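(* Let $E$ be a Dedekind complete real Banach lattice such that its centre $\mathcal Z(E)$ is normal. Take a compact Hausdorff space $X$ and a surjective $\ast$-isomorphism $\widehat{\ \cdot\ }\colon\mathcal Z(E_{\mathbb C})\to C(X,\mathbb C)$. Then there exists a unique regular Borel measure $\mu\colon\mathcal B(X)\to\mathcal Z(E)^+$ such that $$T=\int_X^{o}\widehat T\,d\mu\qquad(\ast)$$ for all $T\in\mathcal Z(E)$. It is a spectral measure, $\mu(\Delta)$ is an order projection for every $\Delta\in\mathcal B(X)$, $\mu(X)=I$, and $(\ast)$ holds for all $T\in\mathcal Z(E_{\mathbb C})$. When $V$ is a non-empty open subset of $X$, $$\mu(V)=\sup\{T: T\in\mathcal Z(E),\ \mathbf 0\le\widehat T\le\mathbf 1,\ \operatorname{supp}\widehat T\subseteq V\}.$$ When $K$ is a non-empty compact subset of $X$, $$\mu(K)=\inf\{T: T\in\mathcal Z(E),\ \mathbf 0\le\widehat T\le\mathbf 1,\ \widehat T(x)=1\text{ for }x\in K\}.$$ Furthermore, $\mu(V)>0$ for every non-empty open subset $V$ of $X$.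
   Context: Operators are linear; $I$ is the identity operator. For a Dedekind complete real Banach lattice $E$, the complexification $E_{\mathbb C}=E+iE$ carries the modulus $|x+iy|=\sup_{\theta}(x\cos\theta+y\sin\theta)$ and the norm $\lVert z\rVert=\lVert\,|z|\,\rVert$. $L_r(E)$ is the Dedekind complete vector lattice of regular operators on $E$, $L_r(E_{\mathbb C})=L_r(E)+iL_r(E)$, and for $T=R+iS$ with $R,S\in L_r(E)$, $|T|=\sup_\theta(R\cos\theta+S\sin\theta)$ and $\overline T=R-iS$. The centres are $\mathcal Z(E)=\{T\in L_r(E):|T|\le\lambda I\text{ for some }\lambda\ge0\}$ (a Dedekind complete vector lattice and an algebra under composition) and $\mathcal Z(E_{\mathbb C})=\{T\in L_r(E_{\mathbb C}):|T|\le\lambda I\text{ for some }\lambda\ge0\}=\mathcal Z(E)+i\mathcal Z(E)$. With involution $T\mapsto\overline T$ and norm $\lVert T\rVert_I=\inf\{\lambda\ge0:|T|\le\lambda I\}$, $\mathcal Z(E_{\mathbb C})$ is a unital commutative $\mathrm C^\ast$-algebra. A real vector lattice is normal when its order continuous dual (the order continuous order bounded functionals) separates its points. $\mathcal B(X)$ is the Borel $\sigma$-algebra of $X$; $\mathbf 0,\mathbf 1$ are constant functions. Measures and integrals: let $F$ be a Dedekind complete real vector lattice (here $F=\mathcal Z(E)$). An $F$-valued measure on a $\sigma$-algebra $\Omega$ is a map $\mu\colon\Omega\to F^+$ with $\mu(\emptyset)=0$ and $\mu(\bigcup_n\Delta_n)=\sup_N\sum_{n=1}^N\mu(\Delta_n)$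 for pairwise disjoint sequences $(\Delta_n)$ in $\Omega$. When $F$ is also an associative algebra, $\mu$ is spectral when $\mu(\Delta_1\cap\Delta_2)=\mu(\Delta_1)\mu(\Delta_2)$ for all $\Delta_1,\Delta_2\in\Omega$. The order integral of $\varphi=\sum_{i=1}^n r_i\chi_{\Delta_i}$ with $r_i\ge0$, $\Delta_i\in\Omega$ is $\int^o\varphi\,d\mu=\sum_i r_i\mu(\Delta_i)$; for bounded measurable $f\ge0$, $\int^o f\,d\mu=\sup_n\int^o\varphi_n\,d\mu$ for any sequence of such functions $\varphi_n\uparrow f$ pointwise (independent of the choice); for bounded measurable real $f$, $\int^o f\,d\mu=\int^o f^+d\mu-\int^o f^-d\mu$; and for bounded measurable complex $f$, $\int^o f\,d\mu=\int^o\operatorname{Re}f\,d\mu+i\int^o\operatorname{Im}f\,d\mu\in F_{\mathbb C}$. A measure $\mu\colon\mathcal B(X)\to F^+$ is a regular Borel measure when $\mu(V)=\sup\{\mu(K):K\subseteq V\text{ compact}\}$ for all open $V$ and $\mu(\Delta)=\inf\{\mu(V):V\supseteq\Delta\text{ open}\}$ for all $\Delta\in\mathcal B(X)$. An order projection is a band projection, i.e., an operator $P$ with $P^2=P$ and $0\le P\le I$. *)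

theory Defs
  imports "HOL-Analysis.Analysis" "HOL-Library.Lub_Glb" "HOL-Library.Lattice_Algebras"
begin

section \<open>Dedekind complete vector lattices and Banach lattices\<close>

class dedekind_complete_vector_lattice =
  ordered_real_vector + conditionally_complete_lattice + lattice_ab_group_add_abs

class dedekind_complete_banach_lattice = dedekind_complete_vector_lattice + banach +
  assumes norm_mono: "\<bar>x\<bar> \<le> \<bar>y\<bar> \<Longrightarrow> norm x \<le> norm y"

instance real :: dedekind_complete_banach_lattice
  by standard (auto simp: sup_real_def)


section \<open>Regular operators\<close>

definition positive_operator :: "('a::dedekind_complete_vector_lattice \<Rightarrow> 'a) \<Rightarrow> bool"
  where "positive_operator T \<longleftrightarrow> linear T \<and> (\<forall>x\<ge>0. 0 \<le> T x)"

definition regular_operator :: "('a::dedekind_complete_vector_lattice \<Rightarrow> 'a) \<Rightarrow> bool"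
  where "regular_operator T \<longleftrightarrow>
    (\<exists>P Q. positive_operator P \<and> positive_operator Q \<and> T = (\<lambda>x. P x - Q x))"

lemma positive_operator_zero: "positive_operator (\<lambda>x. 0)"
  by (auto simp: positive_operator_def intro!: linearI)

lemma positive_operator_id: "positive_operator (\<lambda>x. x)"
  by (auto simp: positive_operator_def intro!: linearI)

lemma positive_operator_add:
  "positive_operator S \<Longrightarrow> positive_operator T \<Longrightarrow> positive_operator (\<lambda>x. S x + T x)"
  by (auto simp: positive_operator_def intro!: linear_compose_add)

lemma positive_operator_scaleR:
  "positive_operator T \<Longrightarrow> 0 \<le> c \<Longrightarrow> positive_operator (\<lambda>x. c *\<^sub>R T x)"
  by (auto simp: positive_operator_def scaleR_nonneg_nonneg intro!: linear_compose_scale_right)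

lemma positive_operator_comp:
  "positive_operator S \<Longrightarrow> positive_operator T \<Longrightarrow> positive_operator (\<lambda>x. S (T x))"
  using linear_compose[of T S] by (auto simp: positive_operator_def o_def)

lemma regular_operatorI:
  assumes "positive_operator P" "positive_operator Q" "\<And>x. T x = P x - Q x"
  shows "regular_operator T"
  using assms by (auto simp: regular_operator_def)

lemma regular_operatorE:
  assumes "regular_operator T"
  obtains P Q where "positive_operator P" "positive_operator Q" "\<And>x. T x = P x - Q x"
  using assms by (auto simp: regular_operator_def)

lemma regular_operator_linear: "regular_operator T \<Longrightarrow> linear T"
  by (auto simp: regular_operator_def positive_operator_def intro: linear_compose_sub)

typedef (overloaded) 'a regop =
  "{T :: 'a::dedekind_complete_vector_lattice \<Rightarrow> 'a. regular_operator T}"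
  morphisms apply_regop Regop
  by (auto intro!: exI[of _ "\<lambda>x. 0"] regular_operatorI positive_operator_zero)

setup_lifting type_definition_regop

lemma linear_apply_regop: "linear (apply_regop T)"
  using apply_regop[of T] by (simp add: regular_operator_linear)

lemma positive_operator_imp_regular: "positive_operator P \<Longrightarrow> regular_operator P"
  by (rule regular_operatorI[OF _ positive_operator_zero]) auto

lemma regular_operator_add:
  assumes "regular_operator S" "regular_operator T"
  shows "regular_operator (\<lambda>x. S x + T x)"
proof -
  obtain P Q P' Q' where *: "positive_operator P" "positive_operator Q" "\<And>x. S x = P x - Q x"
    "positive_operator P'" "positive_operator Q'" "\<And>x. T x = P' x - Q' x"
    using assms by (metis regular_operatorE)
  show ?thesis
    by (rule regular_operatorI[OF positive_operator_add[OF *(1) *(4)]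
          positive_operator_add[OF *(2) *(5)]]) (simp add: *)
qed

lemma regular_operator_uminus:
  assumes "regular_operator T"
  shows "regular_operator (\<lambda>x. - T x)"
proof -
  obtain P Q where *: "positive_operator P" "positive_operator Q" "\<And>x. T x = P x - Q x"
    using assms by (metis regular_operatorE)
  show ?thesis
    by (rule regular_operatorI[OF *(2) *(1)]) (simp add: *)
qed

lemma regular_operator_diff:
  assumes "regular_operator S" "regular_operator T"
  shows "regular_operator (\<lambda>x. S x - T x)"
  using regular_operator_add[OF assms(1) regular_operator_uminus[OF assms(2)]] by simp

lemma regular_operator_scaleR:
  assumes "regular_operator T"
  shows "regular_operator (\<lambda>x. c *\<^sub>R T x)"
proof -
  obtain P Q where *: "positive_operator P" "positive_operator Q" "\<And>x. T x = P x - Q x"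
    using assms by (metis regular_operatorE)
  have nonneg: "regular_operator (\<lambda>x. d *\<^sub>R T x)" if "d \<ge> 0" for d
    by (rule regular_operatorI[OF positive_operator_scaleR[OF *(1) that]
          positive_operator_scaleR[OF *(2) that]]) (simp add: * scaleR_diff_right)
  show ?thesis
  proof (cases "c \<ge> 0")
    case True
    then show ?thesis by (rule nonneg)
  next
    case False
    then have "regular_operator (\<lambda>x. - ((- c) *\<^sub>R T x))"
      by (intro regular_operator_uminus nonneg) auto
    then show ?thesis by simp
  qed
qed

lemma regular_operator_comp:
  assumes "regular_operator S" "regular_operator T"
  shows "regular_operator (\<lambda>x. S (T x))"
proof -
  obtain P Q P' Q' where *: "positive_operator P" "positive_operator Q" "\<And>x. S x = P x - Q x"
    "positive_operator P'" "positive_operator Q'" "\<And>x. T x = P' x - Q' x"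
    using assms by (metis regular_operatorE)
  have lin: "linear P" "linear Q"
    using * by (auto simp: positive_operator_def)
  show ?thesis
    by (rule regular_operatorI[OF
          positive_operator_add[OF positive_operator_comp[OF *(1) *(4)] positive_operator_comp[OF *(2) *(5)]]
          positive_operator_add[OF positive_operator_comp[OF *(1) *(5)] positive_operator_comp[OF *(2) *(4)]]])
       (simp add: * linear_diff[OF lin(1)] linear_diff[OF lin(2)])
qed


subsection \<open>Vector space, algebra and order structure\<close>

instantiation regop :: (dedekind_complete_vector_lattice) real_vector
begin

lift_definition zero_regop :: "'a regop" is "\<lambda>x. 0"
  by (intro positive_operator_imp_regular positive_operator_zero)
lift_definition plus_regop :: "'a regop \<Rightarrow> 'a regop \<Rightarrow> 'a regop" is "\<lambda>S T x. S x + T x"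
  by (rule regular_operator_add)
lift_definition minus_regop :: "'a regop \<Rightarrow> 'a regop \<Rightarrow> 'a regop" is "\<lambda>S T x. S x - T x"
  by (rule regular_operator_diff)
lift_definition uminus_regop :: "'a regop \<Rightarrow> 'a regop" is "\<lambda>T x. - T x"
  by (rule regular_operator_uminus)
lift_definition scaleR_regop :: "real \<Rightarrow> 'a regop \<Rightarrow> 'a regop" is "\<lambda>c T x. c *\<^sub>R T x"
  by (rule regular_operator_scaleR)

instance
  by standard (transfer; auto simp: algebra_simps)+

end

instantiation regop :: (dedekind_complete_vector_lattice) real_algebra
begin

text \<open>The product of operators is composition. There is no \<^term>\<open>1\<close>, since the type class for
  unital rings would exclude the zero lattice; the identity operator is a separate constant.\<close>

lift_definition times_regop :: "'a regop \<Rightarrow> 'a regop \<Rightarrow> 'a regop" is "\<lambda>S T x. S (T x)"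
  by (rule regular_operator_comp)

instance
  by standard (transfer; auto simp: fun_eq_iff dest!: regular_operator_linear
      simp: linear_add linear_scale)+

end

lift_definition id_regop :: "'a::dedekind_complete_vector_lattice regop" is "\<lambda>x. x"
  by (intro positive_operator_imp_regular positive_operator_id)

lemma linear_eq_on_cone:
  fixes S T :: "'a::dedekind_complete_vector_lattice \<Rightarrow> 'a"
  assumes "linear S" "linear T" "\<And>x. 0 \<le> x \<Longrightarrow> S x = T x"
  shows "S = T"
proof
  fix x :: 'a
  have x: "x = pprt x - (- nprt x)"
    using prts[of x] by simp
  have "S (pprt x - (- nprt x)) = T (pprt x - (- nprt x))"
    unfolding linear_diff[OF assms(1)] linear_diff[OF assms(2)] by (simp add: assms(3))
  then show "S x = T x"
    using x by simp
qed

instantiation regop :: (dedekind_complete_vector_lattice) ordered_real_vector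
begin

lift_definition less_eq_regop :: "'a regop \<Rightarrow> 'a regop \<Rightarrow> bool" is "\<lambda>S T. \<forall>x\<ge>0. S x \<le> T x" .

definition less_regop :: "'a regop \<Rightarrow> 'a regop \<Rightarrow> bool"
  where "less_regop S T \<longleftrightarrow> S \<le> T \<and> \<not> T \<le> S"

instance
proof
  fix S T U :: "'a regop" and a b :: real
  show "S < T \<longleftrightarrow> S \<le> T \<and> \<not> T \<le> S" by (rule less_regop_def)
  show "S \<le> S" by transfer simp
  show "S \<le> T \<Longrightarrow> T \<le> U \<Longrightarrow> S \<le> U" by transfer (meson order_trans)
  show "S \<le> T \<Longrightarrow> T \<le> S \<Longrightarrow> S = T"
    by transfer (auto intro: linear_eq_on_cone regular_operator_linear order.antisym)
  show "S \<le> T \<Longrightarrow> U + S \<le> U + T" by transfer simp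
  show "S \<le> T \<Longrightarrow> 0 \<le> a \<Longrightarrow> a *\<^sub>R S \<le> a *\<^sub>R T" by transfer (simp add: scaleR_left_mono)
  show "a \<le> b \<Longrightarrow> 0 \<le> S \<Longrightarrow> a *\<^sub>R S \<le> b *\<^sub>R S" by transfer (simp add: scaleR_right_mono)
qed

end


subsection \<open>Lattice structure (Riesz-Kantorovich)\<close>

text \<open>\<open>rk_sums A x s\<close>: \<^term>\<open>s\<close> is of the form \<open>T\<^sub>1 x\<^sub>1 + \<dots> + T\<^sub>n x\<^sub>n\<close> with
  \<open>T\<^sub>i \<in> A\<close>, \<open>x\<^sub>i \<ge> 0\<close> and \<open>x\<^sub>1 + \<dots> + x\<^sub>n = x\<close>.\<close>

inductive rk_sums :: "('a::dedekind_complete_vector_lattice \<Rightarrow> 'a) set \<Rightarrow> 'a \<Rightarrow> 'a \<Rightarrow> bool"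
  for A where
  rk_0: "rk_sums A 0 0"
| rk_add: "T \<in> A \<Longrightarrow> 0 \<le> y \<Longrightarrow> rk_sums A x s \<Longrightarrow> rk_sums A (y + x) (T y + s)"

definition rk_sup_cone :: "('a::dedekind_complete_vector_lattice \<Rightarrow> 'a) set \<Rightarrow> 'a \<Rightarrow> 'a"
  where "rk_sup_cone A x = Sup {s. rk_sums A x s}"

definition rk_sup :: "('a::dedekind_complete_vector_lattice \<Rightarrow> 'a) set \<Rightarrow> 'a \<Rightarrow> 'a"
  where "rk_sup A x = rk_sup_cone A (pprt x) - rk_sup_cone A (- nprt x)"

lemma rk_sums_nonneg: "rk_sums A x s \<Longrightarrow> 0 \<le> x"
  by (induction rule: rk_sums.induct) auto

lemma rk_sums_add: "rk_sums A x s \<Longrightarrow> rk_sums A y t \<Longrightarrow> rk_sums A (x + y) (s + t)"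
  by (induction rule: rk_sums.induct) (auto simp: add.assoc intro: rk_add)

lemma rk_sums_single: "T \<in> A \<Longrightarrow> 0 \<le> x \<Longrightarrow> rk_sums A x (T x)"
  using rk_add[OF _ _ rk_0, of T A x] by simp

lemma rk_sums_scaleR:
  "rk_sums A x s \<Longrightarrow> (\<And>T. T \<in> A \<Longrightarrow> linear T) \<Longrightarrow> 0 \<le> c \<Longrightarrow> rk_sums A (c *\<^sub>R x) (c *\<^sub>R s)"
proof (induction rule: rk_sums.induct)
  case (rk_add T y x s)
  then have "rk_sums A (c *\<^sub>R y + c *\<^sub>R x) (T (c *\<^sub>R y) + c *\<^sub>R s)"
    by (intro rk_sums.rk_add) (auto simp: scaleR_nonneg_nonneg)
  with rk_add show ?case
    by (simp add: scaleR_add_right linear_scale)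
qed (auto intro: rk_0)

lemma rk_sums_upper:
  "rk_sums A x s \<Longrightarrow> linear u \<Longrightarrow> \<forall>T\<in>A. \<forall>y\<ge>0. T y \<le> u y \<Longrightarrow> s \<le> u x"
  by (induction rule: rk_sums.induct) (auto simp: linear_0 linear_add intro: add_mono)

lemma rk_sums_split:
  assumes "rk_sums A z s" "\<And>T. T \<in> A \<Longrightarrow> linear T" "z = x + y" "0 \<le> x" "0 \<le> y"
  shows "\<exists>s1 s2. rk_sums A x s1 \<and> rk_sums A y s2 \<and> s = s1 + s2"
  using assms
proof (induction arbitrary: x y rule: rk_sums.induct)
  case rk_0
  then have "x = 0" "y = 0"
    using add_nonneg_eq_0_iff[of x y] by auto
  then show ?case
    by (auto intro!: exI[of _ 0] rk_sums.rk_0)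
next
  case (rk_add T w z s)
  define w1 where "w1 = inf w x"
  define w2 where "w2 = w - w1"
  have z: "0 \<le> z"
    using rk_add.hyps by (auto dest: rk_sums_nonneg)
  have "w - x \<le> y"
    using z rk_add.prems(2) by (simp add: algebra_simps) (metis add_increasing2 add.commute order_refl)
  moreover have "w2 = sup 0 (w - x)"
    by (simp add: w1_def w2_def diff_inf_eq_sup add_sup_distrib_left)
  ultimately have "w2 \<le> y" "0 \<le> w2"
    using rk_add.prems by auto
  then have w: "0 \<le> w1" "0 \<le> w2" "w = w1 + w2" "w1 \<le> x" "w2 \<le> y"
    using rk_add.hyps rk_add.prems by (auto simp: w1_def w2_def simp del: diff_inf_eq_sup)
  have "z = (x - w1) + (y - w2)"
    using rk_add.prems(2) w(3) by (simp add: algebra_simps)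
  then obtain s1 s2 where s: "rk_sums A (x - w1) s1" "rk_sums A (y - w2) s2" "s = s1 + s2"
    using rk_add.IH[OF rk_add.prems(1), of "x - w1" "y - w2"] w by auto
  have "rk_sums A x (T w1 + s1)" "rk_sums A y (T w2 + s2)"
    using rk_sums.rk_add[OF rk_add.hyps(1) w(1) s(1)] rk_sums.rk_add[OF rk_add.hyps(1) w(2) s(2)]
    by auto
  moreover have "T w + s = (T w1 + s1) + (T w2 + s2)"
    using rk_add.prems(1)[OF rk_add.hyps(1)] by (simp add: w(3) linear_add s(3))
  ultimately show ?case by blast
qed

context
  fixes A :: "('a::dedekind_complete_vector_lattice \<Rightarrow> 'a) set" and u :: "'a \<Rightarrow> 'a"
  assumes nonempty: "A \<noteq> {}"
    and lin: "\<And>T. T \<in> A \<Longrightarrow> linear T"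
    and u_lin: "linear u"
    and u_ub: "\<forall>T\<in>A. \<forall>y\<ge>0. T y \<le> u y"
begin

lemma rk_bdd: "bdd_above {s. rk_sums A x s}"
  using rk_sums_upper[OF _ u_lin u_ub] by (intro bdd_aboveI[of _ "u x"]) auto

lemma rk_nonempty: "0 \<le> x \<Longrightarrow> {s. rk_sums A x s} \<noteq> {}"
  using nonempty rk_sums_single by blast

lemma rk_upper: "rk_sums A x s \<Longrightarrow> s \<le> rk_sup_cone A x"
  unfolding rk_sup_cone_def by (intro cSup_upper rk_bdd) auto

lemma rk_least: "0 \<le> x \<Longrightarrow> (\<And>s. rk_sums A x s \<Longrightarrow> s \<le> b) \<Longrightarrow> rk_sup_cone A x \<le> b"
  unfolding rk_sup_cone_def by (intro cSup_least rk_nonempty) auto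

lemma rk_sup_cone_add:
  assumes "0 \<le> x" "0 \<le> y"
  shows "rk_sup_cone A (x + y) = rk_sup_cone A x + rk_sup_cone A y"
proof (rule order.antisym)
  show "rk_sup_cone A (x + y) \<le> rk_sup_cone A x + rk_sup_cone A y"
  proof (rule rk_least)
    fix s assume "rk_sums A (x + y) s"
    then obtain s1 s2 where "rk_sums A x s1" "rk_sums A y s2" "s = s1 + s2"
      using rk_sums_split[OF _ lin refl assms] by blast
    then show "s \<le> rk_sup_cone A x + rk_sup_cone A y"
      by (auto intro!: add_mono rk_upper)
  qed (use assms in auto)
  have "rk_sup_cone A x \<le> rk_sup_cone A (x + y) - rk_sup_cone A y"
  proof (rule rk_least[OF assms(1)])
    fix s assume s: "rk_sums A x s"
    have "rk_sup_cone A y \<le> rk_sup_cone A (x + y) - s"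
    proof (rule rk_least[OF assms(2)])
      fix t assume "rk_sums A y t"
      then have "s + t \<le> rk_sup_cone A (x + y)"
        using s by (intro rk_upper rk_sums_add)
      then show "t \<le> rk_sup_cone A (x + y) - s"
        by (simp add: algebra_simps)
    qed
    then show "s \<le> rk_sup_cone A (x + y) - rk_sup_cone A y"
      by (simp add: algebra_simps)
  qed
  then show "rk_sup_cone A x + rk_sup_cone A y \<le> rk_sup_cone A (x + y)"
    by (simp add: algebra_simps)
qed

lemma rk_sup_cone_scaleR:
  assumes "0 \<le> x" "0 < c"
  shows "rk_sup_cone A (c *\<^sub>R x) = c *\<^sub>R rk_sup_cone A x"
proof -
  have le: "c *\<^sub>R rk_sup_cone A x \<le> rk_sup_cone A (c *\<^sub>R x)" if "0 \<le> x" "0 < c" for c x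
  proof -
    have "rk_sup_cone A x \<le> inverse c *\<^sub>R rk_sup_cone A (c *\<^sub>R x)"
    proof (rule rk_least[OF that(1)])
      fix s assume "rk_sums A x s"
      then have "c *\<^sub>R s \<le> rk_sup_cone A (c *\<^sub>R x)"
        using that by (intro rk_upper rk_sums_scaleR lin) auto
      then have "inverse c *\<^sub>R (c *\<^sub>R s) \<le> inverse c *\<^sub>R rk_sup_cone A (c *\<^sub>R x)"
        using that by (intro scaleR_left_mono) auto
      then show "s \<le> inverse c *\<^sub>R rk_sup_cone A (c *\<^sub>R x)"
        using that by simp
    qed
    then have "c *\<^sub>R rk_sup_cone A x \<le> c *\<^sub>R (inverse c *\<^sub>R rk_sup_cone A (c *\<^sub>R x))"
      using that by (intro scaleR_left_mono) auto
    then show ?thesis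
      using that by simp
  qed
  have "inverse c *\<^sub>R rk_sup_cone A (c *\<^sub>R x) \<le> rk_sup_cone A (inverse c *\<^sub>R (c *\<^sub>R x))"
    using assms by (intro le) (auto simp: scaleR_nonneg_nonneg)
  then have "inverse c *\<^sub>R rk_sup_cone A (c *\<^sub>R x) \<le> rk_sup_cone A x"
    using assms by simp
  then have "c *\<^sub>R (inverse c *\<^sub>R rk_sup_cone A (c *\<^sub>R x)) \<le> c *\<^sub>R rk_sup_cone A x"
    using assms by (intro scaleR_left_mono) auto
  then have "rk_sup_cone A (c *\<^sub>R x) \<le> c *\<^sub>R rk_sup_cone A x"
    using assms by simp
  with le[OF assms] show ?thesis
    by (rule order.antisym[rotated])
qed

lemma rk_sup_diff:
  assumes "0 \<le> a" "0 \<le> b"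
  shows "rk_sup A (a - b) = rk_sup_cone A a - rk_sup_cone A b"
proof -
  let ?x = "a - b"
  have "pprt ?x + b = a + (- nprt ?x)"
    using prts[of ?x] by (simp add: algebra_simps)
  then have "rk_sup_cone A (pprt ?x + b) = rk_sup_cone A (a + (- nprt ?x))"
    by simp
  then have "rk_sup_cone A (pprt ?x) + rk_sup_cone A b =
      rk_sup_cone A a + rk_sup_cone A (- nprt ?x)"
    using assms by (simp only: rk_sup_cone_add zero_le_pprt neg_0_le_iff_le nprt_le_zero)
  then show ?thesis
    by (simp add: rk_sup_def algebra_simps)
qed

lemma rk_sup_eq: "0 \<le> x \<Longrightarrow> rk_sup A x = rk_sup_cone A x"
  using rk_sup_diff[of x 0] rk_sup_cone_add[of 0 0] by simp

lemma rk_sup_linear: "linear (rk_sup A)"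
proof (rule linearI)
  have decomp: "z = pprt z - (- nprt z)" for z :: 'a
    using prts[of z] by simp
  show "rk_sup A (x + y) = rk_sup A x + rk_sup A y" for x y
  proof -
    have "x + y = (pprt x + pprt y) - ((- nprt x) + (- nprt y))"
      using arg_cong2[OF prts[of x] prts[of y], of plus] by (simp add: algebra_simps)
    then have "rk_sup A (x + y) =
        rk_sup_cone A (pprt x + pprt y) - rk_sup_cone A ((- nprt x) + (- nprt y))"
      using rk_sup_diff[of "pprt x + pprt y" "(- nprt x) + (- nprt y)"]
      by (simp only: add_nonneg_nonneg zero_le_pprt neg_0_le_iff_le nprt_le_zero)
    also have "\<dots> = (rk_sup_cone A (pprt x) + rk_sup_cone A (pprt y))
        - (rk_sup_cone A (- nprt x) + rk_sup_cone A (- nprt y))"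
      by (simp only: rk_sup_cone_add zero_le_pprt neg_0_le_iff_le nprt_le_zero)
    also have "\<dots> = rk_sup A x + rk_sup A y"
      unfolding rk_sup_def by (simp add: algebra_simps)
    finally show ?thesis .
  qed
  have pos: "rk_sup A (c *\<^sub>R x) = c *\<^sub>R rk_sup A x" if "0 < c" for c x
  proof -
    have "c *\<^sub>R x = c *\<^sub>R pprt x - c *\<^sub>R (- nprt x)"
      using decomp[of x] by (metis scaleR_diff_right)
    then have "rk_sup A (c *\<^sub>R x) =
        rk_sup_cone A (c *\<^sub>R pprt x) - rk_sup_cone A (c *\<^sub>R (- nprt x))"
      using that rk_sup_diff[of "c *\<^sub>R pprt x" "c *\<^sub>R (- nprt x)"]
      by (simp only: scaleR_nonneg_nonneg less_imp_le zero_le_pprt neg_0_le_iff_le nprt_le_zero)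
    also have "\<dots> = c *\<^sub>R rk_sup A x"
      using that unfolding rk_sup_def
      by (simp only: rk_sup_cone_scaleR zero_le_pprt neg_0_le_iff_le nprt_le_zero scaleR_diff_right)
    finally show ?thesis .
  qed
  have neg: "rk_sup A (- x) = - rk_sup A x" for x
    unfolding rk_sup_def pprt_neg nprt_neg by simp
  show "rk_sup A (c *\<^sub>R x) = c *\<^sub>R rk_sup A x" for c x
  proof (cases c "0::real" rule: linorder_cases)
    case less
    then have "rk_sup A (- ((- c) *\<^sub>R x)) = - ((- c) *\<^sub>R rk_sup A x)"
      unfolding neg by (subst pos) auto
    then show ?thesis by simp
  next
    case equal
    then show ?thesis by (simp add: rk_sup_def)
  next
    case greater
    then show ?thesis by (rule pos)
  qed
qed

lemma rk_sup_upper: "T \<in> A \<Longrightarrow> 0 \<le> x \<Longrightarrow> T x \<le> rk_sup A x"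
  by (simp add: rk_sup_eq rk_upper rk_sums_single)

lemma rk_sup_least:
  assumes "linear v" "\<forall>T\<in>A. \<forall>y\<ge>0. T y \<le> v y" "0 \<le> x"
  shows "rk_sup A x \<le> v x"
  unfolding rk_sup_eq[OF assms(3)]
  by (rule rk_least[OF assms(3)]) (rule rk_sums_upper[OF _ assms(1,2)])

lemma rk_sup_regular:
  assumes "regular_operator u"
  shows "regular_operator (rk_sup A)"
proof -
  have "positive_operator (\<lambda>x. u x - rk_sup A x)"
    using rk_sup_least[OF u_lin u_ub]
    by (auto simp: positive_operator_def intro!: linear_compose_sub u_lin rk_sup_linear)
  then show ?thesis
    using regular_operator_diff[OF assms positive_operator_imp_regular] by fastforce
qed

end

instantiation regop :: (dedekind_complete_vector_lattice) dedekind_complete_vector_lattice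
begin

definition Sup_regop :: "'a regop set \<Rightarrow> 'a regop"
  where "Sup_regop A = Regop (rk_sup (apply_regop ` A))"

definition Inf_regop :: "'a regop set \<Rightarrow> 'a regop"
  where "Inf_regop A = - Sup (uminus ` A)"

definition sup_regop :: "'a regop \<Rightarrow> 'a regop \<Rightarrow> 'a regop"
  where "sup_regop S T = Sup {S, T}"

definition inf_regop :: "'a regop \<Rightarrow> 'a regop \<Rightarrow> 'a regop"
  where "inf_regop S T = - Sup {- S, - T}"

definition abs_regop :: "'a regop \<Rightarrow> 'a regop"
  where "abs_regop T = sup T (- T)"

lemma Sup_regop_props:
  fixes A :: "'a regop set"
  assumes ne: "A \<noteq> {}" and U: "\<And>T. T \<in> A \<Longrightarrow> T \<le> U"
  shows "T \<in> A \<Longrightarrow> T \<le> Sup A"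
    and "(\<And>T. T \<in> A \<Longrightarrow> T \<le> V) \<Longrightarrow> Sup A \<le> V"
proof -
  let ?A = "apply_regop ` A"
  have 1: "?A \<noteq> {}" using ne by simp
  have 2: "linear T" if "T \<in> ?A" for T
    using that by (auto intro: linear_apply_regop)
  have 3: "\<forall>T\<in>?A. \<forall>y\<ge>0. T y \<le> apply_regop U y"
    using U by (auto simp: less_eq_regop.rep_eq)
  note props = 1 2 linear_apply_regop[of U] 3
  have Sup: "apply_regop (Sup A) = rk_sup ?A"
    unfolding Sup_regop_def
    using rk_sup_regular[OF props] apply_regop[of U] by (subst Regop_inverse) auto
  show "T \<in> A \<Longrightarrow> T \<le> Sup A"
    using rk_sup_upper[OF props] by (auto simp: less_eq_regop.rep_eq Sup)
  show "Sup A \<le> V" if "\<And>T. T \<in> A \<Longrightarrow> T \<le> V"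
    using rk_sup_least[OF props linear_apply_regop[of V]] that
    by (auto simp: less_eq_regop.rep_eq Sup)
qed

lemma regop_ub2: "\<exists>U. S \<le> U \<and> T \<le> (U :: 'a regop)"
proof -
  obtain P Q where PQ: "positive_operator P" "positive_operator Q" "\<And>x. apply_regop S x = P x - Q x"
    using apply_regop[of S] by (auto elim: regular_operatorE)
  obtain P' Q' where PQ': "positive_operator P'" "positive_operator Q'" "\<And>x. apply_regop T x = P' x - Q' x"
    using apply_regop[of T] by (auto elim: regular_operatorE)
  define U where "U = Regop (\<lambda>x. P x + P' x)"
  have U: "apply_regop U = (\<lambda>x. P x + P' x)"
    unfolding U_def
    using positive_operator_imp_regular[OF positive_operator_add[OF PQ(1) PQ'(1)]]
    by (simp add: Regop_inverse)
  have "P x - Q x \<le> P x + P' x" "P' x - Q' x \<le> P x + P' x" if "0 \<le> x" for x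
  proof -
    have nn: "0 \<le> P x" "0 \<le> P' x" "0 \<le> Q x" "0 \<le> Q' x"
      using that PQ PQ' by (auto simp: positive_operator_def)
    show "P x - Q x \<le> P x + P' x"
      using add_mono[OF order_refl[of "P x"] add_nonneg_nonneg[OF nn(2,3)]]
      by (simp add: algebra_simps)
    show "P' x - Q' x \<le> P x + P' x"
      using add_mono[OF order_refl[of "P' x"] add_nonneg_nonneg[OF nn(1,4)]]
      by (simp add: algebra_simps)
  qed
  then show ?thesis
    by (intro exI[of _ U]) (auto simp: less_eq_regop.rep_eq U PQ(3) PQ'(3))
qed

instance
proof
  fix S T U :: "'a regop" and A :: "'a regop set"
  have sup2: "S \<le> Sup {S, T}" "T \<le> Sup {S, T}" "S \<le> U \<Longrightarrow> T \<le> U \<Longrightarrow> Sup {S, T} \<le> U"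
    for S T U :: "'a regop"
  proof -
    obtain W where W: "S \<le> W" "T \<le> W" using regop_ub2 by blast
    then have W': "X \<le> W" if "X \<in> {S, T}" for X using that by auto
    show "S \<le> Sup {S, T}" "T \<le> Sup {S, T}"
      by (rule Sup_regop_props(1)[of _ W]; use W' in blast)+
    show "S \<le> U \<Longrightarrow> T \<le> U \<Longrightarrow> Sup {S, T} \<le> U"
      by (rule Sup_regop_props(2)[of _ U]; blast)
  qed
  show "S \<le> sup S T" "T \<le> sup S T" by (auto simp: sup_regop_def sup2)
  show "T \<le> S \<Longrightarrow> U \<le> S \<Longrightarrow> sup T U \<le> S" by (auto simp: sup_regop_def sup2)
  show "inf S T \<le> S" "inf S T \<le> T"
    using sup2(1,2)[where S = "- S" and T = "- T"] by (auto simp: inf_regop_def minus_le_iff)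
  show "S \<le> T \<Longrightarrow> S \<le> U \<Longrightarrow> S \<le> inf T U"
    using sup2(3)[of "- T" "- S" "- U"] by (auto simp: inf_regop_def le_minus_iff)
  show "\<bar>S\<bar> = sup S (- S)" by (rule abs_regop_def)
  show "S \<le> Sup A" if "S \<in> A" "bdd_above A"
    using that Sup_regop_props(1)[of A _ S] by (auto simp: bdd_above_def)
  show "Sup A \<le> S" if "A \<noteq> {}" "\<And>T. T \<in> A \<Longrightarrow> T \<le> S"
    using Sup_regop_props(2)[OF that] that by blast
  show "Inf A \<le> S" if S: "S \<in> A" and bdd: "bdd_below A"
  proof -
    obtain B where "\<And>T. T \<in> A \<Longrightarrow> B \<le> T" using bdd by (auto simp: bdd_below_def)
    then have "T \<le> - B" if "T \<in> uminus ` A" for T using that by auto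
    then have "- S \<le> Sup (uminus ` A)"
      by (rule Sup_regop_props(1)[of _ "- B", rotated]) (use S in auto)
    then show ?thesis by (simp add: Inf_regop_def minus_le_iff)
  qed
  show "S \<le> Inf A" if ne: "A \<noteq> {}" and lb: "\<And>T. T \<in> A \<Longrightarrow> S \<le> T"
  proof -
    have "T \<le> - S" if "T \<in> uminus ` A" for T using lb that by auto
    then have "Sup (uminus ` A) \<le> - S"
      by (intro Sup_regop_props(2)[of _ "- S"]) (use ne in simp_all)
    then show ?thesis by (simp add: Inf_regop_def le_minus_iff)
  qed
qed

end


section \<open>Complexification\<close>

text \<open>\<open>Cplx x y\<close> stands for \<open>x + iy\<close>. The type constructor is used for complexifications of
  vector lattices and of operator spaces alike.\<close>

datatype 'a complexification = Cplx (re_part: 'a) (im_part: 'a)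

lemma complexification_eq_iff: "z = w \<longleftrightarrow> re_part z = re_part w \<and> im_part z = im_part w"
  by (cases z; cases w) simp

instantiation complexification :: (ring) ring
begin

definition "0 = Cplx 0 0"
definition "z + w = Cplx (re_part z + re_part w) (im_part z + im_part w)"
definition "z - w = Cplx (re_part z - re_part w) (im_part z - im_part w)"
definition "- z = Cplx (- re_part z) (- im_part z)"
definition "z * w = Cplx (re_part z * re_part w - im_part z * im_part w)
                         (re_part z * im_part w + im_part z * re_part w)"

instance
  by standard (auto simp: complexification_eq_iff zero_complexification_def
      plus_complexification_def minus_complexification_def uminus_complexification_def
      times_complexification_def algebra_simps)

end

definition cscale :: "complex \<Rightarrow> 'a::real_vector complexification \<Rightarrow> 'a complexification"
  where "cscale c z = Cplx (Re c *\<^sub>R re_part z - Im c *\<^sub>R im_part z)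
                           (Re c *\<^sub>R im_part z + Im c *\<^sub>R re_part z)"

definition cconj :: "'a::ab_group_add complexification \<Rightarrow> 'a complexification"
  where "cconj z = Cplx (re_part z) (- im_part z)"

definition cmodulus :: "'a::dedekind_complete_vector_lattice complexification \<Rightarrow> 'a"
  where "cmodulus z = (SUP \<theta>. cos \<theta> *\<^sub>R re_part z + sin \<theta> *\<^sub>R im_part z)"

lemma cmodulus_bdd_above:
  fixes z :: "'a::dedekind_complete_vector_lattice complexification"
  shows "bdd_above (range (\<lambda>\<theta>. cos \<theta> *\<^sub>R re_part z + sin \<theta> *\<^sub>R im_part z))"
proof -
  have le: "c *\<^sub>R x \<le> \<bar>x\<bar>" if "\<bar>c\<bar> \<le> 1" for c :: real and x :: 'a
  proof (cases "0 \<le> c")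
    case True
    then have "c *\<^sub>R x \<le> c *\<^sub>R \<bar>x\<bar>"
      by (intro scaleR_left_mono) (auto simp: abs_ge_self)
    also have "\<dots> \<le> 1 *\<^sub>R \<bar>x\<bar>"
      using that by (intro scaleR_right_mono) auto
    finally show ?thesis by simp
  next
    case False
    then have "(- c) *\<^sub>R (- x) \<le> (- c) *\<^sub>R \<bar>x\<bar>"
      by (intro scaleR_left_mono) (auto simp: abs_ge_minus_self)
    also have "\<dots> \<le> 1 *\<^sub>R \<bar>x\<bar>"
      using that by (intro scaleR_right_mono) auto
    finally show ?thesis by simp
  qed
  show ?thesis
    by (intro bdd_aboveI[of _ "\<bar>re_part z\<bar> + \<bar>im_part z\<bar>"])
       (auto intro!: add_mono le simp: abs_cos_le_one abs_sin_le_one)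
qed

text \<open>The action of \<open>R + iS\<close> as a complex linear operator on the complexified lattice. Under it the
  product of \<^typ>\<open>'a regop complexification\<close> is composition, so this type, as an algebra, is the
  algebra of regular operators on the complexified lattice.\<close>

definition apply_cregop ::
    "'a::dedekind_complete_vector_lattice regop complexification
      \<Rightarrow> 'a complexification \<Rightarrow> 'a complexification"
  where "apply_cregop T z =
    Cplx (apply_regop (re_part T) (re_part z) - apply_regop (im_part T) (im_part z))
         (apply_regop (re_part T) (im_part z) + apply_regop (im_part T) (re_part z))"

lemma apply_cregop_times: "apply_cregop (S * T) z = apply_cregop S (apply_cregop T z)"
  by (simp add: apply_cregop_def times_complexification_def times_regop.rep_eq plus_regop.rep_eq
      minus_regop.rep_eq linear_add[OF linear_apply_regop] linear_diff[OF linear_apply_regop])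

lemma apply_cregop_inject: "apply_cregop S = apply_cregop T \<longleftrightarrow> S = T"
proof
  assume eq: "apply_cregop S = apply_cregop T"
  have "apply_regop (re_part S) x = apply_regop (re_part T) x \<and>
        apply_regop (im_part S) x = apply_regop (im_part T) x" for x
    using fun_cong[OF eq, of "Cplx x 0"]
    by (simp add: apply_cregop_def linear_0[OF linear_apply_regop])
  then show "S = T"
    by (auto simp: complexification_eq_iff simp flip: apply_regop_inject)
qed simp


section \<open>Centres\<close>

definition centre :: "'a::dedekind_complete_vector_lattice regop set"
  where "centre = {T. \<exists>l::real. l \<ge> 0 \<and> \<bar>T\<bar> \<le> l *\<^sub>R id_regop}"

definition complex_centre :: "'a::dedekind_complete_vector_lattice regop complexification set"
  where "complex_centre = {T. \<exists>l::real. l \<ge> 0 \<and> cmodulus T \<le> l *\<^sub>R id_regop}"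

definition order_projection :: "'a::dedekind_complete_vector_lattice regop \<Rightarrow> bool"
  where "order_projection P \<longleftrightarrow> P * P = P \<and> 0 \<le> P \<and> P \<le> id_regop"


section \<open>Normal vector lattices\<close>

text \<open>In this section and the next, the vector lattice \<^term>\<open>F\<close> is a linear sublattice of the
  ambient type, such as \<^term>\<open>centre\<close>. Suprema and infima are taken in \<^term>\<open>F\<close>.

  Nets are represented by filters: a filter on \<^term>\<open>F\<close> converges in order to \<open>0\<close> when
  it is eventually dominated by every element of some downward directed subset of \<^term>\<open>F\<close>
  with infimum \<open>0\<close> (that is, of some net decreasing to \<open>0\<close>).\<close>

definition decreases_to_zero :: "'f::dedekind_complete_vector_lattice set \<Rightarrow> 'f set \<Rightarrow> bool"
  where "decreases_to_zero F D \<longleftrightarrow> D \<noteq> {} \<and> D \<subseteq> F \<and>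
    (\<forall>x\<in>D. \<forall>y\<in>D. \<exists>z\<in>D. z \<le> x \<and> z \<le> y) \<and> isGlb F D 0"

definition order_null :: "'f::dedekind_complete_vector_lattice set \<Rightarrow> 'f filter \<Rightarrow> bool"
  where "order_null F \<F> \<longleftrightarrow> (\<forall>\<^sub>F x in \<F>. x \<in> F) \<and>
    (\<exists>D. decreases_to_zero F D \<and> (\<forall>d\<in>D. \<forall>\<^sub>F x in \<F>. \<bar>x\<bar> \<le> d))"

definition order_continuous_dual ::
    "'f::dedekind_complete_vector_lattice set \<Rightarrow> ('f \<Rightarrow> real) set"
  where "order_continuous_dual F = {\<phi>.
    (\<forall>x\<in>F. \<forall>y\<in>F. \<phi> (x + y) = \<phi> x + \<phi> y) \<and> (\<forall>c. \<forall>x\<in>F. \<phi> (c *\<^sub>R x) = c * \<phi> x) \<and>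
    (\<forall>a\<in>F. \<forall>b\<in>F. bounded (\<phi> ` {x\<in>F. a \<le> x \<and> x \<le> b})) \<and>
    (\<forall>\<F>. order_null F \<F> \<longrightarrow> (\<phi> \<longlongrightarrow> 0) \<F>)}"

definition normal_lattice :: "'f::dedekind_complete_vector_lattice set \<Rightarrow> bool"
  where "normal_lattice F \<longleftrightarrow>
    (\<forall>x\<in>F. \<forall>y\<in>F. x \<noteq> y \<longrightarrow> (\<exists>\<phi>\<in>order_continuous_dual F. \<phi> x \<noteq> \<phi> y))"


section \<open>Vector-valued measures and order integrals\<close>

text \<open>As usual in HOL-Analysis, \<^term>\<open>M\<close> carries the measurable space
  \<open>(space M, sets M)\<close>; its own measure plays no role.\<close>

definition lattice_measure ::
    "'f::dedekind_complete_vector_lattice set \<Rightarrow> 'x measure \<Rightarrow> ('x set \<Rightarrow> 'f) \<Rightarrow> bool"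
  where "lattice_measure F M \<mu> \<longleftrightarrow>
    (\<forall>\<Delta>\<in>sets M. \<mu> \<Delta> \<in> F \<and> 0 \<le> \<mu> \<Delta>) \<and> \<mu> {} = 0 \<and>
    (\<forall>\<Delta>::nat \<Rightarrow> 'x set. range \<Delta> \<subseteq> sets M \<longrightarrow> disjoint_family \<Delta> \<longrightarrow>
      isLub F (range (\<lambda>N. \<Sum>n<N. \<mu> (\<Delta> n))) (\<mu> (\<Union>n. \<Delta> n)))"

definition spectral :: "'x measure \<Rightarrow> ('x set \<Rightarrow> 'f::times) \<Rightarrow> bool"
  where "spectral M \<mu> \<longleftrightarrow>
    (\<forall>\<Delta>\<^sub>1\<in>sets M. \<forall>\<Delta>\<^sub>2\<in>sets M. \<mu> (\<Delta>\<^sub>1 \<inter> \<Delta>\<^sub>2) = \<mu> \<Delta>\<^sub>1 * \<mu> \<Delta>\<^sub>2)"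

definition simple_order_integral ::
    "'x measure \<Rightarrow> ('x set \<Rightarrow> 'f::real_vector) \<Rightarrow> ('x \<Rightarrow> real) \<Rightarrow> 'f"
  where "simple_order_integral M \<mu> f = (\<Sum>r\<in>f ` space M. r *\<^sub>R \<mu> (f -` {r} \<inter> space M))"

definition simple_approximation :: "'x measure \<Rightarrow> (nat \<Rightarrow> 'x \<Rightarrow> real) \<Rightarrow> ('x \<Rightarrow> real) \<Rightarrow> bool"
  where "simple_approximation M s f \<longleftrightarrow>
    (\<forall>n. simple_function M (s n) \<and> (\<forall>x\<in>space M. 0 \<le> s n x)) \<and>
    (\<forall>x\<in>space M. incseq (\<lambda>n. s n x) \<and> (\<lambda>n. s n x) \<longlonglongrightarrow> f x)"

text \<open>The order integrals below are meaningful for bounded measurable functions; the first of them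
  requires nonnegativity as well. The value does not depend on the approximating sequence.\<close>

definition order_integral_nonneg ::
    "'f::dedekind_complete_vector_lattice set \<Rightarrow> 'x measure \<Rightarrow> ('x set \<Rightarrow> 'f) \<Rightarrow> ('x \<Rightarrow> real) \<Rightarrow> 'f"
  where "order_integral_nonneg F M \<mu> f =
    (THE z. \<forall>s. simple_approximation M s f \<longrightarrow>
       isLub F (range (\<lambda>n. simple_order_integral M \<mu> (s n))) z)"

definition order_integral_real ::
    "'f::dedekind_complete_vector_lattice set \<Rightarrow> 'x measure \<Rightarrow> ('x set \<Rightarrow> 'f) \<Rightarrow> ('x \<Rightarrow> real) \<Rightarrow> 'f"
  where "order_integral_real F M \<mu> f =
    order_integral_nonneg F M \<mu> (\<lambda>x. max (f x) 0) - order_integral_nonneg F M \<mu> (\<lambda>x. max (- f x) 0)"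

definition order_integral ::
    "'f::dedekind_complete_vector_lattice set \<Rightarrow> 'x measure \<Rightarrow> ('x set \<Rightarrow> 'f)
      \<Rightarrow> ('x \<Rightarrow> complex) \<Rightarrow> 'f complexification"
  where "order_integral F M \<mu> f =
    Cplx (order_integral_real F M \<mu> (\<lambda>x. Re (f x))) (order_integral_real F M \<mu> (\<lambda>x. Im (f x)))"

definition Borel :: "'x topology \<Rightarrow> 'x measure"
  where "Borel X = sigma (topspace X) {V. openin X V}"

definition regular_Borel_measure ::
    "'f::dedekind_complete_vector_lattice set \<Rightarrow> 'x topology \<Rightarrow> ('x set \<Rightarrow> 'f) \<Rightarrow> bool"
  where "regular_Borel_measure F X \<mu> \<longleftrightarrow> lattice_measure F (Borel X) \<mu> \<and>
    (\<forall>V. openin X V \<longrightarrow> isLub F {\<mu> K |K. compactin X K \<and> K \<subseteq> V} (\<mu> V)) \<and>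
    (\<forall>\<Delta>\<in>sets (Borel X). isGlb F {\<mu> V |V. openin X V \<and> \<Delta> \<subseteq> V} (\<mu> \<Delta>))"


section \<open>Continuous functions and star-isomorphisms\<close>

text \<open>Functions on \<^term>\<open>X\<close> are normalized outside \<^term>\<open>topspace X\<close> by extensionality,
  so that bijectivity of a map into \<open>C(X, \<complex>)\<close> makes sense.\<close>

definition continuous_functions :: "'x topology \<Rightarrow> ('x \<Rightarrow> complex) set"
  where "continuous_functions X = {f \<in> extensional (topspace X). continuous_map X euclidean f}"

definition supp :: "'x topology \<Rightarrow> ('x \<Rightarrow> complex) \<Rightarrow> 'x set"
  where "supp X f = X closure_of {x \<in> topspace X. f x \<noteq> 0}"

definition star_isomorphism ::
    "'x topology \<Rightarrow> ('a::dedekind_complete_vector_lattice regop complexification \<Rightarrow> 'x \<Rightarrow> complex) \<Rightarrow> bool"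
  where "star_isomorphism X h \<longleftrightarrow>
    bij_betw h complex_centre (continuous_functions X) \<and>
    (\<forall>S\<in>complex_centre. \<forall>T\<in>complex_centre. \<forall>x\<in>topspace X.
       h (S + T) x = h S x + h T x \<and> h (S * T) x = h S x * h T x) \<and>
    (\<forall>c. \<forall>T\<in>complex_centre. \<forall>x\<in>topspace X. h (cscale c T) x = c * h T x) \<and>
    (\<forall>T\<in>complex_centre. \<forall>x\<in>topspace X. h (cconj T) x = cnj (h T x))"

end

theory Submission
  imports Defs
begin

text \<open>Squares are positive in the centre, so a \<open>*\<close>-isomorphism onto \<open>C(X, \<complex>)\<close> restricts to an
  isomorphism of ordered algebras from the centre onto \<open>C(X, \<real>)\<close>. Dedekind completeness makes
  \<open>X\<close> extremally disconnected. Call a set null when the closures of its open neighbourhoods have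
  infimum \<open>{}\<close> among the clopen sets. Normality makes the null sets a \<open>\<sigma>\<close>-ideal: each nonempty clopen
  set contains one on which some order continuous functional is strictly positive, and the usual
  \<open>\<epsilon>/2\<^sup>n\<close> argument applies there. Hence every Borel set \<open>\<Delta>\<close> differs from a unique clopen set \<open>C\<close> by a
  null set, and \<open>\<mu>(\<Delta>)\<close> is the order projection represented by the indicator of \<open>C\<close>. Integrals of
  simple functions are then represented by the functions themselves off a null set, which gives
  the representation. A second representing measure agrees with \<open>\<mu>\<close> on open sets, by comparing
  both with continuous functions, and therefore everywhere by regularity.\<close>

section \<open>The centre as an algebra of continuous functions\<close>

text \<open>The isomorphism is only assumed to respect the algebra, so the order has to be recovered
  algebraically: disjoint positive elements of the centre have product zero, which makes squares
  positive, and nonnegative continuous functions are squares. The obstacle that shapes the rest is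
  that suprema in the centre are not pointwise suprema of functions: a family of indicators of
  clopen sets has as its supremum the indicator of the closure of the union. Boundaries must
  therefore be discarded, countably many at a time. The notion of null set is dictated by outer
  regularity: it says exactly that the projections of the closures of open neighbourhoods have
  infimum 0. The price is that stability under countable unions is not a formal consequence of the
  definition; this is what strictly positive order continuous charges are for.\<close>

text \<open>Order intervals take the place of the modulus. A negative \<open>l\<close> does no harm:
  \<open>id_regop\<close> is positive, so \<open>l\<close> may be replaced by
  \<open>max l 0\<close>.\<close>

lemma mem_centre_iff:
  "T \<in> centre \<longleftrightarrow> (\<exists>l. - (l *\<^sub>R id_regop) \<le> T \<and> T \<le> l *\<^sub>R id_regop)" (is "?L \<longleftrightarrow> ?R")
proof
  assume ?L
  then obtain l where "\<bar>T\<bar> \<le> l *\<^sub>R id_regop"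
    by (auto simp: centre_def)
  then show ?R
    by (metis abs_le_iff minus_le_iff)
next
  have I: "(0 :: 'a regop) \<le> id_regop"
    by transfer simp
  assume ?R
  then obtain l where l: "- (l *\<^sub>R id_regop) \<le> T" "T \<le> l *\<^sub>R id_regop" by blast
  have "l *\<^sub>R id_regop \<le> max l 0 *\<^sub>R (id_regop :: 'a regop)"
    using I by (intro scaleR_right_mono) auto
  with l have "T \<le> max l 0 *\<^sub>R id_regop" "- T \<le> max l 0 *\<^sub>R id_regop"
    by (meson order_trans minus_le_iff)+
  then have "\<bar>T\<bar> \<le> max l 0 *\<^sub>R id_regop"
    by (simp add: abs_le_iff)
  then show ?L
    unfolding centre_def by (intro CollectI exI[of _ "max l 0"]) auto
qed

lemma centreI: "- (l *\<^sub>R id_regop) \<le> T \<Longrightarrow> T \<le> l *\<^sub>R id_regop \<Longrightarrow> T \<in> centre"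
  using mem_centre_iff by blast

lemma centreE:
  assumes "T \<in> centre"
  obtains l where "0 \<le> l" "- (l *\<^sub>R id_regop) \<le> T" "T \<le> l *\<^sub>R id_regop"
proof -
  from assms obtain l where "0 \<le> l" "\<bar>T\<bar> \<le> l *\<^sub>R id_regop"
    by (auto simp: centre_def)
  with that show ?thesis
    by (metis abs_le_iff minus_le_iff)
qed

lemma id_regop_nonneg: "0 \<le> id_regop"
  by transfer simp

lemma id_regop_mult [simp]: "id_regop * T = T" "T * id_regop = T"
  by (transfer; simp)+

lemma id_regop_in_centre: "id_regop \<in> centre"
  using id_regop_nonneg by (intro centreI[of 1]) (auto intro: order_trans[of _ 0])

lemma subspace_centre: "subspace (centre :: 'a::dedekind_complete_vector_lattice regop set)"
proof (rule subspaceI)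
  show "0 \<in> (centre :: 'a regop set)"
    by (rule centreI[of 0]) auto
  show "S + T \<in> centre" if ST: "S \<in> centre" "T \<in> centre" for S T :: "'a regop"
  proof -
    obtain l where l: "- (l *\<^sub>R id_regop) \<le> S" "S \<le> l *\<^sub>R id_regop" using ST(1) by (rule centreE)
    obtain k where k: "- (k *\<^sub>R id_regop) \<le> T" "T \<le> k *\<^sub>R id_regop" using ST(2) by (rule centreE)
    show ?thesis
      using add_mono[OF l(1) k(1)] add_mono[OF l(2) k(2)]
      by (intro centreI[of "l + k"]) (auto simp: scaleR_add_left)
  qed
  show "c *\<^sub>R T \<in> centre" if T: "T \<in> centre" for c and T :: "'a regop"
  proof -
    obtain l where l: "- (l *\<^sub>R id_regop) \<le> T" "T \<le> l *\<^sub>R id_regop" using T by (rule centreE)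
    show ?thesis
    proof (cases "0 \<le> c")
      case True
      then show ?thesis
        using scaleR_left_mono[OF l(1), of c] scaleR_left_mono[OF l(2), of c]
        by (intro centreI[of "c * l"]) auto
    next
      case False
      then show ?thesis
        using scaleR_left_mono_neg[OF l(1), of c] scaleR_left_mono_neg[OF l(2), of c]
        by (intro centreI[of "- c * l"]) auto
    qed
  qed
qed

lemma centre_convex:
  assumes "S \<in> centre" "U \<in> centre" "S \<le> T" "T \<le> U"
  shows "T \<in> centre"
proof -
  have I: "(0 :: 'a regop) \<le> id_regop" by (rule id_regop_nonneg)
  obtain l where l: "- (l *\<^sub>R id_regop) \<le> S" using assms(1) by (rule centreE)
  obtain k where k: "U \<le> k *\<^sub>R id_regop" using assms(2) by (rule centreE)
  have "l *\<^sub>R id_regop \<le> max l k *\<^sub>R (id_regop :: 'a regop)"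
       "k *\<^sub>R id_regop \<le> max l k *\<^sub>R (id_regop :: 'a regop)"
    using I by (auto intro!: scaleR_right_mono)
  with l k assms show ?thesis
    by (intro centreI[of "max l k"]) (meson order_trans neg_le_iff_le)+
qed

text \<open>The centre is order convex, and the ambient supremum lies between a member of
  \<open>A\<close> and the bound \<open>U\<close>. Hence suprema formed in \<open>regop\<close> also
  serve as suprema inside the centre.\<close>

lemma Sup_in_centre:
  assumes "A \<subseteq> centre" "A \<noteq> {}" "U \<in> centre" "\<And>T. T \<in> A \<Longrightarrow> T \<le> U"
  shows "Sup A \<in> centre"
proof -
  obtain S where S: "S \<in> A" using assms(2) by blast
  have "bdd_above A"
    using assms(4) unfolding bdd_above_def by blast
  with S have "S \<le> Sup A"
    by (rule cSup_upper)
  moreover have "Sup A \<le> U"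
    using assms(2,4) by (rule cSup_least)
  ultimately show ?thesis
    using assms(1,3) S centre_convex[of S U] by blast
qed

lemma regop_mult_nonneg:
  fixes S T :: "'a::dedekind_complete_vector_lattice regop"
  assumes "0 \<le> S" "0 \<le> T"
  shows "0 \<le> S * T"
  using assms by transfer auto

text \<open>Products of positive operators are positive. Expanding \<open>(L + S) * (K + T)\<close>
  and \<open>(L - S) * (K + T)\<close>, with multiples \<open>L\<close> and \<open>K\<close> of the
  identity that make all factors positive, traps \<open>S * T\<close> between linear combinations of
  central elements.\<close>

lemma centre_mult:
  fixes S T :: "'a::dedekind_complete_vector_lattice regop"
  assumes "S \<in> centre" "T \<in> centre"
  shows "S * T \<in> centre"
proof -
  obtain l where l: "0 \<le> l" "- (l *\<^sub>R id_regop) \<le> S" "S \<le> l *\<^sub>R id_regop"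
    using assms(1) by (rule centreE)
  obtain k where k: "0 \<le> k" "- (k *\<^sub>R id_regop) \<le> T" "T \<le> k *\<^sub>R id_regop"
    using assms(2) by (rule centreE)
  define L K where "L = l *\<^sub>R (id_regop :: 'a regop)" and "K = k *\<^sub>R (id_regop :: 'a regop)"
  have c: "L \<in> centre" "K \<in> centre"
    unfolding L_def K_def by (simp_all add: subspace_scale[OF subspace_centre] id_regop_in_centre)
  have p: "0 \<le> L + S" "0 \<le> L - S" "0 \<le> K + T"
    using add_left_mono[OF l(2), of L] add_left_mono[OF k(2), of K] l(3)
    by (simp_all add: L_def K_def)
  have 1: "0 \<le> (L + S) * (K + T)" "0 \<le> (L - S) * (K + T)"
    using p by (auto intro: regop_mult_nonneg)
  have [simp]: "L * U = l *\<^sub>R U" "U * K = k *\<^sub>R U" for U by (simp_all add: L_def K_def)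
  have "k *\<^sub>R L = l *\<^sub>R K" by (simp add: L_def K_def mult.commute)
  define U V where "U = l *\<^sub>R K + l *\<^sub>R T + k *\<^sub>R S" and "V = l *\<^sub>R K + l *\<^sub>R T - k *\<^sub>R S"
  have "(L + S) * (K + T) = S * T + U" "(L - S) * (K + T) = V - S * T"
    using \<open>k *\<^sub>R L = l *\<^sub>R K\<close> by (simp_all add: U_def V_def algebra_simps)
  with 1 have "- U \<le> S * T" "S * T \<le> V"
    using diff_right_mono[of 0 "S * T + U" U] by auto
  moreover have "- U \<in> centre" "V \<in> centre"
    unfolding U_def V_def using c assms
    by (intro subspace_neg subspace_add subspace_diff subspace_scale subspace_centre; simp)+
  ultimately show ?thesis
    by (meson centre_convex)
qed

section \<open>Disjointness and positivity of squares in the centre\<close>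

text \<open>Both factors are bounded by a multiple \<open>c\<close> of the identity, so the product
  lies below \<open>c\<close> times either factor; divided by \<open>c\<close>, it lies below the
  infimum of the two.\<close>

lemma regop_inf_zero_mult_zero:
  assumes "P \<in> centre" "Q \<in> centre" "0 \<le> P" "0 \<le> Q" "inf P Q = 0"
  shows "P * Q = 0"
proof -
  obtain l where l: "P \<le> l *\<^sub>R id_regop" using assms(1) by (rule centreE)
  obtain k where k: "Q \<le> k *\<^sub>R id_regop" using assms(2) by (rule centreE)
  \<comment> \<open>The \<open>1\<close> keeps \<open>c\<close> invertible.\<close>
  define c where "c = max 1 (max l k)"
  have c: "c > 0" "P \<le> c *\<^sub>R id_regop" "Q \<le> c *\<^sub>R id_regop"
    by (auto simp: c_def intro!: order_trans[OF l] order_trans[OF k] scaleR_right_mono id_regop_nonneg)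
  have "0 \<le> P * (c *\<^sub>R id_regop - Q)" "0 \<le> (c *\<^sub>R id_regop - P) * Q"
    using c assms by (auto intro!: regop_mult_nonneg)
  then have "P * Q \<le> c *\<^sub>R P" "P * Q \<le> c *\<^sub>R Q"
    by (simp_all add: right_diff_distrib left_diff_distrib)
  then have "inverse c *\<^sub>R (P * Q) \<le> inf P Q"
    using scaleR_left_mono[of "P * Q" "c *\<^sub>R P" "inverse c"]
      scaleR_left_mono[of "P * Q" "c *\<^sub>R Q" "inverse c"] c(1) by simp
  then have "c *\<^sub>R (inverse c *\<^sub>R (P * Q)) \<le> c *\<^sub>R 0"
    unfolding assms(5) using c by (intro scaleR_left_mono) auto
  then have "P * Q \<le> 0" using c by simp
  with regop_mult_nonneg[OF assms(3,4)] show ?thesis by simp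
qed

lemma inf_pprt_nprt: "inf (pprt x) (- nprt x) = (0 :: 'a::lattice_ab_group_add)"
proof -
  have "inf x 0 = inf (pprt x + nprt x) (- nprt x + nprt x)"
    using prts[of x] by simp
  also have "\<dots> = inf (pprt x) (- nprt x) + nprt x"
    by (simp only: add_inf_distrib_right)
  finally show ?thesis
    by (simp add: nprt_def)
qed

text \<open>The positive and negative parts of \<open>R\<close> are disjoint, so the cross terms of
  the square vanish and \<open>P * P + Q * Q\<close> remains.\<close>

lemma centre_square_nonneg:
  fixes R :: "'a::dedekind_complete_vector_lattice regop"
  assumes "R \<in> centre"
  shows "0 \<le> R * R"
proof -
  obtain l where l: "0 \<le> l" "- (l *\<^sub>R id_regop) \<le> R" "R \<le> l *\<^sub>R id_regop"
    using assms by (rule centreE)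
  have L: "0 \<le> l *\<^sub>R (id_regop :: 'a regop)" by (simp add: l(1) scaleR_nonneg_nonneg id_regop_nonneg)
  define P Q where "P = pprt R" and "Q = - nprt R"
  have R: "R = P - Q" using prts[of R] by (simp add: P_def Q_def)
  have pos: "0 \<le> P" "0 \<le> Q" by (simp_all add: P_def Q_def)
  have "P \<le> l *\<^sub>R id_regop" "- (l *\<^sub>R id_regop) \<le> - Q"
    using l L by (simp_all add: P_def Q_def pprt_def nprt_def)
  with pos L have "P \<in> centre" "Q \<in> centre"
    by (auto intro!: centreI[of l] intro: order_trans[of _ 0])
  moreover have "inf P Q = 0" unfolding P_def Q_def by (rule inf_pprt_nprt)
  ultimately have "P * Q = 0" "Q * P = 0"
    using pos by (auto intro!: regop_inf_zero_mult_zero simp: inf.commute)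
  then have "R * R = P * P + Q * Q" by (simp add: R algebra_simps)
  then show ?thesis using pos by (simp add: regop_mult_nonneg)
qed

lemma complex_centre_iff: "T \<in> complex_centre \<longleftrightarrow> re_part T \<in> centre \<and> im_part T \<in> centre"
proof
  assume "T \<in> complex_centre"
  then obtain l where l: "cmodulus T \<le> l *\<^sub>R id_regop" by (auto simp: complex_centre_def)
  have *: "cos t *\<^sub>R re_part T + sin t *\<^sub>R im_part T \<le> l *\<^sub>R id_regop" for t
    using cSUP_upper[OF UNIV_I cmodulus_bdd_above, of t T] l unfolding cmodulus_def by (rule order_trans)
  \<comment> \<open>The angles 0, pi, pi/2 and -pi/2 single out the real part, its negative, the
    imaginary part and its negative.\<close>
  show "re_part T \<in> centre \<and> im_part T \<in> centre"
    using *[of 0] *[of pi] *[of "pi / 2"] *[of "- (pi / 2)"]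
    by (auto intro!: centreI[of l] simp: minus_le_iff)
next
  assume "re_part T \<in> centre \<and> im_part T \<in> centre"
  then obtain l k where l: "0 \<le> l" "\<bar>re_part T\<bar> \<le> l *\<^sub>R id_regop"
    and k: "0 \<le> k" "\<bar>im_part T\<bar> \<le> k *\<^sub>R id_regop"
    unfolding centre_def by blast
  have le: "c *\<^sub>R U \<le> m *\<^sub>R id_regop"
    if "\<bar>c\<bar> \<le> 1" "0 \<le> m" "\<bar>U\<bar> \<le> m *\<^sub>R id_regop" for c m and U :: "'a regop"
  proof -
    have U: "U \<le> m *\<^sub>R id_regop" "- U \<le> m *\<^sub>R id_regop" using that(3) by (simp_all add: abs_le_iff)
    have "c *\<^sub>R U \<le> \<bar>c\<bar> *\<^sub>R (m *\<^sub>R id_regop)"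
      using scaleR_left_mono[OF U(1), of "\<bar>c\<bar>"] scaleR_left_mono[OF U(2), of "\<bar>c\<bar>"]
      by (cases "0 \<le> c") auto
    also have "\<dots> \<le> 1 *\<^sub>R (m *\<^sub>R id_regop)"
      using that by (intro scaleR_right_mono) (auto simp: scaleR_nonneg_nonneg id_regop_nonneg)
    finally show ?thesis by simp
  qed
  have "cmodulus T \<le> (l + k) *\<^sub>R id_regop"
    unfolding cmodulus_def
  proof (rule cSUP_least)
    fix t
    show "cos t *\<^sub>R re_part T + sin t *\<^sub>R im_part T \<le> (l + k) *\<^sub>R id_regop"
      unfolding scaleR_add_left by (intro add_mono le l k) auto
  qed auto
  then show "T \<in> complex_centre"
    using l k unfolding complex_centre_def by (intro CollectI exI[of _ "l + k"]) auto
qed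

lemma Cplx_complex_centre: "T \<in> centre \<Longrightarrow> Cplx T 0 \<in> complex_centre"
  using subspace_0[OF subspace_centre] by (simp add: complex_centre_iff)

lemma Cplx_mult: "Cplx S 0 * Cplx T 0 = Cplx (S * T) (0 :: 'a::ring)"
  and Cplx_add: "Cplx S 0 + Cplx T 0 = Cplx (S + T) (0 :: 'a)"
  by (simp_all add: times_complexification_def plus_complexification_def)

lemma cscale_of_real_Cplx: "cscale (of_real c) (Cplx T 0) = Cplx (c *\<^sub>R T) 0"
  by (simp add: cscale_def)

section \<open>From an algebraic isomorphism to an order isomorphism\<close>

context
  fixes X :: "'x topology"
    and hat :: "'a::dedekind_complete_vector_lattice regop complexification \<Rightarrow> 'x \<Rightarrow> complex"
  assumes star: "star_isomorphism X hat"
begin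

lemma star_add: "S \<in> complex_centre \<Longrightarrow> T \<in> complex_centre \<Longrightarrow> x \<in> topspace X \<Longrightarrow> hat (S + T) x = hat S x + hat T x"
  and star_mult: "S \<in> complex_centre \<Longrightarrow> T \<in> complex_centre \<Longrightarrow> x \<in> topspace X \<Longrightarrow> hat (S * T) x = hat S x * hat T x"
  and star_cscale: "T \<in> complex_centre \<Longrightarrow> x \<in> topspace X \<Longrightarrow> hat (cscale c T) x = c * hat T x"
  and star_cconj: "T \<in> complex_centre \<Longrightarrow> x \<in> topspace X \<Longrightarrow> hat (cconj T) x = cnj (hat T x)"
  and star_continuous: "T \<in> complex_centre \<Longrightarrow> continuous_map X euclidean (hat T)"
  using star unfolding star_isomorphism_def bij_betw_def continuous_functions_def by auto

lemma star_inj: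
  assumes "S \<in> complex_centre" "T \<in> complex_centre" "\<And>x. x \<in> topspace X \<Longrightarrow> hat S x = hat T x"
  shows "S = T"
proof -
  have "hat S \<in> extensional (topspace X)" "hat T \<in> extensional (topspace X)"
    using star assms unfolding star_isomorphism_def bij_betw_def continuous_functions_def by auto
  then have "hat S = hat T" using assms(3) by (rule extensionalityI)
  with assms star show ?thesis unfolding star_isomorphism_def bij_betw_def by (auto dest: inj_onD)
qed

lemma star_surj:
  assumes "continuous_map X euclidean f"
  obtains T where "T \<in> complex_centre" "\<And>x. x \<in> topspace X \<Longrightarrow> hat T x = f x"
proof -
  have "restrict f (topspace X) \<in> continuous_functions X"
    using assms unfolding continuous_functions_def
    by (auto intro: continuous_map_eq)
  then obtain T where "T \<in> complex_centre" "hat T = restrict f (topspace X)"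
    using star unfolding star_isomorphism_def bij_betw_def by (metis imageE)
  with that show ?thesis by auto
qed

text \<open>\<open>Cplx T 0\<close> is its own conjugate, hence so is its image.\<close>

lemma star_real: "T \<in> centre \<Longrightarrow> x \<in> topspace X \<Longrightarrow> hat (Cplx T 0) x = complex_of_real (Re (hat (Cplx T 0) x))"
  using star_cconj[OF Cplx_complex_centre, of T x]
  by (auto simp: cconj_def complex_eq_iff)

text \<open>The preimage of a real function is self-conjugate by injectivity, so its imaginary part
  equals its own negative and vanishes.\<close>

lemma star_real_surj:
  assumes "continuous_map X euclideanreal f"
  obtains T where "T \<in> centre" "\<And>x. x \<in> topspace X \<Longrightarrow> hat (Cplx T 0) x = complex_of_real (f x)"
proof -
  have "continuous_map X euclidean (complex_of_real \<circ> f)"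
    using assms by (rule continuous_map_compose) (simp add: continuous_on_of_real)
  then obtain T where T: "T \<in> complex_centre" "\<And>x. x \<in> topspace X \<Longrightarrow> hat T x = complex_of_real (f x)"
    by (rule star_surj) auto
  have "cconj T \<in> complex_centre"
    using T(1) subspace_neg[OF subspace_centre] by (auto simp: complex_centre_iff cconj_def)
  then have "cconj T = T"
    by (rule star_inj[OF _ T(1)]) (simp add: star_cconj T)
  then have "im_part T = - im_part T"
    by (metis cconj_def complexification.sel(2))
  then have "im_part T + im_part T = 0"
    by (simp only: eq_neg_iff_add_eq_0)
  then have "2 *\<^sub>R im_part T = 0"
    by (simp add: scaleR_2)
  then have "Cplx (re_part T) 0 = T"
    by (simp add: complexification_eq_iff)
  with T that[of "re_part T"] show ?thesis by (simp add: complex_centre_iff)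
qed

text \<open>A nonnegative function has a continuous square root, so its preimage is a square and
  thus positive. Conversely, for positive \<open>T\<close> let \<open>N\<close> be the preimage of
  the negative part of its function. Then \<open>N\<close> is positive and
  \<open>N * N = - (N * T)\<close>, which is both at least and at most 0, so the negative part
  vanishes.\<close>

lemma star_nonneg_iff:
  assumes T: "T \<in> centre"
  shows "0 \<le> T \<longleftrightarrow> (\<forall>x\<in>topspace X. 0 \<le> Re (hat (Cplx T 0) x))"
proof
  have square: "\<exists>R\<in>centre. R * R = S \<and> (\<forall>x\<in>topspace X. hat (Cplx R 0) x = complex_of_real (sqrt (Re (hat (Cplx S 0) x))))"
    if S: "S \<in> centre" and pos: "\<And>x. x \<in> topspace X \<Longrightarrow> 0 \<le> Re (hat (Cplx S 0) x)" for S
  proof -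
    have "continuous_map X euclideanreal (\<lambda>x. sqrt (Re (hat (Cplx S 0) x)))"
      using continuous_map_compose[OF star_continuous[OF Cplx_complex_centre[OF S]], of euclideanreal "\<lambda>z. sqrt (Re z)"]
      by (simp add: o_def continuous_intros)
    then obtain R where R: "R \<in> centre"
      "\<And>x. x \<in> topspace X \<Longrightarrow> hat (Cplx R 0) x = complex_of_real (sqrt (Re (hat (Cplx S 0) x)))"
      by (rule star_real_surj) auto
    have "Cplx (R * R) 0 = Cplx S 0"
    proof (rule star_inj)
      show "Cplx (R * R) 0 \<in> complex_centre" "Cplx S 0 \<in> complex_centre"
        using R S by (auto intro: Cplx_complex_centre centre_mult)
      fix x assume x: "x \<in> topspace X"
      have "hat (Cplx (R * R) 0) x = complex_of_real (Re (hat (Cplx S 0) x))"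
        using star_mult[OF Cplx_complex_centre Cplx_complex_centre, of R R x] R x pos[OF x]
        by (simp add: Cplx_mult flip: of_real_mult)
      then show "hat (Cplx (R * R) 0) x = hat (Cplx S 0) x"
        using star_real[OF S x] by simp
    qed
    with R show ?thesis by auto
  qed
  {
    assume pos: "0 \<le> T"
    let ?f = "\<lambda>x. Re (hat (Cplx T 0) x)"
    have "continuous_map X euclideanreal (\<lambda>x. max (- ?f x) 0)"
      using continuous_map_compose[OF star_continuous[OF Cplx_complex_centre[OF T]], of euclideanreal "\<lambda>z. max (- Re z) 0"]
      by (simp add: o_def continuous_intros)
    then obtain N where N: "N \<in> centre"
      "\<And>x. x \<in> topspace X \<Longrightarrow> hat (Cplx N 0) x = complex_of_real (max (- ?f x) 0)"
      by (rule star_real_surj) auto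
    have "0 \<le> N"
      using square[OF N(1)] N centre_square_nonneg by (metis Re_complex_of_real max.cobounded2)
    have NN: "0 \<le> N * N" using N by (simp add: centre_square_nonneg)
    \<comment> \<open>Pointwise, a real number times its negative part is minus the square of that
      negative part.\<close>
    have "Cplx (N * N) 0 = Cplx (- (N * T)) 0"
    proof (rule star_inj)
      show "Cplx (N * N) 0 \<in> complex_centre" "Cplx (- (N * T)) 0 \<in> complex_centre"
        using N T by (auto intro!: Cplx_complex_centre centre_mult subspace_neg[OF subspace_centre])
      fix x assume x: "x \<in> topspace X"
      have "hat (Cplx (- (N * T)) 0) x = - (hat (Cplx N 0) x * hat (Cplx T 0) x)"
        using star_cscale[OF Cplx_complex_centre[OF centre_mult[OF N(1) T]] x, of "of_real (- 1)"]
          star_mult[OF Cplx_complex_centre[OF N(1)] Cplx_complex_centre[OF T] x]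
        unfolding cscale_of_real_Cplx Cplx_mult by simp
      also have "\<dots> = complex_of_real (- (max (- ?f x) 0 * ?f x))"
        using N(2)[OF x] star_real[OF T x] by (metis of_real_minus of_real_mult)
      also have "- (max (- ?f x) 0 * ?f x) = max (- ?f x) 0 * max (- ?f x) 0"
        by (auto simp: max_def)
      also have "complex_of_real \<dots> = hat (Cplx (N * N) 0) x"
        using star_mult[OF Cplx_complex_centre[OF N(1)] Cplx_complex_centre[OF N(1)] x] N(2)[OF x]
        unfolding Cplx_mult by simp
      finally show "hat (Cplx (N * N) 0) x = hat (Cplx (- (N * T)) 0) x" ..
    qed
    then have "N * N = - (N * T)" by simp
    with regop_mult_nonneg[OF \<open>0 \<le> N\<close> pos] NN have "N * N = 0"
      by (metis neg_le_0_iff_le order_antisym)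
    then have *: "Cplx N 0 * Cplx N 0 = Cplx 0 0" by (simp add: Cplx_mult)
    show "\<forall>x\<in>topspace X. 0 \<le> Re (hat (Cplx T 0) x)"
    proof
      fix x assume x: "x \<in> topspace X"
      have 0: "hat (Cplx 0 0) x = 0"
        using star_cscale[OF Cplx_complex_centre[OF subspace_0[OF subspace_centre]] x, of 0]
        by (simp add: cscale_def)
      have "hat (Cplx N 0) x * hat (Cplx N 0) x = 0"
        using star_mult[OF Cplx_complex_centre[OF N(1)] Cplx_complex_centre[OF N(1)] x] unfolding * 0 by simp
      then show "0 \<le> Re (hat (Cplx T 0) x)" using N(2)[OF x] by (simp add: max_def split: if_splits)
    qed
  }
  assume "\<forall>x\<in>topspace X. 0 \<le> Re (hat (Cplx T 0) x)"
  then show "0 \<le> T" using square[OF T] centre_square_nonneg by metis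
qed

text \<open>Preservation of the unit is derived: with \<open>T\<close> the preimage of the constant
  1, multiplicativity on \<open>T * id_regop = T\<close> leaves the claimed value.\<close>

lemma star_id: "x \<in> topspace X \<Longrightarrow> hat (Cplx id_regop 0) x = 1"
proof -
  assume x: "x \<in> topspace X"
  obtain T where T: "T \<in> centre" "\<And>x. x \<in> topspace X \<Longrightarrow> hat (Cplx T 0) x = complex_of_real 1"
    by (rule star_real_surj[of "\<lambda>_. 1"]) auto
  then show ?thesis
    using star_mult[OF Cplx_complex_centre[OF T(1)] Cplx_complex_centre[OF id_regop_in_centre] x] x
    unfolding Cplx_mult by simp
qed

end

section \<open>Null sets in hyperstonean spaces\<close>

definition clopenin :: "'x topology \<Rightarrow> 'x set \<Rightarrow> bool"
  where "clopenin X C \<longleftrightarrow> openin X C \<and> closedin X C"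

lemma clopenin_empty [simp]: "clopenin X {}"
  and clopenin_topspace [simp]: "clopenin X (topspace X)"
  and clopenin_Un: "clopenin X A \<Longrightarrow> clopenin X B \<Longrightarrow> clopenin X (A \<union> B)"
  and clopenin_Int: "clopenin X A \<Longrightarrow> clopenin X B \<Longrightarrow> clopenin X (A \<inter> B)"
  and clopenin_diff: "clopenin X A \<Longrightarrow> clopenin X B \<Longrightarrow> clopenin X (A - B)"
  and clopenin_subset: "clopenin X A \<Longrightarrow> A \<subseteq> topspace X"
  by (auto simp: clopenin_def openin_diff closedin_diff openin_subset[THEN subsetD])

lemma clopenin_UN:
  "finite I \<Longrightarrow> (\<And>i. i \<in> I \<Longrightarrow> clopenin X (A i)) \<Longrightarrow> clopenin X (\<Union>i\<in>I. A i)"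
  by (induction rule: finite_induct) (auto intro: clopenin_Un)

lemma continuous_map_indicator:
  assumes "clopenin X C"
  shows "continuous_map X euclideanreal (indicator C)"
proof -
  have "openin X {x \<in> topspace X. indicator C x \<in> U}" for U :: "real set"
  proof -
    have "{x \<in> topspace X. indicator C x \<in> U} =
        (if 1 \<in> U then C else {}) \<union> (if 0 \<in> U then topspace X - C else {})"
      using clopenin_subset[OF assms] by (auto simp: indicator_def)
    then show ?thesis
      using assms by (auto simp: clopenin_def intro: openin_diff)
  qed
  then show ?thesis
    by (auto simp: continuous_map_def)
qed

lemma sets_Borel: "sets (Borel X) = sigma_sets (topspace X) {V. openin X V}"
  and space_Borel: "space (Borel X) = topspace X"
  unfolding Borel_def by (auto intro!: sets_measure_of space_measure_of dest: openin_subset)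

text \<open>Order continuity of a charge is stated along upward directed families; in an extremally
  disconnected space the closure of the union is their supremum among the clopen sets.\<close>

definition order_continuous_charge :: "'x topology \<Rightarrow> ('x set \<Rightarrow> real) \<Rightarrow> bool"
  where "order_continuous_charge X m \<longleftrightarrow>
    (\<forall>A B. clopenin X A \<longrightarrow> clopenin X B \<longrightarrow> A \<inter> B = {} \<longrightarrow> m (A \<union> B) = m A + m B) \<and>
    (\<forall>\<D> \<epsilon>. \<D> \<noteq> {} \<longrightarrow> (\<forall>A\<in>\<D>. clopenin X A) \<longrightarrow> (\<forall>A\<in>\<D>. \<forall>B\<in>\<D>. \<exists>C\<in>\<D>. A \<union> B \<subseteq> C) \<longrightarrow> 0 < \<epsilon> \<longrightarrow>
      (\<exists>A\<in>\<D>. \<forall>B\<in>\<D>. A \<subseteq> B \<longrightarrow> \<bar>m (X closure_of \<Union>\<D>) - m B\<bar> < \<epsilon>))"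

lemma order_continuous_charge_add:
  "order_continuous_charge X m \<Longrightarrow> clopenin X A \<Longrightarrow> clopenin X B \<Longrightarrow> A \<inter> B = {} \<Longrightarrow>
    m (A \<union> B) = m A + m B"
  unfolding order_continuous_charge_def by blast

lemma order_continuous_charge_approx:
  assumes m: "order_continuous_charge X m" and "\<D> \<noteq> {}" "\<And>A. A \<in> \<D> \<Longrightarrow> clopenin X A"
    and "\<And>A B. A \<in> \<D> \<Longrightarrow> B \<in> \<D> \<Longrightarrow> \<exists>C\<in>\<D>. A \<union> B \<subseteq> C" and "0 < \<epsilon>"
  obtains A where "A \<in> \<D>" "\<bar>m (X closure_of \<Union>\<D>) - m A\<bar> < \<epsilon>"
proof -
  have "\<exists>A\<in>\<D>. \<forall>B\<in>\<D>. A \<subseteq> B \<longrightarrow> \<bar>m (X closure_of \<Union>\<D>) - m B\<bar> < \<epsilon>"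
    using m[unfolded order_continuous_charge_def, THEN conjunct2, rule_format, of \<D> \<epsilon>] assms(2-) by blast
  with that show ?thesis by blast
qed

text \<open>Under the hypotheses below these are exactly the meagre sets. With this definition a null
  open set is empty for trivial reasons, so the Baire category theorem is not needed.\<close>

definition null_set_in :: "'x topology \<Rightarrow> 'x set \<Rightarrow> bool"
  where "null_set_in X N \<longleftrightarrow> N \<subseteq> topspace X \<and>
    (\<forall>Z. clopenin X Z \<longrightarrow> (\<forall>V. openin X V \<and> N \<subseteq> V \<longrightarrow> Z \<subseteq> X closure_of V) \<longrightarrow> Z = {})"

lemma null_set_in_mono: "null_set_in X N \<Longrightarrow> M \<subseteq> N \<Longrightarrow> null_set_in X M"
  unfolding null_set_in_def by (meson subset_trans)

lemma null_set_in_empty [simp]: "null_set_in X {}"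
  unfolding null_set_in_def using openin_empty by fastforce

section \<open>Null sets in extremally disconnected compact spaces\<close>

locale extremally_disconnected_space =
  fixes X :: "'x topology"
  assumes compact: "compact_space X" and Hausdorff: "Hausdorff_space X"
    and openin_closure_of: "openin X V \<Longrightarrow> openin X (X closure_of V)"
begin

lemma clopenin_closure_of: "openin X V \<Longrightarrow> clopenin X (X closure_of V)"
  by (simp add: clopenin_def openin_closure_of)

text \<open>Regularity separates any point outside \<open>N\<close> from an open neighbourhood of
  \<open>N\<close>, and hence from its closure. So a clopen \<open>Z\<close> below all these
  closures lies in \<open>N\<close>, which has empty interior.\<close>

lemma closed_nowhere_dense_null:
  assumes N: "closedin X N" and dense: "X interior_of N = {}"
  shows "null_set_in X N"
  unfolding null_set_in_def
proof (intro conjI allI impI)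
  show "N \<subseteq> topspace X" using N by (rule closedin_subset)
  fix Z assume Z: "clopenin X Z" and le: "\<forall>V. openin X V \<and> N \<subseteq> V \<longrightarrow> Z \<subseteq> X closure_of V"
  have reg: "regular_space X"
    by (rule compact_Hausdorff_imp_regular_space[OF compact Hausdorff])
  have "Z \<subseteq> N"
  proof
    fix x assume x: "x \<in> Z"
    show "x \<in> N"
    proof (rule ccontr)
      assume "x \<notin> N"
      then obtain U V where UV: "openin X U" "openin X V" "x \<in> U" "N \<subseteq> V" "disjnt U V"
        using reg N x clopenin_subset[OF Z] unfolding regular_space_def by (metis Diff_iff subsetD)
      have "x \<in> X closure_of V" using le UV x by blast
      with UV show False unfolding in_closure_of disjnt_iff by blast
    qed
  qed
  then show "Z = {}"
    using Z dense interior_of_maximal[of Z N X] by (auto simp: clopenin_def)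
qed

text \<open>The closure of \<open>V\<close> is clopen and contained in the closure of every open set
  around \<open>V\<close>, so it is itself one of the sets that nullness forces to be empty.\<close>

lemma openin_null_empty:
  assumes "openin X V" "null_set_in X V"
  shows "V = {}"
proof -
  have "X closure_of V = {}"
    using assms clopenin_closure_of[OF assms(1)] closure_of_mono[of V _ X]
    unfolding null_set_in_def by blast
  then show ?thesis
    using closure_of_subset[OF openin_subset[OF assms(1)]] by simp
qed

text \<open>The difference is the boundary of \<open>V\<close>. It is closed, and a nonempty open
  subset of it would have to meet \<open>V\<close>.\<close>

lemma openin_symdiff_closure_null:
  assumes "openin X V"
  shows "null_set_in X (X closure_of V - V)"
proof (rule closed_nowhere_dense_null)
  show "closedin X (X closure_of V - V)"
    using assms by (simp add: closedin_diff)
  show "X interior_of (X closure_of V - V) = {}"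
  proof (rule ccontr)
    let ?I = "X interior_of (X closure_of V - V)"
    assume "?I \<noteq> {}"
    then obtain x where x: "x \<in> ?I" by blast
    have sub: "?I \<subseteq> X closure_of V - V" by (rule interior_of_subset)
    with x have "x \<in> X closure_of V" by blast
    then have "\<exists>y. y \<in> V \<and> y \<in> ?I"
      using x openin_interior_of[of X] unfolding in_closure_of by blast
    with sub show False by blast
  qed
qed

end

section \<open>The sigma-ideal of null sets\<close>

text \<open>The classical condition asks for enough normal measures. Here they appear as finitely
  additive, possibly signed charges on clopen sets, which is what order continuous functionals
  provide directly.\<close>

locale hyperstonean_space = extremally_disconnected_space +
  assumes charges_separate:
    "clopenin X Z \<Longrightarrow> Z \<noteq> {} \<Longrightarrow> \<exists>m. order_continuous_charge X m \<and> m Z \<noteq> 0"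
begin

text \<open>A maximal clopen subset of \<open>Z\<close> of nonpositive charge exists by order continuity along
  chains; its complement in \<open>Z\<close> carries a strictly positive charge.\<close>

lemma strictly_positive_charge:
  assumes Z: "clopenin X Z" "Z \<noteq> {}"
  obtains m W where "order_continuous_charge X m" "clopenin X W" "W \<subseteq> Z" "W \<noteq> {}"
    "\<And>C. clopenin X C \<Longrightarrow> C \<subseteq> W \<Longrightarrow> C \<noteq> {} \<Longrightarrow> 0 < m C"
proof -
  obtain m0 where m0: "order_continuous_charge X m0" "m0 Z \<noteq> 0"
    using charges_separate[OF Z] by blast
  \<comment> \<open>The sign makes \<open>m Z\<close> positive and leaves absolute differences,
    hence order continuity, unchanged.\<close>
  define m where "m C = sgn (m0 Z) * m0 C" for C
  have m: "order_continuous_charge X m" and mZ: "0 < m Z"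
  proof -
    have "\<bar>sgn (m0 Z)\<bar> = 1" using m0(2) by (simp add: abs_sgn_eq)
    then have "\<bar>m A - m B\<bar> = \<bar>m0 A - m0 B\<bar>" for A B
      by (simp add: m_def abs_mult flip: right_diff_distrib)
    then show "order_continuous_charge X m"
      using m0(1) unfolding order_continuous_charge_def by (simp add: m_def distrib_left)
    show "0 < m Z" using m0(2) by (simp add: m_def sgn_mult_self_eq)
        (metis abs_sgn mult.commute zero_less_abs_iff)
  qed
  have add: "m (A \<union> B) = m A + m B" if "clopenin X A" "clopenin X B" "A \<inter> B = {}" for A B
    using order_continuous_charge_add[OF m that] .
  have m_empty: "m {} = 0" using add[of "{}" "{}"] by simp
  define \<N> where "\<N> = {N. clopenin X N \<and> N \<subseteq> Z \<and> m N \<le> 0}"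
  have "\<exists>M\<in>\<N>. \<forall>N\<in>\<N>. M \<subseteq> N \<longrightarrow> N = M"
  proof (rule subset_Zorn)
    fix \<C> assume chain: "subset.chain \<N> \<C>"
    show "\<exists>U\<in>\<N>. \<forall>N\<in>\<C>. N \<subseteq> U"
    proof (cases "\<C> = {}")
      case True
      then show ?thesis using m_empty by (intro bexI[of _ "{}"]) (auto simp: \<N>_def)
    next
      case False
      have C: "\<And>N. N \<in> \<C> \<Longrightarrow> clopenin X N \<and> N \<subseteq> Z \<and> m N \<le> 0"
        using chain by (auto simp: \<N>_def subset.chain_def)
      let ?U = "X closure_of \<Union>\<C>"
      have op: "openin X (\<Union>\<C>)" using C by (auto simp: clopenin_def)
      have dir: "\<exists>D\<in>\<C>. A \<union> B \<subseteq> D" if "A \<in> \<C>" "B \<in> \<C>" for A B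
      proof -
        have "A \<subseteq> B \<or> B \<subseteq> A" using chain that unfolding subset.chain_def by blast
        with that show ?thesis by blast
      qed
      \<comment> \<open>A chain is directed, so order continuity brings the charge of
        \<open>?U\<close> within any \<open>e\<close> of the nonpositive charge of some
        member.\<close>
      have "m ?U \<le> 0"
      proof (rule field_le_epsilon)
        fix e :: real assume "0 < e"
        obtain A where "A \<in> \<C>" "\<bar>m ?U - m A\<bar> < e"
          by (rule order_continuous_charge_approx[OF m False _ dir \<open>0 < e\<close>]) (use C in blast)+
        then show "m ?U \<le> 0 + e" using C[of A] by linarith
      qed
      moreover have "?U \<subseteq> Z"
        using C Z by (intro closure_of_minimal) (auto simp: clopenin_def)
      moreover have "N \<subseteq> ?U" if "N \<in> \<C>" for N
        using closure_of_subset[OF openin_subset[OF op]] that by blast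
      ultimately show ?thesis
        using clopenin_closure_of[OF op] by (intro bexI[of _ ?U]) (auto simp: \<N>_def)
    qed
  qed
  then obtain M where M: "M \<in> \<N>" "\<And>N. N \<in> \<N> \<Longrightarrow> M \<subseteq> N \<Longrightarrow> N = M" by blast
  have M': "clopenin X M" "M \<subseteq> Z" "m M \<le> 0" using M(1) by (auto simp: \<N>_def)
  have "m Z = m M + m (Z - M)"
    using add[of M "Z - M"] M' Z by (simp add: Un_absorb1 clopenin_diff)
  then have ne: "Z - M \<noteq> {}" using mZ M'(3) m_empty by force
  show ?thesis
  proof (rule that[of m "Z - M"])
    fix C assume C: "clopenin X C" "C \<subseteq> Z - M" "C \<noteq> {}"
    show "0 < m C"
    proof (rule ccontr)
      assume "\<not> 0 < m C"
      moreover have "m (M \<union> C) = m M + m C" using C M' by (intro add) auto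
      ultimately have "M \<union> C \<in> \<N>" using C M' by (auto simp: \<N>_def intro: clopenin_Un)
      from M(2)[OF this] C show False by auto
    qed
  qed (use m M' Z ne in \<open>auto intro: clopenin_diff\<close>)
qed

text \<open>If a nonempty clopen \<open>Z\<close> survived, a clopen \<open>W\<close> inside it
  would carry a strictly positive charge. Covering the \<open>N n\<close> by open sets whose
  closures have small, geometrically decreasing charge in \<open>W\<close> then contradicts the
  density of these covers in \<open>W\<close>.\<close>

lemma null_set_in_UN:
  fixes N :: "nat \<Rightarrow> 'a set"
  assumes null: "\<And>n. null_set_in X (N n)"
  shows "null_set_in X (\<Union>n. N n)"
  unfolding null_set_in_def
proof (intro conjI allI impI)
  show "(\<Union>n. N n) \<subseteq> topspace X" using null by (auto simp: null_set_in_def)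
  fix Z assume Z: "clopenin X Z" and le: "\<forall>V. openin X V \<and> (\<Union>n. N n) \<subseteq> V \<longrightarrow> Z \<subseteq> X closure_of V"
  show "Z = {}"
  proof (rule ccontr)
    assume "Z \<noteq> {}"
    obtain m W where m: "order_continuous_charge X m" and W: "clopenin X W" "W \<subseteq> Z" "W \<noteq> {}"
      and pos: "\<And>C. clopenin X C \<Longrightarrow> C \<subseteq> W \<Longrightarrow> C \<noteq> {} \<Longrightarrow> 0 < m C"
      using strictly_positive_charge[OF Z \<open>Z \<noteq> {}\<close>] by metis
    have add: "m (A \<union> B) = m A + m B" if "clopenin X A" "clopenin X B" "A \<inter> B = {}" for A B
      using order_continuous_charge_add[OF m that] .
    have m_empty: "m {} = 0" using add[of "{}" "{}"] by simp
    have nonneg: "0 \<le> m C" if "clopenin X C" "C \<subseteq> W" for C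
      using pos[OF that] m_empty by (cases "C = {}") auto
    \<comment> \<open>The sets \<open>W - X closure_of V\<close> grow as \<open>V\<close> shrinks.
      The part of \<open>W\<close> missed by the closure of their union lies in every
      \<open>X closure_of V\<close>, so nullness of \<open>N n\<close> empties it, and order
      continuity gives the estimate.\<close>
    have approx: "\<exists>V. openin X V \<and> N n \<subseteq> V \<and> m (W \<inter> X closure_of V) < e" if "0 < e" for n e
    proof -
      define \<D> where "\<D> = {W - X closure_of V |V. openin X V \<and> N n \<subseteq> V}"
      have ne: "\<D> \<noteq> {}" and cl: "\<And>A. A \<in> \<D> \<Longrightarrow> clopenin X A"
        using null[of n] W(1) unfolding \<D>_def null_set_in_def by (auto intro!: clopenin_diff clopenin_closure_of)
      have dir: "\<exists>C\<in>\<D>. A \<union> B \<subseteq> C" if "A \<in> \<D>" "B \<in> \<D>" for A B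
      proof -
        from that obtain U V where UV: "openin X U" "N n \<subseteq> U" "A = W - X closure_of U"
          "openin X V" "N n \<subseteq> V" "B = W - X closure_of V" by (auto simp: \<D>_def)
        have "A \<union> B \<subseteq> W - X closure_of (U \<inter> V)"
          using closure_of_mono[of "U \<inter> V" U X] closure_of_mono[of "U \<inter> V" V X] UV by auto
        moreover have "W - X closure_of (U \<inter> V) \<in> \<D>" using UV by (auto simp: \<D>_def)
        ultimately show "\<exists>C\<in>\<D>. A \<union> B \<subseteq> C" by blast
      qed
      let ?U = "X closure_of \<Union>\<D>"
      have op: "openin X (\<Union>\<D>)" using cl by (auto simp: clopenin_def)
      have "W - ?U = {}"
      proof -
        have "W - ?U \<subseteq> X closure_of V" if "openin X V" "N n \<subseteq> V" for V
          using that closure_of_subset[OF openin_subset[OF op]] by (auto simp: \<D>_def)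
        moreover have "clopenin X (W - ?U)" using W(1) op by (intro clopenin_diff clopenin_closure_of)
        ultimately show ?thesis using null[of n] unfolding null_set_in_def by blast
      qed
      moreover have "?U \<subseteq> W"
        using W(1) by (intro closure_of_minimal) (auto simp: \<D>_def clopenin_def)
      ultimately have "?U = W" by blast
      with order_continuous_charge_approx[OF m ne cl dir \<open>0 < e\<close>]
      obtain A where "A \<in> \<D>" "\<bar>m W - m A\<bar> < e" by metis
      then obtain V where V: "openin X V" "N n \<subseteq> V" "\<bar>m W - m (W - X closure_of V)\<bar> < e"
        by (auto simp: \<D>_def)
      have "m W = m (W \<inter> X closure_of V) + m (W - X closure_of V)"
        using add[of "W \<inter> X closure_of V" "W - X closure_of V"] W(1) clopenin_closure_of[OF V(1)]
        by (simp add: clopenin_Int clopenin_diff Int_Diff_Un Int_Diff_disjoint)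
      with V show ?thesis by (intro exI[of _ V]) auto
    qed
    \<comment> \<open>With \<open>m W = 4 * e\<close>, the covers have total charge at most
      \<open>2 * e\<close>, while some \<open>P k\<close> must come within \<open>e\<close> of
      \<open>m W\<close> and so exceed \<open>3 * e\<close>.\<close>
    define e where "e = m W / 4"
    have e: "0 < e" using pos[OF W(1) order_refl W(3)] by (simp add: e_def)
    have "\<forall>n. \<exists>V. openin X V \<and> N n \<subseteq> V \<and> m (W \<inter> X closure_of V) < e * (1/2)^n"
      using approx e by simp
    then obtain V where V: "\<And>n. openin X (V n)" "\<And>n. N n \<subseteq> V n"
      "\<And>n. m (W \<inter> X closure_of V n) < e * (1/2)^n" by metis
    define P where "P k = (\<Union>n<k. W \<inter> X closure_of V n)" for k
    have P_clopen: "clopenin X (P k)" for k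
      unfolding P_def using W(1) V(1) by (intro clopenin_UN clopenin_Int clopenin_closure_of) auto
    have P_sub: "P k \<subseteq> W" for k by (auto simp: P_def)
    have P_bound: "m (P k) \<le> (\<Sum>n<k. e * (1/2)^n)" for k
    proof (induction k)
      case 0
      then show ?case by (simp add: P_def m_empty)
    next
      case (Suc k)
      let ?C = "W \<inter> X closure_of V k"
      have C: "clopenin X ?C" using W(1) V(1) by (intro clopenin_Int clopenin_closure_of)
      have "P (Suc k) = P k \<union> (?C - P k)" by (auto simp: P_def lessThan_Suc)
      then have "m (P (Suc k)) = m (P k) + m (?C - P k)"
        using add[of "P k" "?C - P k"] P_clopen C by (simp add: clopenin_diff)
      moreover have "m ?C = m (?C \<inter> P k) + m (?C - P k)"
        using add[of "?C \<inter> P k" "?C - P k"] P_clopen C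
        by (simp add: clopenin_Int clopenin_diff Int_Diff_Un Int_Diff_disjoint)
      moreover have "0 \<le> m (?C \<inter> P k)" using clopenin_Int[OF C P_clopen] by (rule nonneg) blast
      ultimately show ?case using Suc.IH V(3)[of k] by simp
    qed
    have sum_bound: "(\<Sum>n<k. e * (1/2)^n) \<le> 2 * e" for k
    proof -
      have "(\<Sum>n<k. (1/2::real)^n) \<le> 2"
        by (subst sum_gp_strict) (auto simp: field_simps)
      then show ?thesis using e by (simp flip: sum_distrib_left)
    qed
    have mono: "P i \<subseteq> P j" if "i \<le> j" for i j using that by (force simp: P_def)
    have closure: "X closure_of (\<Union>k. P k) = W"
    proof
      show "X closure_of (\<Union>k. P k) \<subseteq> W"
        using W(1) P_sub by (intro closure_of_minimal) (auto simp: clopenin_def)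
      show "W \<subseteq> X closure_of (\<Union>k. P k)"
      proof
        fix x assume x: "x \<in> W"
        \<comment> \<open>The union of the \<open>V n\<close> is an open neighbourhood of the union
          of the \<open>N n\<close>, so the assumption on \<open>Z\<close> puts \<open>W\<close>
          inside its closure.\<close>
        have "openin X (\<Union>n. V n)" "(\<Union>n. N n) \<subseteq> (\<Union>n. V n)" using V by auto
        then have xc: "x \<in> X closure_of (\<Union>n. V n)" using le W(2) x by blast
        show "x \<in> X closure_of (\<Union>k. P k)"
          unfolding in_closure_of
        proof (intro conjI allI impI)
          show "x \<in> topspace X" using x clopenin_subset[OF W(1)] by blast
          fix T assume T: "x \<in> T \<and> openin X T"
          then have "openin X (T \<inter> W)" "x \<in> T \<inter> W" using W(1) x by (auto simp: clopenin_def)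
          then obtain y n where y: "y \<in> V n" "y \<in> T" "y \<in> W"
            using xc unfolding in_closure_of by blast
          then have "y \<in> P (Suc n)"
            using closure_of_subset[OF openin_subset[OF V(1)[of n]]] by (auto simp: P_def)
          with y show "\<exists>y. y \<in> (\<Union>k. P k) \<and> y \<in> T" by blast
        qed
      qed
    qed
    have dir: "\<exists>C\<in>range P. A \<union> B \<subseteq> C" if "A \<in> range P" "B \<in> range P" for A B
    proof -
      from that obtain i j where "A = P i" "B = P j" by blast
      then have "A \<union> B \<subseteq> P (max i j)" using mono[of i "max i j"] mono[of j "max i j"] by simp
      then show ?thesis by blast
    qed
    obtain A where "A \<in> range P" "\<bar>m (X closure_of (\<Union>k. P k)) - m A\<bar> < e"
      by (rule order_continuous_charge_approx[OF m _ _ dir e]) (use P_clopen in auto)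
    then obtain k where "\<bar>m W - m (P k)\<bar> < e"
      unfolding closure by blast
    with P_bound[of k] sum_bound[of k] show False using e by (simp add: e_def)
  qed
qed

lemma null_set_in_Un:
  assumes "null_set_in X M" "null_set_in X N"
  shows "null_set_in X (M \<union> N)"
proof -
  have "null_set_in X (\<Union>n. if n = (0::nat) then M else N)"
    using assms by (intro null_set_in_UN) auto
  then show ?thesis by (rule null_set_in_mono) (force split: if_splits)
qed

lemma null_set_in_finite_UN:
  "finite I \<Longrightarrow> (\<And>i. i \<in> I \<Longrightarrow> null_set_in X (N i)) \<Longrightarrow> null_set_in X (\<Union>i\<in>I. N i)"
  by (induction rule: finite_induct) (auto intro: null_set_in_Un)

section \<open>Clopen representatives of Borel sets\<close>

definition clopen_rep :: "'a set \<Rightarrow> 'a set \<Rightarrow> bool"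
  where "clopen_rep \<Delta> C \<longleftrightarrow> clopenin X C \<and> null_set_in X (sym_diff \<Delta> C)"

lemma clopen_rep_self: "clopenin X C \<Longrightarrow> clopen_rep C C"
  by (simp add: clopen_rep_def)

lemma clopen_rep_open: "openin X V \<Longrightarrow> clopen_rep V (X closure_of V)"
  using openin_symdiff_closure_null[of V] closure_of_subset[OF openin_subset[of X V]]
  unfolding clopen_rep_def by (auto intro: clopenin_closure_of elim!: null_set_in_mono)

lemma clopen_rep_compl: "clopen_rep \<Delta> C \<Longrightarrow> clopen_rep (topspace X - \<Delta>) (topspace X - C)"
  unfolding clopen_rep_def by (auto intro: clopenin_diff elim!: null_set_in_mono)

lemma clopen_rep_Int:
  assumes "clopen_rep A C" "clopen_rep B D"
  shows "clopen_rep (A \<inter> B) (C \<inter> D)"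
  unfolding clopen_rep_def
proof
  show "clopenin X (C \<inter> D)" using assms by (auto simp: clopen_rep_def intro: clopenin_Int)
  have "null_set_in X (sym_diff A C \<union> sym_diff B D)"
    using assms by (auto simp: clopen_rep_def intro: null_set_in_Un)
  then show "null_set_in X (sym_diff (A \<inter> B) (C \<inter> D))"
    by (rule null_set_in_mono) auto
qed

text \<open>The union of the clopen sets is merely open. Passing to its closure adds a null boundary
  to the countable union of the individual errors.\<close>

lemma clopen_rep_UN:
  fixes A :: "nat \<Rightarrow> 'a set"
  assumes rep: "\<And>n. clopen_rep (A n) (C n)"
  shows "clopen_rep (\<Union>n. A n) (X closure_of (\<Union>n. C n))"
  unfolding clopen_rep_def
proof
  have op: "openin X (\<Union>n. C n)" using rep by (auto simp: clopen_rep_def clopenin_def)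
  show "clopenin X (X closure_of (\<Union>n. C n))" using op by (rule clopenin_closure_of)
  have "null_set_in X ((\<Union>n. sym_diff (A n) (C n)) \<union> (X closure_of (\<Union>n. C n) - (\<Union>n. C n)))"
    using rep[unfolded clopen_rep_def] op
    by (intro null_set_in_Un[OF null_set_in_UN openin_symdiff_closure_null]) blast+
  then show "null_set_in X (sym_diff (\<Union>n. A n) (X closure_of (\<Union>n. C n)))"
    using closure_of_subset[OF openin_subset[OF op]] by (rule_tac null_set_in_mono) blast+
qed

text \<open>\<open>C - D\<close> is open, and null because it is covered by the two errors; hence it
  is empty. The case \<open>A = B\<close> gives uniqueness of the representative.\<close>

lemma clopen_rep_mono:
  assumes "clopen_rep A C" "clopen_rep B D" "A \<subseteq> B"
  shows "C \<subseteq> D"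
proof -
  have "null_set_in X (sym_diff A C \<union> sym_diff B D)"
    using assms by (auto simp: clopen_rep_def intro: null_set_in_Un)
  then have "null_set_in X (C - D)"
    using assms(3) by (rule_tac null_set_in_mono) blast+
  moreover have "openin X (C - D)"
    using assms by (auto simp: clopen_rep_def clopenin_def intro: openin_diff)
  ultimately show ?thesis using openin_null_empty by blast
qed

lemma clopen_rep_ex:
  assumes "\<Delta> \<in> sets (Borel X)"
  shows "\<exists>C. clopen_rep \<Delta> C"
  using assms unfolding sets_Borel
proof induction
  case (Basic V)
  then show ?case using clopen_rep_open by blast
next
  case Empty
  then show ?case using clopen_rep_self by force
next
  case (Compl A)
  then show ?case using clopen_rep_compl by blast
next
  case (Union A)
  then have "\<forall>n. \<exists>C. clopen_rep (A n) C" by blast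
  then obtain C where "\<And>n. clopen_rep (A n) (C n)" by metis
  then show ?case using clopen_rep_UN by blast
qed

definition rep :: "'a set \<Rightarrow> 'a set"
  where "rep \<Delta> = (SOME C. clopen_rep \<Delta> C)"

lemma clopen_rep_rep: "\<Delta> \<in> sets (Borel X) \<Longrightarrow> clopen_rep \<Delta> (rep \<Delta>)"
  unfolding rep_def by (rule someI_ex) (rule clopen_rep_ex)

lemma rep_eqI: "clopen_rep \<Delta> C \<Longrightarrow> rep \<Delta> = C"
  unfolding rep_def
  by (rule some_equality) (auto dest: clopen_rep_mono[OF _ _ order_refl, THEN subsetD])

lemma clopenin_rep: "\<Delta> \<in> sets (Borel X) \<Longrightarrow> clopenin X (rep \<Delta>)"
  and null_rep: "\<Delta> \<in> sets (Borel X) \<Longrightarrow> null_set_in X (sym_diff \<Delta> (rep \<Delta>))"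
  using clopen_rep_rep by (auto simp: clopen_rep_def)

lemma rep_mono:
  "A \<in> sets (Borel X) \<Longrightarrow> B \<in> sets (Borel X) \<Longrightarrow> A \<subseteq> B \<Longrightarrow> rep A \<subseteq> rep B"
  by (meson clopen_rep_mono clopen_rep_rep)

lemma rep_open: "openin X V \<Longrightarrow> rep V = X closure_of V"
  by (intro rep_eqI clopen_rep_open)

lemma rep_Int: "A \<in> sets (Borel X) \<Longrightarrow> B \<in> sets (Borel X) \<Longrightarrow> rep (A \<inter> B) = rep A \<inter> rep B"
  by (intro rep_eqI clopen_rep_Int clopen_rep_rep)

lemma rep_empty [simp]: "rep {} = {}"
  and rep_topspace [simp]: "rep (topspace X) = topspace X"
  by (auto intro!: rep_eqI clopen_rep_self)

lemma rep_closed: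
  assumes "closedin X K"
  shows "rep K = X interior_of K"
proof -
  have "clopen_rep (topspace X - (topspace X - K)) (topspace X - X closure_of (topspace X - K))"
    using assms by (intro clopen_rep_compl clopen_rep_open) auto
  moreover have "topspace X - (topspace X - K) = K" using closedin_subset[OF assms] by blast
  ultimately show ?thesis by (simp add: rep_eqI interior_of_closure_of)
qed

lemma rep_UN:
  "(\<And>n. A n \<in> sets (Borel X)) \<Longrightarrow> rep (\<Union>n::nat. A n) = X closure_of (\<Union>n. rep (A n))"
  by (intro rep_eqI clopen_rep_UN clopen_rep_rep)

end

section \<open>Order integrals with respect to a measure in a sublattice\<close>

text \<open>Completeness provides the infimum of the positive multiples of \<open>u\<close>. Halving
  the multiples shows that twice this infimum is at most the infimum, so it is nonpositive.\<close>

lemma archimedean_le_zero: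
  fixes x u :: "'f::dedekind_complete_vector_lattice"
  assumes le: "\<And>\<epsilon>. 0 < \<epsilon> \<Longrightarrow> x \<le> \<epsilon> *\<^sub>R u"
  shows "x \<le> 0"
proof -
  define S where "S = (\<lambda>\<epsilon>. \<epsilon> *\<^sub>R u) ` {0<..}"
  have "S \<noteq> {}" by (auto simp: S_def)
  have bdd: "bdd_below S" using le by (intro bdd_belowI[of S x]) (auto simp: S_def)
  have x: "x \<le> Inf S" using le \<open>S \<noteq> {}\<close> by (intro cInf_greatest) (auto simp: S_def)
  have "2 *\<^sub>R Inf S \<le> Inf S"
  proof (rule cInf_greatest[OF \<open>S \<noteq> {}\<close>])
    fix y assume "y \<in> S"
    then obtain \<epsilon> where \<epsilon>: "0 < \<epsilon>" "y = \<epsilon> *\<^sub>R u" by (auto simp: S_def)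
    then have "(\<epsilon> / 2) *\<^sub>R u \<in> S" by (auto simp: S_def)
    then have "Inf S \<le> (\<epsilon> / 2) *\<^sub>R u" using bdd by (rule cInf_lower)
    then have "2 *\<^sub>R Inf S \<le> 2 *\<^sub>R ((\<epsilon> / 2) *\<^sub>R u)" by (rule scaleR_left_mono) simp
    then show "2 *\<^sub>R Inf S \<le> y" using \<epsilon> by simp
  qed
  then have "Inf S \<le> 0" by (simp add: scaleR_2)
  with x show ?thesis by (rule order_trans)
qed

lemma isLubI:
  assumes "z \<in> F" "\<And>a. a \<in> A \<Longrightarrow> a \<le> z" "\<And>u. u \<in> F \<Longrightarrow> (\<And>a. a \<in> A \<Longrightarrow> a \<le> u) \<Longrightarrow> z \<le> u"
  shows "isLub F A z"
  using assms unfolding isLub_def leastP_def isUb_def setle_def setge_def by blast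

lemma isLub_least: "isLub F A z \<Longrightarrow> u \<in> F \<Longrightarrow> (\<And>a. a \<in> A \<Longrightarrow> a \<le> u) \<Longrightarrow> z \<le> u"
  unfolding isLub_def leastP_def isUb_def setle_def setge_def by blast

lemma isLub_eq: "isLub F A y \<Longrightarrow> isLub F A z \<Longrightarrow> y = (z :: 'b::order)"
  by (meson isLub_isUb isLub_le_isUb order.antisym)

lemma isGlbI:
  assumes "z \<in> F" "\<And>a. a \<in> A \<Longrightarrow> z \<le> a" "\<And>u. u \<in> F \<Longrightarrow> (\<And>a. a \<in> A \<Longrightarrow> u \<le> a) \<Longrightarrow> u \<le> z"
  shows "isGlb F A z"
  using assms unfolding isGlb_def greatestP_def isLb_def setle_def setge_def by blast

lemma isGlb_greatest: "isGlb F A z \<Longrightarrow> u \<in> F \<Longrightarrow> (\<And>a. a \<in> A \<Longrightarrow> u \<le> a) \<Longrightarrow> u \<le> z"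
  unfolding isGlb_def greatestP_def isLb_def setle_def setge_def by blast

lemma isGlb_eq: "isGlb F A y \<Longrightarrow> isGlb F A z \<Longrightarrow> y = (z :: 'b::order)"
  unfolding isGlb_def greatestP_def isLb_def setle_def setge_def by (blast intro: order.antisym)

text \<open>Suprema in the definition of a measure are relative to \<open>F\<close>.
  \<open>Sup_mem\<close> lets the ambient \<open>Sup\<close> of a set bounded in \<open>F\<close>
  act as such a supremum; for the centre this is \<open>Sup_in_centre\<close>.\<close>

locale sublattice_measure =
  fixes F :: "'f::dedekind_complete_vector_lattice set" and M :: "'x measure" and \<nu> :: "'x set \<Rightarrow> 'f"
  assumes subspace: "subspace F"
    and Sup_mem: "A \<subseteq> F \<Longrightarrow> A \<noteq> {} \<Longrightarrow> u \<in> F \<Longrightarrow> (\<And>a. a \<in> A \<Longrightarrow> a \<le> u) \<Longrightarrow> Sup A \<in> F"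
    and measure: "lattice_measure F M \<nu>"
begin

lemma measure_mem: "A \<in> sets M \<Longrightarrow> \<nu> A \<in> F"
  and measure_nonneg: "A \<in> sets M \<Longrightarrow> 0 \<le> \<nu> A"
  using measure[unfolded lattice_measure_def, THEN conjunct1] by simp_all

lemma measure_empty [simp]: "\<nu> {} = 0"
  using measure unfolding lattice_measure_def by simp

lemma measure_UN:
  fixes D :: "nat \<Rightarrow> 'x set"
  shows "range D \<subseteq> sets M \<Longrightarrow> disjoint_family D \<Longrightarrow>
    isLub F (range (\<lambda>N. \<Sum>n<N. \<nu> (D n))) (\<nu> (\<Union>n. D n))"
  using measure[unfolded lattice_measure_def, THEN conjunct2, THEN conjunct2, rule_format, of D] .

lemma measure_Un:
  assumes "A \<in> sets M" "B \<in> sets M" "A \<inter> B = {}"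
  shows "\<nu> (A \<union> B) = \<nu> A + \<nu> B"
proof -
  define D where "D n = (if n = 0 then A else if n = 1 then B else {})" for n :: nat
  have D: "range D \<subseteq> sets M" "disjoint_family D" "(\<Union>n. D n) = A \<union> B"
    using assms by (auto simp: D_def disjoint_family_on_def split: if_splits)
  have lub: "isLub F (range (\<lambda>N. \<Sum>n<N. \<nu> (D n))) (\<nu> (A \<union> B))"
    using measure_UN[OF D(1,2)] D(3) by simp
  have sums: "(\<Sum>n<N. \<nu> (D n)) = (if N = 0 then 0 else if N = 1 then \<nu> A else \<nu> A + \<nu> B)" for N
  proof (induction N)
    case (Suc N)
    then show ?case by (auto simp: D_def)
  qed simp
  show ?thesis
  proof (rule order.antisym)
    show "\<nu> (A \<union> B) \<le> \<nu> A + \<nu> B"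
      by (rule isLub_least[OF lub])
         (use assms measure_mem measure_nonneg subspace_add[OF subspace] sums in \<open>auto split: if_splits\<close>)
    have "(\<Sum>n<2. \<nu> (D n)) \<in> range (\<lambda>N. \<Sum>n<N. \<nu> (D n))" by blast
    from isLubD2[OF lub this] show "\<nu> A + \<nu> B \<le> \<nu> (A \<union> B)"
      unfolding sums by simp
  qed
qed

lemma measure_finite_UN:
  assumes "finite I" "\<And>i. i \<in> I \<Longrightarrow> A i \<in> sets M" "disjoint_family_on A I"
  shows "\<nu> (\<Union>i\<in>I. A i) = (\<Sum>i\<in>I. \<nu> (A i))"
  using assms
proof (induction rule: finite_induct)
  case (insert j I)
  have "A j \<inter> (\<Union>i\<in>I. A i) = {}"
    using insert.hyps insert.prems(2) by (auto simp: disjoint_family_on_def)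
  moreover have "(\<Union>i\<in>I. A i) \<in> sets M" using insert by (intro sets.finite_UN) auto
  ultimately have "\<nu> (A j \<union> (\<Union>i\<in>I. A i)) = \<nu> (A j) + \<nu> (\<Union>i\<in>I. A i)"
    using insert.prems by (intro measure_Un) auto
  then show ?case
    using insert by (simp add: disjoint_family_on_insert)
qed simp

text \<open>This is continuity from below, phrased through upper bounds. The sets
  \<open>disjointed A n\<close> have the same union, and their first \<open>k + 1\<close> measures
  sum to \<open>\<nu> (A k)\<close>.\<close>

lemma measure_incseq_le:
  assumes A: "range A \<subseteq> sets M" "incseq A" and u: "u \<in> F" "\<And>n. \<nu> (A n) \<le> u"
  shows "\<nu> (\<Union>n. A n) \<le> u"
proof -
  have D: "range (disjointed A) \<subseteq> sets M" "disjoint_family (disjointed A)" "(\<Union>n. disjointed A n) = (\<Union>n. A n)"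
    using A(1) by (auto simp: UN_disjointed_eq disjoint_family_disjointed intro: sets.range_disjointed_sets[THEN subsetD])
  have lub: "isLub F (range (\<lambda>N. \<Sum>n<N. \<nu> (disjointed A n))) (\<nu> (\<Union>n. A n))"
    using measure_UN[OF D(1,2)] D(3) by simp
  have "(\<Sum>n<N. \<nu> (disjointed A n)) \<le> u" for N
  proof (cases N)
    \<comment> \<open>The empty partial sum is 0, which \<open>u\<close> dominates because it
      dominates the nonnegative \<open>\<nu> (A 0)\<close>.\<close>
    case 0
    have "0 \<le> \<nu> (A 0)" using A by (intro measure_nonneg) auto
    then show ?thesis using 0 u(2)[of 0] by auto
  next
    case (Suc k)
    have "(\<Sum>n<N. \<nu> (disjointed A n)) = \<nu> (\<Union>n<N. disjointed A n)"
      using D by (intro measure_finite_UN[symmetric]) (auto simp: disjoint_family_on_def)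
    also have "(\<Union>n<N. disjointed A n) = (\<Union>n<N. A n)"
      using finite_UN_disjointed_eq[of A N] by (simp add: atLeast0LessThan)
    also have "\<dots> = A k" using A(2) unfolding Suc lessThan_Suc_atMost incseq_def by blast
    finally show ?thesis using u by simp
  qed
  then show ?thesis
    by (intro isLub_least[OF lub u(1)]) blast
qed

section \<open>Integrals of simple functions\<close>

text \<open>The level sets of \<open>f\<close> are finite disjoint unions of fibres of
  \<open>k\<close>. Taking \<open>k\<close> to be a pair of simple functions writes both integrals
  over one common partition.\<close>

lemma simple_order_integral_partition:
  assumes "finite (k ` space M)" "\<And>b. b \<in> k ` space M \<Longrightarrow> k -` {b} \<inter> space M \<in> sets M"
    and f: "\<And>x. x \<in> space M \<Longrightarrow> f x = g (k x)"
  shows "simple_order_integral M \<nu> f = (\<Sum>b\<in>k ` space M. g b *\<^sub>R \<nu> (k -` {b} \<inter> space M))"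
proof -
  let ?m = "\<lambda>b. \<nu> (k -` {b} \<inter> space M)"
  have fib: "\<nu> (f -` {r} \<inter> space M) = (\<Sum>b\<in>{b \<in> k ` space M. g b = r}. ?m b)" for r
  proof -
    have "f -` {r} \<inter> space M = (\<Union>b\<in>{b \<in> k ` space M. g b = r}. k -` {b} \<inter> space M)"
      using f by auto
    also have "\<nu> \<dots> = (\<Sum>b\<in>{b \<in> k ` space M. g b = r}. ?m b)"
      using assms by (intro measure_finite_UN) (auto simp: disjoint_family_on_def)
    finally show ?thesis .
  qed
  have img: "f ` space M = g ` k ` space M" using f by (force simp: image_iff)
  have "simple_order_integral M \<nu> f = (\<Sum>r\<in>f ` space M. \<Sum>b\<in>{b \<in> k ` space M. g b = r}. g b *\<^sub>R ?m b)"
    unfolding simple_order_integral_def fib by (auto simp: scaleR_sum_right intro!: sum.cong)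
  also have "\<dots> = (\<Sum>b\<in>k ` space M. g b *\<^sub>R ?m b)"
    unfolding img using assms(1) by (intro sum.group) auto
  finally show ?thesis .
qed

lemma simple_order_integral_linear:
  assumes "simple_function M f" "simple_function M g"
  shows "simple_order_integral M \<nu> (\<lambda>x. a * f x + b * g x) =
    a *\<^sub>R simple_order_integral M \<nu> f + b *\<^sub>R simple_order_integral M \<nu> g"
proof -
  let ?k = "\<lambda>x. (f x, g x)"
  have "simple_function M ?k" using assms by (rule simple_function_Pair)
  then have k: "finite (?k ` space M)" "\<And>b. b \<in> ?k ` space M \<Longrightarrow> ?k -` {b} \<inter> space M \<in> sets M"
    by (auto simp: simple_function_def)
  show ?thesis
    by (simp add: simple_order_integral_partition[OF k, where f = "\<lambda>x. a * f x + b * g x" and g = "\<lambda>(u, v). a * u + b * v"]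
        simple_order_integral_partition[OF k, where f = f and g = fst]
        simple_order_integral_partition[OF k, where f = g and g = snd]
        scaleR_sum_right scaleR_add_left case_prod_beta flip: sum.distrib)
qed

lemma simple_order_integral_mono:
  assumes "simple_function M f" "simple_function M g" "\<And>x. x \<in> space M \<Longrightarrow> f x \<le> g x"
  shows "simple_order_integral M \<nu> f \<le> simple_order_integral M \<nu> g"
proof -
  let ?k = "\<lambda>x. (f x, g x)"
  have "simple_function M ?k" using assms(1,2) by (rule simple_function_Pair)
  then have k: "finite (?k ` space M)" "\<And>b. b \<in> ?k ` space M \<Longrightarrow> ?k -` {b} \<inter> space M \<in> sets M"
    by (auto simp: simple_function_def)
  show ?thesis
    using assms(3) k
    by (auto simp: simple_order_integral_partition[OF k, where f = f and g = fst]
        simple_order_integral_partition[OF k, where f = g and g = snd]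
        intro!: sum_mono scaleR_right_mono measure_nonneg)
qed

lemma simple_order_integral_const: "simple_order_integral M \<nu> (\<lambda>x. c) = c *\<^sub>R \<nu> (space M)"
  by (cases "space M = {}") (auto simp: simple_order_integral_def image_constant_conv)

lemma simple_order_integral_indicator:
  assumes "A \<in> sets M"
  shows "simple_order_integral M \<nu> (indicator A) = \<nu> A"
proof -
  let ?k = "\<lambda>x. x \<in> A"
  have "?k -` {b} \<inter> space M \<in> sets M" for b
  proof -
    have "?k -` {b} \<inter> space M = (if b then A else space M - A)"
      using sets.sets_into_space[OF assms] by auto
    then show ?thesis using assms by auto
  qed
  then have "simple_order_integral M \<nu> (indicator A) =
      (\<Sum>b\<in>?k ` space M. of_bool b *\<^sub>R \<nu> (?k -` {b} \<inter> space M))"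
    by (intro simple_order_integral_partition) (auto simp: indicator_def)
  \<comment> \<open>For empty \<open>A\<close> the value \<open>True\<close> is not attained, but
    its term is then the measure of the empty set; the term of \<open>False\<close> has coefficient
    0.\<close>
  also have "\<dots> = (\<Sum>b\<in>{True}. of_bool b *\<^sub>R \<nu> (?k -` {b} \<inter> space M))"
  proof (rule sum.mono_neutral_cong)
    fix b assume "b \<in> {True} - ?k ` space M"
    then have "?k -` {b} \<inter> space M = {}" by blast
    then show "of_bool b *\<^sub>R \<nu> (?k -` {b} \<inter> space M) = 0" by simp
  qed auto
  also have "\<dots> = \<nu> A"
    using sets.sets_into_space[OF assms] by (auto intro!: arg_cong[of _ _ \<nu>])
  finally show ?thesis .
qed

lemma simple_order_integral_mem:
  assumes "simple_function M f"
  shows "simple_order_integral M \<nu> f \<in> F"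
  unfolding simple_order_integral_def
  using assms by (intro subspace_sum subspace_scale subspace measure_mem) (auto simp: simple_function_def)

text \<open>Given \<open>\<epsilon> > 0\<close>, the set where \<open>t - \<epsilon> \<le> s n\<close> increases to the whole space; \<open>\<epsilon>\<close> is
  removed at the end by the Archimedean property.\<close>

lemma simple_order_integral_monotone_convergence:
  assumes t: "simple_function M t" and s: "\<And>n. simple_function M (s n)" "\<And>n x. x \<in> space M \<Longrightarrow> 0 \<le> s n x"
    and inc: "\<And>x. x \<in> space M \<Longrightarrow> incseq (\<lambda>n. s n x)"
    and lim: "\<And>x. x \<in> space M \<Longrightarrow> (\<lambda>n. s n x) \<longlonglongrightarrow> f x"
    and le: "\<And>x. x \<in> space M \<Longrightarrow> t x \<le> f x"
    and z: "z \<in> F" "\<And>n. simple_order_integral M \<nu> (s n) \<le> z"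
  shows "simple_order_integral M \<nu> t \<le> z"
proof -
  let ?I = "simple_order_integral M \<nu>"
  have fin: "finite (t ` space M)" using t by (simp add: simple_function_def)
  \<comment> \<open>An upper bound of \<open>t\<close>, kept positive by the \<open>1\<close> so
    that it can be inverted.\<close>
  define c where "c = max (Max (t ` space M)) 1"
  have c: "0 < c" "\<And>x. x \<in> space M \<Longrightarrow> t x \<le> c"
    using Max_ge[OF fin] by (auto simp: c_def le_max_iff_disj)
  have "?I t - z \<le> \<epsilon> *\<^sub>R \<nu> (space M)" if \<epsilon>: "0 < \<epsilon>" for \<epsilon>
  proof -
    define A where "A n = {x \<in> space M. t x - \<epsilon> \<le> s n x}" for n
    have A_sets: "A n \<in> sets M" for n
      using borel_measurable_simple_function[OF t] borel_measurable_simple_function[OF s(1)]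
      unfolding A_def by measurable
    have "incseq A" using inc by (fastforce simp: A_def incseq_def intro: order_trans)
    have UN_A: "(\<Union>n. A n) = space M"
    proof
      show "space M \<subseteq> (\<Union>n. A n)"
      proof
        fix x assume x: "x \<in> space M"
        then have "t x - \<epsilon> < f x" using le[OF x] \<epsilon> by linarith
        from order_tendstoD(1)[OF lim[OF x] this] obtain n where "t x - \<epsilon> < s n x"
          by (auto simp: eventually_sequentially)
        then show "x \<in> (\<Union>n. A n)" using x by (auto simp: A_def intro: less_imp_le)
      qed
    qed (auto simp: A_def)
    \<comment> \<open>This is the bound obtained by solving \<open>?I t \<le> z + \<epsilon>
      \<nu>(space M) + c (\<nu>(space M) - \<nu>(A n))\<close> for
      \<open>\<nu>(A n)\<close>.\<close>
    define u where "u = inverse c *\<^sub>R (z + \<epsilon> *\<^sub>R \<nu> (space M) - ?I t) + \<nu> (space M)"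
    have "u \<in> F"
      unfolding u_def using z(1) measure_mem[of "space M"] simple_order_integral_mem[OF t]
      by (intro subspace_add subspace_diff subspace_scale subspace) auto
    have "\<nu> (A n) \<le> u" for n
    proof -
      let ?B = "space M - A n"
      have B: "?B \<in> sets M" using A_sets by auto
      have sB: "simple_function M (\<lambda>x. \<epsilon> * 1 + c * indicator ?B x)"
        using B by (intro simple_function_add simple_function_mult) auto
      \<comment> \<open>On \<open>A n\<close>, \<open>t\<close> is at most
        \<open>s n + \<epsilon>\<close>; off it, \<open>t\<close> is at most \<open>c\<close> and
        \<open>s n\<close> is nonnegative.\<close>
      have "?I t \<le> ?I (\<lambda>x. 1 * s n x + 1 * (\<epsilon> * 1 + c * indicator ?B x))"
      proof (rule simple_order_integral_mono[OF t])
        show "simple_function M (\<lambda>x. 1 * s n x + 1 * (\<epsilon> * 1 + c * indicator ?B x))"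
          using simple_function_add[OF s(1)[of n] sB] by simp
        fix x assume x: "x \<in> space M"
        show "t x \<le> 1 * s n x + 1 * (\<epsilon> * 1 + c * indicator ?B x)"
          using c(2)[OF x] s(2)[OF x, of n] x \<epsilon> by (cases "x \<in> A n") (auto simp: A_def)
      qed
      also have "\<dots> = ?I (s n) + (\<epsilon> *\<^sub>R \<nu> (space M) + c *\<^sub>R \<nu> ?B)"
        using simple_order_integral_linear[OF s(1)[of n] sB, of 1 1]
          simple_order_integral_linear[OF simple_function_const simple_function_indicator[OF B], of \<epsilon> 1 c]
        by (simp add: simple_order_integral_const simple_order_integral_indicator[OF B])
      also have "\<dots> \<le> z + (\<epsilon> *\<^sub>R \<nu> (space M) + c *\<^sub>R \<nu> ?B)"
        using z(2) by (rule add_right_mono)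
      also have "\<nu> ?B = \<nu> (space M) - \<nu> (A n)"
        using measure_Un[of "A n" ?B] A_sets B sets.sets_into_space[OF A_sets[of n]]
        by (simp add: Un_absorb1)
      finally have "c *\<^sub>R \<nu> (A n) \<le> z + \<epsilon> *\<^sub>R \<nu> (space M) - ?I t + c *\<^sub>R \<nu> (space M)"
        by (simp add: algebra_simps)
      then have "inverse c *\<^sub>R (c *\<^sub>R \<nu> (A n)) \<le> inverse c *\<^sub>R (z + \<epsilon> *\<^sub>R \<nu> (space M) - ?I t + c *\<^sub>R \<nu> (space M))"
        using c(1) by (intro scaleR_left_mono) auto
      then show ?thesis using c(1) by (simp add: u_def scaleR_add_right)
    qed
    \<comment> \<open>In the limit \<open>A n\<close> becomes the whole space, and
      \<open>\<nu> (space M)\<close> cancels against the last summand of \<open>u\<close>.\<close>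
    then have "\<nu> (space M) \<le> u"
      using measure_incseq_le[OF _ \<open>incseq A\<close> \<open>u \<in> F\<close>] A_sets UN_A by auto
    then have "0 \<le> inverse c *\<^sub>R (z + \<epsilon> *\<^sub>R \<nu> (space M) - ?I t)" by (simp add: u_def)
    then have "c *\<^sub>R 0 \<le> c *\<^sub>R (inverse c *\<^sub>R (z + \<epsilon> *\<^sub>R \<nu> (space M) - ?I t))"
      using c(1) by (intro scaleR_left_mono) auto
    then show ?thesis using c(1) by (simp add: algebra_simps)
  qed
  then have "?I t - z \<le> 0" by (rule archimedean_le_zero)
  then show ?thesis by simp
qed

section \<open>Order integrals of bounded nonnegative functions\<close>

lemma simple_approximation_ex:
  assumes "f \<in> borel_measurable M" "\<And>x. 0 \<le> f x"
  shows "\<exists>s. simple_approximation M s f"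
proof -
  obtain s where s: "incseq s" "\<And>i. simple_function M (s i)" "\<And>x. bdd_above (range (\<lambda>i. s i x))"
    "\<And>i x. 0 \<le> s i x" "f = (SUP i. s i)"
    using borel_measurable_implies_simple_function_sequence_real[OF assms] by metis
  have "(\<lambda>i. s i x) \<longlonglongrightarrow> f x" for x
    using LIMSEQ_incseq_SUP[of "\<lambda>i. s i x"] s(1,3,5) by (simp add: mono_def le_fun_def incseq_def image_image)
  then show ?thesis
    using s unfolding simple_approximation_def by (intro exI[of _ s]) (auto simp: incseq_def le_fun_def)
qed

text \<open>Monotone convergence, applied to each term of one approximating sequence against another
  sequence, shows that their integrals have the same upper bounds in \<open>F\<close>. So the
  supremum, which exists because \<open>f\<close> is bounded, is common to all sequences and the
  description in the definition is proper.\<close>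

lemma isLub_order_integral_nonneg:
  assumes f: "f \<in> borel_measurable M" "\<And>x. 0 \<le> f x" "\<And>x. x \<in> space M \<Longrightarrow> f x \<le> c"
    and approx: "simple_approximation M s f"
  shows "isLub F (range (\<lambda>n. simple_order_integral M \<nu> (s n))) (order_integral_nonneg F M \<nu> f)"
proof -
  let ?I = "simple_order_integral M \<nu>"
  obtain s0 where s0: "simple_approximation M s0 f" using simple_approximation_ex[OF f(1,2)] by blast
  have le: "?I (r n) \<le> z"
    if r: "simple_approximation M r f" and s: "simple_approximation M s f"
      and z: "z \<in> F" "\<And>n. ?I (s n) \<le> z" for r s n z
  proof (rule simple_order_integral_monotone_convergence[OF _ _ _ _ _ _ z])
    fix x assume x: "x \<in> space M"
    have "incseq (\<lambda>n. r n x)" "(\<lambda>n. r n x) \<longlonglongrightarrow> f x"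
      using r x unfolding simple_approximation_def by auto
    then show "r n x \<le> f x" by (rule incseq_le)
  qed (use r s in \<open>auto simp: simple_approximation_def\<close>)
  define z where "z = Sup (range (\<lambda>n. ?I (s0 n)))"
  have ub: "?I (s0 n) \<le> c *\<^sub>R \<nu> (space M)" for n
  proof -
    have "?I (s0 n) \<le> ?I (\<lambda>x. c)"
    proof (rule simple_order_integral_mono)
      fix x assume x: "x \<in> space M"
      have "incseq (\<lambda>n. s0 n x)" "(\<lambda>n. s0 n x) \<longlonglongrightarrow> f x"
        using s0 x unfolding simple_approximation_def by auto
      then have "s0 n x \<le> f x" by (rule incseq_le)
      then show "s0 n x \<le> c" using f(3)[OF x] by simp
    qed (use s0 in \<open>auto simp: simple_approximation_def\<close>)
    then show ?thesis by (simp add: simple_order_integral_const)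
  qed
  have mem: "?I (s0 n) \<in> F" for n
    using s0 by (intro simple_order_integral_mem) (auto simp: simple_approximation_def)
  have "z \<in> F" unfolding z_def
    by (rule Sup_mem[of _ "c *\<^sub>R \<nu> (space M)"])
       (use ub mem measure_mem subspace_scale[OF subspace] in auto)
  have "bdd_above (range (\<lambda>n. ?I (s0 n)))" using ub unfolding bdd_above_def by blast
  then have z: "?I (s0 n) \<le> z" for n unfolding z_def by (intro cSup_upper) auto
  have lub: "isLub F (range (\<lambda>n. ?I (s n))) z" if s: "simple_approximation M s f" for s
  proof (rule isLubI[OF \<open>z \<in> F\<close>])
    fix a assume "a \<in> range (\<lambda>n. ?I (s n))"
    then show "a \<le> z" using le[OF s s0 \<open>z \<in> F\<close> z] by blast
  next
    fix u assume u: "u \<in> F" "\<And>a. a \<in> range (\<lambda>n. ?I (s n)) \<Longrightarrow> a \<le> u"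
    then have "?I (s0 n) \<le> u" for n by (intro le[OF s0 s]) auto
    then show "z \<le> u" unfolding z_def by (intro cSup_least) auto
  qed
  have "order_integral_nonneg F M \<nu> f = z"
    unfolding order_integral_nonneg_def
    by (rule the_equality) (use lub s0 isLub_eq in blast)+
  with lub[OF approx] show ?thesis by simp
qed

lemma order_integral_nonneg_cong:
  assumes "\<And>x. x \<in> space M \<Longrightarrow> f x = g x"
  shows "order_integral_nonneg F M \<nu> f = order_integral_nonneg F M \<nu> g"
proof -
  have "simple_approximation M s f \<longleftrightarrow> simple_approximation M s g" for s
    using assms by (simp add: simple_approximation_def)
  then show ?thesis by (simp add: order_integral_nonneg_def)
qed

lemma order_integral_nonneg_zero:
  assumes "\<And>x. x \<in> space M \<Longrightarrow> f x = 0"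
  shows "order_integral_nonneg F M \<nu> f = 0"
proof -
  have "order_integral_nonneg F M \<nu> f = order_integral_nonneg F M \<nu> (\<lambda>x. 0)"
    using assms by (rule order_integral_nonneg_cong)
  moreover have "isLub F (range (\<lambda>n::nat. simple_order_integral M \<nu> (\<lambda>x. 0))) (order_integral_nonneg F M \<nu> (\<lambda>x. 0))"
    by (rule isLub_order_integral_nonneg[of _ 0]) (auto simp: simple_approximation_def incseq_def)
  moreover have "isLub F (range (\<lambda>n::nat. simple_order_integral M \<nu> (\<lambda>x. 0))) 0"
    by (rule isLubI) (auto simp: simple_order_integral_const subspace_0[OF subspace])
  ultimately show ?thesis using isLub_eq by metis
qed

end

section \<open>The representing measure\<close>

text \<open>For the centre, \<open>h\<close> is the real part of the isomorphism and
  \<open>e\<close> the identity operator. Values of \<open>h\<close> off \<open>topspace X\<close>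
  are left open, so order and surjectivity are expressed pointwise on
  \<open>topspace X\<close>.\<close>

locale function_representation =
  fixes X :: "'x topology" and F :: "'f::{dedekind_complete_vector_lattice,real_algebra} set"
    and e :: 'f and h :: "'f \<Rightarrow> 'x \<Rightarrow> real"
  assumes compact_X: "compact_space X" and Hausdorff_X: "Hausdorff_space X"
    and subspace: "subspace F"
    and Sup_mem: "\<And>A u. A \<subseteq> F \<Longrightarrow> A \<noteq> {} \<Longrightarrow> u \<in> F \<Longrightarrow> (\<And>a. a \<in> A \<Longrightarrow> a \<le> u) \<Longrightarrow> Sup A \<in> F"
    and h_cont: "\<And>T. T \<in> F \<Longrightarrow> continuous_map X euclideanreal (h T)"
    and h_surj: "\<And>f. continuous_map X euclideanreal f \<Longrightarrow> \<exists>T\<in>F. \<forall>x\<in>topspace X. h T x = f x"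
    and le_iff: "\<And>S T. S \<in> F \<Longrightarrow> T \<in> F \<Longrightarrow> S \<le> T \<longleftrightarrow> (\<forall>x\<in>topspace X. h S x \<le> h T x)"
    and h_add: "\<And>S T x. S \<in> F \<Longrightarrow> T \<in> F \<Longrightarrow> x \<in> topspace X \<Longrightarrow> h (S + T) x = h S x + h T x"
    and h_scale: "\<And>c T x. T \<in> F \<Longrightarrow> x \<in> topspace X \<Longrightarrow> h (c *\<^sub>R T) x = c * h T x"
    and mult_mem: "\<And>S T. S \<in> F \<Longrightarrow> T \<in> F \<Longrightarrow> S * T \<in> F"
    and h_mult: "\<And>S T x. S \<in> F \<Longrightarrow> T \<in> F \<Longrightarrow> x \<in> topspace X \<Longrightarrow> h (S * T) x = h S x * h T x"
    and unit_mem: "e \<in> F" and h_unit: "\<And>x. x \<in> topspace X \<Longrightarrow> h e x = 1"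
begin

lemma h_zero: "x \<in> topspace X \<Longrightarrow> h 0 x = 0"
  using h_scale[OF subspace_0[OF subspace], of x 0] by simp

lemma h_sum:
  "finite I \<Longrightarrow> (\<And>i. i \<in> I \<Longrightarrow> T i \<in> F) \<Longrightarrow> x \<in> topspace X \<Longrightarrow> h (\<Sum>i\<in>I. T i) x = (\<Sum>i\<in>I. h (T i) x)"
  by (induction rule: finite_induct) (simp_all add: h_zero h_add subspace_sum[OF subspace])

lemma h_eqI:
  assumes "S \<in> F" "T \<in> F" "\<And>x. x \<in> topspace X \<Longrightarrow> h S x = h T x"
  shows "S = T"
  using assms le_iff by (metis order.antisym order_refl)

definition J :: "('x \<Rightarrow> real) \<Rightarrow> 'f"
  where "J f = (SOME T. T \<in> F \<and> (\<forall>x\<in>topspace X. h T x = f x))"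

lemma J_mem: "continuous_map X euclideanreal f \<Longrightarrow> J f \<in> F"
  and h_J: "continuous_map X euclideanreal f \<Longrightarrow> x \<in> topspace X \<Longrightarrow> h (J f) x = f x"
proof -
  have *: "J f \<in> F \<and> (\<forall>x\<in>topspace X. h (J f) x = f x)" if "continuous_map X euclideanreal f"
    unfolding J_def by (rule someI_ex) (use h_surj[OF that] in blast)
  show "continuous_map X euclideanreal f \<Longrightarrow> J f \<in> F"
    "continuous_map X euclideanreal f \<Longrightarrow> x \<in> topspace X \<Longrightarrow> h (J f) x = f x"
    using * by auto
qed

abbreviation clopen_proj :: "'x set \<Rightarrow> 'f"
  where "clopen_proj C \<equiv> J (indicator C)"

lemma clopen_proj_mem: "clopenin X C \<Longrightarrow> clopen_proj C \<in> F"
  and h_clopen_proj: "clopenin X C \<Longrightarrow> x \<in> topspace X \<Longrightarrow> h (clopen_proj C) x = indicator C x"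
  by (simp_all add: J_mem h_J continuous_map_indicator)

lemma openin_less:
  assumes "S \<in> F" "T \<in> F"
  shows "openin X {x \<in> topspace X. h S x < h T x}"
proof -
  have "openin X {x \<in> topspace X. h T x - h S x \<in> {0<..}}"
    using h_cont assms by (intro openin_continuous_map_preimage[of X euclideanreal] continuous_map_diff) auto
  then show ?thesis by simp
qed

lemma closedin_le:
  assumes "S \<in> F" "T \<in> F"
  shows "closedin X {x \<in> topspace X. h S x \<le> h T x}"
proof -
  have "{x \<in> topspace X. h S x \<le> h T x} = topspace X - {x \<in> topspace X. h T x < h S x}"
    by auto
  then show ?thesis using openin_less[OF assms(2,1)] by (simp add: closedin_diff)
qed

lemma le_on_closure:
  assumes "S \<in> F" "T \<in> F" "A \<subseteq> topspace X" "\<And>x. x \<in> A \<Longrightarrow> h S x \<le> h T x" "x \<in> X closure_of A"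
  shows "h S x \<le> h T x"
proof -
  have "X closure_of A \<subseteq> {x \<in> topspace X. h S x \<le> h T x}"
    using assms(3,4) by (intro closure_of_minimal closedin_le assms(1,2)) auto
  with assms(5) show ?thesis by blast
qed

lemma Urysohn_F:
  assumes "closedin X K" "closedin X L" "K \<inter> L = {}"
  shows "\<exists>T\<in>F. (\<forall>x\<in>topspace X. 0 \<le> h T x \<and> h T x \<le> 1) \<and> (\<forall>x\<in>K. h T x = 0) \<and> (\<forall>x\<in>L. h T x = 1)"
proof -
  have normal: "normal_space X"
    using compact_Hausdorff_or_regular_imp_normal_space compact_X Hausdorff_X by blast
  obtain f where f: "continuous_map X (top_of_set {0..1::real}) f" "f ` K \<subseteq> {0}" "f ` L \<subseteq> {1}"
    by (rule Urysohn_lemma[OF normal assms(1,2), of 0 1]) (use assms(3) in \<open>auto simp: disjnt_def\<close>)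
  then have c: "continuous_map X euclideanreal f" and r: "\<And>x. x \<in> topspace X \<Longrightarrow> f x \<in> {0..1}"
    by (auto simp: continuous_map_in_subtopology)
  have "K \<subseteq> topspace X" "L \<subseteq> topspace X" using assms closedin_subset by auto
  then show ?thesis
    using f(2,3) r h_J[OF c] by (intro bexI[OF _ J_mem[OF c]]) (auto simp: subset_iff)
qed

section \<open>Suprema and infima of families of continuous functions\<close>

definition support :: "'f \<Rightarrow> 'x set"
  where "support T = X closure_of {x \<in> topspace X. h T x \<noteq> 0}"

definition subordinate :: "'x set \<Rightarrow> 'f set"
  where "subordinate V = {T \<in> F. (\<forall>x\<in>topspace X. 0 \<le> h T x \<and> h T x \<le> 1) \<and> support T \<subseteq> V}"

definition dominating :: "'x set \<Rightarrow> 'f set"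
  where "dominating K = {T \<in> F. (\<forall>x\<in>topspace X. 0 \<le> h T x \<and> h T x \<le> 1) \<and> (\<forall>x\<in>K. h T x = 1)}"

lemma zero_subordinate: "0 \<in> subordinate V"
  by (simp add: subordinate_def subspace_0[OF subspace] h_zero support_def cong: conj_cong)

text \<open>Vanishing off \<open>V\<close> would not keep the closed support inside
  \<open>V\<close>. So \<open>V\<close> is first shrunk to an open \<open>U\<close> that is disjoint
  from an open set \<open>W\<close> around the complement of \<open>V\<close>; a function vanishing
  off \<open>U\<close> has its support outside \<open>W\<close>.\<close>

lemma subordinate_bump:
  assumes V: "openin X V" and x: "x \<in> V"
  obtains T where "T \<in> subordinate V" "h T x = 1"
proof -
  have reg: "regular_space X"
    by (rule compact_Hausdorff_imp_regular_space[OF compact_X Hausdorff_X])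
  have xX: "x \<in> topspace X" using V x openin_subset by blast
  have "closedin X (topspace X - V)" "x \<in> topspace X - (topspace X - V)" using V x xX by auto
  with reg obtain U W where UW: "openin X U" "openin X W" "x \<in> U" "topspace X - V \<subseteq> W" "disjnt U W"
    unfolding regular_space_def by metis
  have "closedin X (topspace X - U)" "closedin X {x}"
    using UW(1) xX Hausdorff_X by (auto simp: closedin_Hausdorff_singleton)
  from Urysohn_F[OF this] UW(3)
  obtain T where T: "T \<in> F" "\<forall>x\<in>topspace X. 0 \<le> h T x \<and> h T x \<le> 1"
    "\<And>y. y \<in> topspace X - U \<Longrightarrow> h T y = 0" "h T x = 1"
    by auto
  have "support T \<subseteq> topspace X - W"
    unfolding support_def
    using T(3) UW(2,5) by (intro closure_of_minimal) (auto simp: disjnt_def)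
  then have "support T \<subseteq> V" using UW(4) by blast
  with T that[of T] show ?thesis by (simp add: subordinate_def)
qed

text \<open>Bumps force the value of \<open>z\<close> to be at least 1 on \<open>V\<close>, hence on
  its closure by continuity. At a point outside the closure, a Urysohn function that is 1 on the
  closure and 0 at the point is an upper bound and forces the value 0.\<close>

lemma h_isLub_subordinate:
  assumes V: "openin X V" and z: "isLub F (subordinate V) z" and x: "x \<in> topspace X"
  shows "h z x = indicator (X closure_of V) x"
proof -
  have zF: "z \<in> F" using z by (rule isLubD1a)
  have ub: "h T y \<le> h z y" if "T \<in> subordinate V" "y \<in> topspace X" for T y
    using isLubD2[OF z that(1)] that zF le_iff[of T z] by (auto simp: subordinate_def)
  have VX: "V \<subseteq> topspace X" using V by (rule openin_subset)
  from ub[OF zero_subordinate x] have nonneg: "0 \<le> h z x" using h_zero[OF x] by simp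
  have le_ub: "h z y \<le> h S y"
    if "S \<in> F" "\<And>y. y \<in> topspace X \<Longrightarrow> 0 \<le> h S y \<and> h S y \<le> 1" "\<And>y. y \<in> V \<Longrightarrow> h S y = 1" "y \<in> topspace X" for S y
  proof -
    have "T \<le> S" if T: "T \<in> subordinate V" for T
    proof -
      have "h T y \<le> h S y" if y: "y \<in> topspace X" for y
      proof (cases "h T y = 0")
        case False
        then have "y \<in> support T"
          using y closure_of_subset[of "{x \<in> topspace X. h T x \<noteq> 0}" X] by (auto simp: support_def)
        then show ?thesis using T y \<open>\<And>y. y \<in> V \<Longrightarrow> h S y = 1\<close> by (auto simp: subordinate_def)
      qed (use \<open>\<And>y. y \<in> topspace X \<Longrightarrow> 0 \<le> h S y \<and> h S y \<le> 1\<close> y in auto)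
      then show ?thesis using T \<open>S \<in> F\<close> by (simp add: le_iff subordinate_def)
    qed
    then have "z \<le> S" by (rule isLub_least[OF z \<open>S \<in> F\<close>])
    then show ?thesis using le_iff[OF zF \<open>S \<in> F\<close>] that(4) by blast
  qed
  show ?thesis
  proof (cases "x \<in> X closure_of V")
    case True
    have "h e y \<le> h z y" if "y \<in> V" for y
    proof -
      obtain T where "T \<in> subordinate V" "h T y = 1" using subordinate_bump[OF V \<open>y \<in> V\<close>] .
      then show ?thesis using ub[of T y] that VX h_unit[of y] by auto
    qed
    from le_on_closure[OF unit_mem zF VX this True] have "1 \<le> h z x" using h_unit[OF x] by simp
    moreover have "h z x \<le> h e x" using VX x by (intro le_ub unit_mem) (auto simp: h_unit)
    ultimately show ?thesis using True h_unit[OF x] by simp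
  next
    case False
    have "closedin X {x}" using x Hausdorff_X by (simp add: closedin_Hausdorff_singleton)
    from Urysohn_F[OF this closedin_closure_of, of V] False
    obtain S where S: "S \<in> F" "\<forall>x\<in>topspace X. 0 \<le> h S x \<and> h S x \<le> 1"
      "h S x = 0" "\<forall>y\<in>X closure_of V. h S y = 1"
      by auto
    have "h z x \<le> h S x"
      using closure_of_subset[OF VX] S by (intro le_ub S x) auto
    then show ?thesis using S(3) False nonneg by simp
  qed
qed

lemma isLub_subordinate_ex:
  assumes "openin X V"
  shows "\<exists>z. isLub F (subordinate V) z"
proof -
  have ne: "subordinate V \<noteq> {}" using zero_subordinate by blast
  have ub: "T \<le> e" if "T \<in> subordinate V" for T
    using that by (auto simp: subordinate_def le_iff unit_mem h_unit)
  have sub: "subordinate V \<subseteq> F" by (auto simp: subordinate_def)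
  have "isLub F (subordinate V) (Sup (subordinate V))"
  proof (rule isLubI)
    show "Sup (subordinate V) \<in> F" using sub ne unit_mem ub by (rule Sup_mem)
    show "T \<le> Sup (subordinate V)" if "T \<in> subordinate V" for T
      using that by (rule cSup_upper) (rule bdd_aboveI[of _ e], rule ub)
    show "Sup (subordinate V) \<le> u" if "\<And>T. T \<in> subordinate V \<Longrightarrow> T \<le> u" for u
      using ne that by (rule cSup_least)
  qed
  then show ?thesis by blast
qed

text \<open>Completeness supplies the supremum of the functions subordinate to \<open>V\<close>. It
  is represented by the indicator of the closure of \<open>V\<close>, and continuity of this
  indicator makes the closure open.\<close>

sublocale extremally_disconnected_space X
proof
  show "compact_space X" "Hausdorff_space X" by (rule compact_X Hausdorff_X)+
  fix V assume V: "openin X V"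
  then obtain z where z: "isLub F (subordinate V) z" using isLub_subordinate_ex by blast
  have zF: "z \<in> F" using z by (rule isLubD1a)
  have "{x \<in> topspace X. h 0 x < h z x} = X closure_of V"
    using h_isLub_subordinate[OF V z] h_zero closure_of_subset_topspace[of X V]
    by (auto simp: indicator_def split: if_splits)
  then show "openin X (X closure_of V)"
    using openin_less[OF subspace_0[OF subspace] zF] by simp
qed

lemma isLub_subordinate:
  assumes "openin X V"
  shows "isLub F (subordinate V) (clopen_proj (X closure_of V))"
proof -
  obtain z where z: "isLub F (subordinate V) z" using isLub_subordinate_ex[OF assms] by blast
  have "clopen_proj (X closure_of V) = z"
    by (rule h_eqI)
       (use z clopenin_closure_of[OF assms] in
         \<open>auto simp: clopen_proj_mem h_clopen_proj h_isLub_subordinate[OF assms z] intro: isLubD1a\<close>)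
  with z show ?thesis by simp
qed

text \<open>Urysohn functions vanishing at a point outside \<open>K\<close> make every lower bound
  nonpositive there, and continuity extends this to the closure of the complement. Only the interior
  of \<open>K\<close> remains, where \<open>e\<close> gives the bound 1.\<close>

lemma isGlb_dominating:
  assumes K: "closedin X K"
  shows "isGlb F (dominating K) (clopen_proj (X interior_of K))"
proof -
  have int: "X interior_of K = topspace X - X closure_of (topspace X - K)"
    by (rule interior_of_closure_of)
  have clopen: "clopenin X (X interior_of K)"
    unfolding int using K by (intro clopenin_diff clopenin_closure_of) auto
  show ?thesis
  proof (rule isGlbI)
    show "clopen_proj (X interior_of K) \<in> F" using clopen by (rule clopen_proj_mem)
    show "clopen_proj (X interior_of K) \<le> T" if "T \<in> dominating K" for T
      using that clopen interior_of_subset[of X K]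
      by (auto simp: le_iff clopen_proj_mem h_clopen_proj dominating_def indicator_def)
  next
    fix u assume u: "u \<in> F" and lb: "\<And>T. T \<in> dominating K \<Longrightarrow> u \<le> T"
    have "e \<in> dominating K"
      using closedin_subset[OF K] by (auto simp: dominating_def unit_mem h_unit)
    from lb[OF this] have le1: "h u x \<le> 1" if "x \<in> topspace X" for x
      using that u unit_mem by (auto simp: le_iff h_unit)
    have off: "h u y \<le> h 0 y" if y: "y \<in> topspace X - K" for y
    proof -
      have "closedin X {y}" using y Hausdorff_X by (simp add: closedin_Hausdorff_singleton)
      from Urysohn_F[OF this K] y
      obtain S where S: "S \<in> F" "\<forall>x\<in>topspace X. 0 \<le> h S x \<and> h S x \<le> 1"
        "h S y = 0" "\<forall>x\<in>K. h S x = 1"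
        by auto
      then have "u \<le> S" by (intro lb) (simp add: dominating_def)
      then show ?thesis using S u y h_zero[of y] le_iff[of u S] by auto
    qed
    have "h u x \<le> 0" if x: "x \<in> X closure_of (topspace X - K)" for x
    proof -
      have "x \<in> topspace X" using x by (simp add: in_closure_of)
      then show ?thesis
        using le_on_closure[OF u subspace_0[OF subspace] Diff_subset off x] h_zero by simp
    qed
    then show "u \<le> clopen_proj (X interior_of K)"
      using u clopen le1
      by (auto simp: le_iff clopen_proj_mem h_clopen_proj indicator_def int)
  qed
qed

section \<open>Projections belonging to clopen sets\<close>

lemma clopen_proj_le_iff:
  assumes "clopenin X A" "clopenin X B"
  shows "clopen_proj A \<le> clopen_proj B \<longleftrightarrow> A \<subseteq> B"
  using assms clopenin_subset[OF assms(1)]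
  by (auto simp: le_iff clopen_proj_mem h_clopen_proj indicator_def subset_iff split: if_splits)

lemma clopen_proj_nonneg: "clopenin X A \<Longrightarrow> 0 \<le> clopen_proj A"
  by (simp add: le_iff clopen_proj_mem h_clopen_proj h_zero subspace_0[OF subspace])

lemma clopen_proj_Un:
  assumes "clopenin X A" "clopenin X B" "A \<inter> B = {}"
  shows "clopen_proj (A \<union> B) = clopen_proj A + clopen_proj B"
  using assms clopenin_Un[OF assms(1,2)]
  by (intro h_eqI subspace_add subspace)
     (auto simp: clopen_proj_mem h_clopen_proj h_add indicator_def)

lemma J_zero [simp]: "J (\<lambda>x. 0) = 0"
  by (rule h_eqI) (simp_all add: J_mem h_J h_zero subspace_0[OF subspace])

lemma clopen_proj_empty [simp]: "clopen_proj {} = 0"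
  by (rule h_eqI) (simp_all add: clopen_proj_mem h_clopen_proj h_zero subspace_0[OF subspace])

lemma clopen_proj_topspace [simp]: "clopen_proj (topspace X) = e"
  by (rule h_eqI) (simp_all add: clopen_proj_mem h_clopen_proj h_unit unit_mem)

text \<open>An upper bound is at least 1 on the union, hence on its closure by continuity. Both the
  order continuity of charges and the countable additivity of the measure rest on this
  correspondence of suprema with closures.\<close>

lemma isLub_clopen_proj:
  assumes D: "\<D> \<noteq> {}" "\<And>A. A \<in> \<D> \<Longrightarrow> clopenin X A"
  shows "isLub F (clopen_proj ` \<D>) (clopen_proj (X closure_of \<Union>\<D>))"
proof -
  have op: "openin X (\<Union>\<D>)" using D(2) by (auto simp: clopenin_def)
  have cl: "clopenin X (X closure_of \<Union>\<D>)" using op by (rule clopenin_closure_of)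
  have sub: "\<Union>\<D> \<subseteq> X closure_of \<Union>\<D>" using openin_subset[OF op] by (rule closure_of_subset)
  show ?thesis
  proof (rule isLubI)
    show "clopen_proj (X closure_of \<Union>\<D>) \<in> F" using cl by (rule clopen_proj_mem)
    show "a \<le> clopen_proj (X closure_of \<Union>\<D>)" if "a \<in> clopen_proj ` \<D>" for a
    proof -
      from that obtain A where A: "A \<in> \<D>" "a = clopen_proj A" by blast
      then show ?thesis using sub D(2) cl clopen_proj_le_iff by blast
    qed
  next
    fix u assume u: "u \<in> F" and ub: "\<And>a. a \<in> clopen_proj ` \<D> \<Longrightarrow> a \<le> u"
    have ind: "indicator A x \<le> h u x" if "A \<in> \<D>" "x \<in> topspace X" for A x
    proof -
      have "clopen_proj A \<le> u" using ub that(1) by blast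
      then show ?thesis
        using u that D(2)[OF that(1)] le_iff[OF clopen_proj_mem[OF D(2)[OF that(1)]] u] by (simp add: h_clopen_proj)
    qed
    obtain A0 where "A0 \<in> \<D>" using D(1) by blast
    then have nonneg: "0 \<le> h u x" if "x \<in> topspace X" for x
      using ind[OF _ that] by (meson indicator_pos_le order_trans)
    have on: "h e x \<le> h u x" if "x \<in> \<Union>\<D>" for x
    proof -
      from that obtain A where A: "A \<in> \<D>" "x \<in> A" by blast
      then have "x \<in> topspace X" using D(2) clopenin_subset by blast
      then show ?thesis using ind[OF A(1)] A(2) by (force simp: h_unit)
    qed
    have "1 \<le> h u x" if x: "x \<in> X closure_of \<Union>\<D>" for x
    proof -
      have "x \<in> topspace X" using x by (simp add: in_closure_of)
      then show ?thesis
        using le_on_closure[OF unit_mem u openin_subset[OF op] on x] h_unit by simp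
    qed
    then show "clopen_proj (X closure_of \<Union>\<D>) \<le> u"
      using u cl nonneg by (auto simp: le_iff clopen_proj_mem h_clopen_proj indicator_def)
  qed
qed

text \<open>Additivity reduces the claim to the remainders, the projections of
  \<open>X closure_of \<Union>\<D> - A\<close>. They decrease to 0 in \<open>F\<close>, so the
  functional tends to 0 along them.\<close>

lemma order_continuous_dual_charge:
  assumes \<phi>: "\<phi> \<in> order_continuous_dual F"
  shows "order_continuous_charge X (\<lambda>C. \<phi> (clopen_proj C))"
proof -
  have add: "\<phi> (S + T) = \<phi> S + \<phi> T" if "S \<in> F" "T \<in> F" for S T
    using \<phi> that by (simp add: order_continuous_dual_def)
  have Un: "\<phi> (clopen_proj (A \<union> B)) = \<phi> (clopen_proj A) + \<phi> (clopen_proj B)"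
    if "clopenin X A" "clopenin X B" "A \<inter> B = {}" for A B
    using that by (simp add: clopen_proj_Un add clopen_proj_mem)
  have "\<exists>A\<in>\<D>. \<forall>B\<in>\<D>. A \<subseteq> B \<longrightarrow> \<bar>\<phi> (clopen_proj (X closure_of \<Union>\<D>)) - \<phi> (clopen_proj B)\<bar> < \<epsilon>"
    if ne: "\<D> \<noteq> {}" and clopen: "\<forall>A\<in>\<D>. clopenin X A"
      and dir: "\<forall>A\<in>\<D>. \<forall>B\<in>\<D>. \<exists>C\<in>\<D>. A \<union> B \<subseteq> C" and \<epsilon>: "0 < \<epsilon>" for \<D> \<epsilon>
  proof -
    let ?U = "X closure_of \<Union>\<D>"
    have op: "openin X (\<Union>\<D>)" using clopen by (auto simp: clopenin_def)
    have U: "clopenin X ?U" using op by (rule clopenin_closure_of)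
    have sub: "\<Union>\<D> \<subseteq> ?U" using openin_subset[OF op] by (rule closure_of_subset)
    define r where "r A = clopen_proj (?U - A)" for A
    have r: "clopenin X (?U - A)" "r A \<in> F" "0 \<le> r A" "clopen_proj ?U = clopen_proj A + r A" if "A \<in> \<D>" for A
    proof -
      show cl: "clopenin X (?U - A)" using U clopen that by (intro clopenin_diff) auto
      show "r A \<in> F" "0 \<le> r A" unfolding r_def using cl by (auto intro: clopen_proj_mem clopen_proj_nonneg)
      have "?U = A \<union> (?U - A)" using sub that by blast
      then show "clopen_proj ?U = clopen_proj A + r A"
        unfolding r_def using clopen_proj_Un[of A "?U - A"] cl clopen that by auto
    qed
    have r_mono: "r B \<le> r A" if "A \<in> \<D>" "B \<in> \<D>" "A \<subseteq> B" for A B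
      unfolding r_def using r(1) that by (subst clopen_proj_le_iff) auto
    have down: "decreases_to_zero F (r ` \<D>)"
      unfolding decreases_to_zero_def
    proof (intro conjI)
      show "r ` \<D> \<noteq> {}" "r ` \<D> \<subseteq> F" using ne r by auto
      show "\<forall>x\<in>r ` \<D>. \<forall>y\<in>r ` \<D>. \<exists>z\<in>r ` \<D>. z \<le> x \<and> z \<le> y"
      proof (intro ballI)
        fix x y assume "x \<in> r ` \<D>" "y \<in> r ` \<D>"
        then obtain A B where AB: "A \<in> \<D>" "B \<in> \<D>" "x = r A" "y = r B" by blast
        then obtain C where C: "C \<in> \<D>" "A \<union> B \<subseteq> C" using dir by blast
        then have "r C \<le> x" "r C \<le> y" using AB r_mono by auto
        with C(1) show "\<exists>z\<in>r ` \<D>. z \<le> x \<and> z \<le> y" by blast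
      qed
      show "isGlb F (r ` \<D>) 0"
      proof (rule isGlbI)
        show "0 \<in> F" by (rule subspace_0[OF subspace])
        show "0 \<le> a" if "a \<in> r ` \<D>" for a using that r by blast
        fix u assume u: "u \<in> F" "\<And>a. a \<in> r ` \<D> \<Longrightarrow> u \<le> a"
        \<comment> \<open>If \<open>u\<close> lies below every remainder, then
          \<open>clopen_proj ?U - u\<close> still dominates every \<open>clopen_proj A\<close>,
          hence their supremum.\<close>
        have "clopen_proj ?U \<le> clopen_proj ?U - u"
        proof (rule isLub_least[OF isLub_clopen_proj[OF ne]])
          show "clopenin X A" if "A \<in> \<D>" for A using clopen that by blast
          show "clopen_proj ?U - u \<in> F" using u(1) U by (intro subspace_diff subspace clopen_proj_mem)
          fix a assume "a \<in> clopen_proj ` \<D>"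
          then obtain A where A: "A \<in> \<D>" "a = clopen_proj A" by blast
          have "u \<le> r A" using u(2) A(1) by blast
          then show "a \<le> clopen_proj ?U - u" using r(4)[OF A(1)] A(2) by (simp add: algebra_simps)
        qed
        then show "u \<le> 0" by simp
      qed
    qed
    \<comment> \<open>The tail filter of the net \<open>r\<close>, indexed by \<open>\<D>\<close>
      under inclusion.\<close>
    define \<F> where "\<F> = (INF A\<in>\<D>. principal (r ` {B \<in> \<D>. A \<subseteq> B}))"
    have ev: "eventually P \<F> \<longleftrightarrow> (\<exists>A\<in>\<D>. \<forall>B\<in>\<D>. A \<subseteq> B \<longrightarrow> P (r B))" for P
      unfolding \<F>_def
    proof (subst eventually_INF_base)
      fix A B assume "A \<in> \<D>" "B \<in> \<D>"
      then obtain C where "C \<in> \<D>" "A \<union> B \<subseteq> C" using dir by blast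
      then show "\<exists>C\<in>\<D>. principal (r ` {B \<in> \<D>. C \<subseteq> B}) \<le>
          inf (principal (r ` {B \<in> \<D>. A \<subseteq> B})) (principal (r ` {D \<in> \<D>. B \<subseteq> D}))"
        by (intro bexI[of _ C]) auto
    qed (use ne in \<open>auto simp: eventually_principal\<close>)
    have "order_null F \<F>"
      unfolding order_null_def
    proof (intro conjI exI[of _ "r ` \<D>"] ballI)
      show "\<forall>\<^sub>F x in \<F>. x \<in> F" unfolding ev using ne r(2) by blast
      show "decreases_to_zero F (r ` \<D>)" by (rule down)
      fix d assume "d \<in> r ` \<D>"
      then obtain A where A: "A \<in> \<D>" "d = r A" by blast
      have "\<bar>r B\<bar> \<le> d" if "B \<in> \<D>" "A \<subseteq> B" for B
        using r_mono[OF A(1) that] r(3)[OF that(1)] A(2) by simp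
      with A(1) show "\<forall>\<^sub>F x in \<F>. \<bar>x\<bar> \<le> d" unfolding ev by blast
    qed
    then have "(\<phi> \<longlongrightarrow> 0) \<F>" using \<phi> by (simp add: order_continuous_dual_def)
    from tendstoD[OF this \<epsilon>] obtain A where A: "A \<in> \<D>" "\<And>B. B \<in> \<D> \<Longrightarrow> A \<subseteq> B \<Longrightarrow> \<bar>\<phi> (r B)\<bar> < \<epsilon>"
      unfolding ev by (auto simp: dist_real_def)
    have "\<phi> (clopen_proj ?U) - \<phi> (clopen_proj B) = \<phi> (r B)" if "B \<in> \<D>" for B
      using r[OF that] clopen that by (simp add: add clopen_proj_mem)
    with A show ?thesis by (intro bexI[of _ A]) auto
  qed
  with Un show ?thesis unfolding order_continuous_charge_def by blast
qed

end

section \<open>The measure, its additivity and its regularity\<close>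

locale normal_function_representation = function_representation +
  assumes normal: "normal_lattice F"
begin

text \<open>Normality enters here: a functional that separates the projection of \<open>Z\<close>
  from 0 yields a charge that is nonzero at \<open>Z\<close>.\<close>

sublocale hyperstonean_space X
proof
  fix Z assume Z: "clopenin X Z" "Z \<noteq> {}"
  have "clopen_proj Z \<noteq> clopen_proj {}"
    using clopen_proj_le_iff[OF Z(1), of "{}"] Z(2) by auto
  then obtain \<phi> where \<phi>: "\<phi> \<in> order_continuous_dual F" "\<phi> (clopen_proj Z) \<noteq> \<phi> (clopen_proj {})"
    using normal Z(1) unfolding normal_lattice_def by (metis clopen_proj_mem clopenin_empty)
  have occ: "order_continuous_charge X (\<lambda>C. \<phi> (clopen_proj C))"
    using \<phi>(1) by (rule order_continuous_dual_charge)
  have "\<phi> (clopen_proj {}) = 0" using order_continuous_charge_add[OF occ, of "{}" "{}"] by simp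
  with occ \<phi>(2) show "\<exists>m. order_continuous_charge X m \<and> m Z \<noteq> 0"
    by (intro exI[of _ "\<lambda>C. \<phi> (clopen_proj C)"]) auto
qed

definition \<mu> :: "'a set \<Rightarrow> 'b"
  where "\<mu> \<Delta> = clopen_proj (rep \<Delta>)"

lemma openin_sets_Borel: "openin X V \<Longrightarrow> V \<in> sets (Borel X)"
  by (auto simp: sets_Borel)

lemma closedin_sets_Borel: "closedin X K \<Longrightarrow> K \<in> sets (Borel X)"
proof -
  assume K: "closedin X K"
  then have "space (Borel X) - (topspace X - K) \<in> sets (Borel X)"
    by (intro sets.compl_sets openin_sets_Borel) auto
  moreover have "space (Borel X) - (topspace X - K) = K"
    using closedin_subset[OF K] by (auto simp: space_Borel)
  ultimately show ?thesis by simp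
qed

lemma \<mu>_mem: "\<Delta> \<in> sets (Borel X) \<Longrightarrow> \<mu> \<Delta> \<in> F"
  and \<mu>_nonneg: "\<Delta> \<in> sets (Borel X) \<Longrightarrow> 0 \<le> \<mu> \<Delta>"
  and h_\<mu>: "\<Delta> \<in> sets (Borel X) \<Longrightarrow> x \<in> topspace X \<Longrightarrow> h (\<mu> \<Delta>) x = indicator (rep \<Delta>) x"
  unfolding \<mu>_def using clopenin_rep by (auto intro: clopen_proj_mem clopen_proj_nonneg h_clopen_proj)

lemma \<mu>_mono:
  "A \<in> sets (Borel X) \<Longrightarrow> B \<in> sets (Borel X) \<Longrightarrow> A \<subseteq> B \<Longrightarrow> \<mu> A \<le> \<mu> B"
  unfolding \<mu>_def by (simp add: clopen_proj_le_iff clopenin_rep rep_mono)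

lemma \<mu>_topspace: "\<mu> (topspace X) = e"
  by (simp add: \<mu>_def)

lemma \<mu>_Int: "A \<in> sets (Borel X) \<Longrightarrow> B \<in> sets (Borel X) \<Longrightarrow> \<mu> (A \<inter> B) = \<mu> A * \<mu> B"
  by (rule h_eqI)
     (auto simp: \<mu>_mem mult_mem h_mult h_\<mu> rep_Int indicator_inter_arith)

lemma \<mu>_le_unit: "A \<in> sets (Borel X) \<Longrightarrow> \<mu> A \<le> e"
  using \<mu>_mono[of A "topspace X"] sets.sets_into_space[of A "Borel X"] openin_sets_Borel[OF openin_topspace]
  by (simp add: \<mu>_topspace space_Borel)

lemma \<mu>_open_pos:
  assumes "openin X V" "V \<noteq> {}"
  shows "0 < \<mu> V"
proof -
  have "X closure_of V \<noteq> {}" using assms closure_of_subset[OF openin_subset[OF assms(1)]] by blast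
  then have "\<not> clopen_proj (X closure_of V) \<le> clopen_proj {}"
    using clopenin_closure_of[OF assms(1)] by (subst clopen_proj_le_iff) auto
  then show ?thesis
    using clopen_proj_nonneg[OF clopenin_closure_of[OF assms(1)]]
    by (auto simp: \<mu>_def rep_open[OF assms(1)] less_le_not_le)
qed

lemma isLub_\<mu>_open: "openin X V \<Longrightarrow> isLub F (subordinate V) (\<mu> V)"
  by (simp add: \<mu>_def rep_open isLub_subordinate)

lemma isGlb_\<mu>_closed: "closedin X K \<Longrightarrow> isGlb F (dominating K) (\<mu> K)"
  by (simp add: \<mu>_def rep_closed isGlb_dominating)

text \<open>Disjoint Borel sets have disjoint representatives, so the partial sums are the
  projections of the increasing clopen sets \<open>C N\<close>. Their supremum belongs to the
  closure of the union, which by \<open>rep_UN\<close> represents the union of the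
  \<open>D n\<close>.\<close>

lemma lattice_measure_\<mu>: "lattice_measure F (Borel X) \<mu>"
  unfolding lattice_measure_def
proof (intro conjI allI impI ballI)
  fix D :: "nat \<Rightarrow> 'a set" assume D: "range D \<subseteq> sets (Borel X)" "disjoint_family D"
  have Dn: "D n \<in> sets (Borel X)" for n using D(1) by auto
  define C where "C N = (\<Union>n<N. rep (D n))" for N
  have C: "clopenin X (C N)" for N unfolding C_def by (intro clopenin_UN clopenin_rep Dn) auto
  have disj: "rep (D m) \<inter> rep (D n) = {}" if "m \<noteq> n" for m n
    using rep_Int[OF Dn Dn, of m n] D(2) that by (simp add: disjoint_family_on_def)
  have sum: "(\<Sum>n<N. \<mu> (D n)) = clopen_proj (C N)" for N
  proof (induction N)
    case 0
    then show ?case by (simp add: C_def)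
  next
    case (Suc N)
    have "rep (D n) \<inter> rep (D N) = {}" if "n < N" for n using disj[of n N] that by simp
    then have "C N \<inter> rep (D N) = {}" unfolding C_def by blast
    moreover have "C (Suc N) = C N \<union> rep (D N)" by (auto simp: C_def lessThan_Suc)
    ultimately have "clopen_proj (C (Suc N)) = clopen_proj (C N) + clopen_proj (rep (D N))"
      using clopen_proj_Un C clopenin_rep[OF Dn] by metis
    then show ?case using Suc by (simp add: \<mu>_def)
  qed
  have UN: "\<Union>(range C) = (\<Union>n. rep (D n))" by (auto simp: C_def)
  have "isLub F (clopen_proj ` range C) (clopen_proj (X closure_of \<Union>(range C)))"
    using C by (intro isLub_clopen_proj) auto
  moreover have "\<mu> (\<Union>n. D n) = clopen_proj (X closure_of \<Union>(range C))"
    by (simp only: \<mu>_def rep_UN[OF Dn] UN)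
  ultimately show "isLub F (range (\<lambda>N. \<Sum>n<N. \<mu> (D n))) (\<mu> (\<Union>n. D n))"
    unfolding sum by (simp only: image_image)
qed (auto simp: \<mu>_mem \<mu>_nonneg, simp add: \<mu>_def)

lemma compactin_iff_closedin: "compactin X K \<longleftrightarrow> closedin X K"
  using compactin_imp_closedin[OF Hausdorff_X] closedin_compact_space[OF compact_X] by blast

text \<open>For inner regularity, the support of a function subordinate to \<open>V\<close> is a
  compact subset whose measure dominates that function. For outer regularity, the neighbourhoods
  \<open>rep \<Delta> \<union> V\<close> with \<open>V\<close> open around the null set
  \<open>\<Delta> - rep \<Delta>\<close> suffice.\<close>

lemma regular_\<mu>: "regular_Borel_measure F X \<mu>"
  unfolding regular_Borel_measure_def
proof (intro conjI allI impI ballI lattice_measure_\<mu>)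
  fix V assume V: "openin X V"
  show "isLub F {\<mu> K |K. compactin X K \<and> K \<subseteq> V} (\<mu> V)"
  proof (rule isLubI)
    show "\<mu> V \<in> F" using V by (intro \<mu>_mem openin_sets_Borel)
    show "a \<le> \<mu> V" if "a \<in> {\<mu> K |K. compactin X K \<and> K \<subseteq> V}" for a
    proof -
      from that obtain K where "a = \<mu> K" "closedin X K" "K \<subseteq> V"
        by (auto simp: compactin_iff_closedin)
      then show ?thesis
        using \<mu>_mono[OF closedin_sets_Borel openin_sets_Borel[OF V]] by simp
    qed
    fix u assume u: "u \<in> F" "\<And>a. a \<in> {\<mu> K |K. compactin X K \<and> K \<subseteq> V} \<Longrightarrow> a \<le> u"
    show "\<mu> V \<le> u"
    proof (rule isLub_least[OF isLub_\<mu>_open[OF V] u(1)])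
      fix T assume T: "T \<in> subordinate V"
      then have TF: "T \<in> F" by (simp add: subordinate_def)
      have K: "closedin X (support T)" by (simp add: support_def)
      have "{x \<in> topspace X. h T x \<noteq> 0} \<subseteq> support T"
        unfolding support_def by (rule closure_of_subset) auto
      moreover have "openin X {x \<in> topspace X. h T x \<noteq> 0}"
        using openin_continuous_map_preimage[OF h_cont[OF TF], of "- {0}"] by (simp add: open_Compl)
      ultimately have "{x \<in> topspace X. h T x \<noteq> 0} \<subseteq> X interior_of (support T)"
        by (rule interior_of_maximal)
      \<comment> \<open>The representative of the closed support is its interior, which contains the
        open set where \<open>h T\<close> is nonzero.\<close>
      then have "T \<le> \<mu> (support T)"
        using T TF K \<mu>_mem[OF closedin_sets_Borel[OF K]] h_\<mu>[OF closedin_sets_Borel[OF K]]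
        by (auto simp: le_iff rep_closed subordinate_def indicator_def)
      also have "\<mu> (support T) \<le> u"
        using T K by (intro u(2)) (auto simp: subordinate_def compactin_iff_closedin)
      finally show "T \<le> u" .
    qed
  qed
next
  fix \<Delta> assume \<Delta>: "\<Delta> \<in> sets (Borel X)"
  show "isGlb F {\<mu> V |V. openin X V \<and> \<Delta> \<subseteq> V} (\<mu> \<Delta>)"
  proof (rule isGlbI)
    show "\<mu> \<Delta> \<in> F" using \<Delta> by (rule \<mu>_mem)
    show "\<mu> \<Delta> \<le> a" if "a \<in> {\<mu> V |V. openin X V \<and> \<Delta> \<subseteq> V}" for a
      using that \<Delta> by (auto intro!: \<mu>_mono openin_sets_Borel)
    fix u assume u: "u \<in> F" "\<And>a. a \<in> {\<mu> V |V. openin X V \<and> \<Delta> \<subseteq> V} \<Longrightarrow> u \<le> a"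
    let ?C = "rep \<Delta>"
    have C: "clopenin X ?C" using \<Delta> by (rule clopenin_rep)
    have N: "null_set_in X (\<Delta> - ?C)" using null_rep[OF \<Delta>] by (rule null_set_in_mono) auto
    \<comment> \<open>The open set where the lower bound \<open>u\<close> would exceed
      \<open>\<mu> \<Delta>\<close>; it has to be empty.\<close>
    define W where "W = {x \<in> topspace X. h (\<mu> \<Delta>) x < h u x}"
    have W: "openin X W" unfolding W_def using u(1) \<mu>_mem[OF \<Delta>] by (intro openin_less)
    have closure: "X closure_of W \<subseteq> ?C \<union> X closure_of V" if V: "openin X V" "\<Delta> - ?C \<subseteq> V" for V
    proof -
      have o: "openin X (?C \<union> V)" using C V by (auto simp: clopenin_def)
      have "\<Delta> \<subseteq> ?C \<union> V" using V(2) by blast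
      then have "u \<le> \<mu> (?C \<union> V)" using o by (intro u(2)) blast
      then have "h u x \<le> indicator (X closure_of (?C \<union> V)) x" if "x \<in> topspace X" for x
        using that u(1) o \<mu>_mem[OF openin_sets_Borel[OF o]] h_\<mu>[OF openin_sets_Borel[OF o]]
        by (auto simp: le_iff rep_open)
      moreover have "X closure_of (?C \<union> V) = ?C \<union> X closure_of V"
        using C by (simp add: closure_of_Un closure_of_closedin clopenin_def)
      ultimately have "W \<subseteq> ?C \<union> X closure_of V"
        unfolding W_def using h_\<mu>[OF \<Delta>] by (fastforce simp: indicator_def split: if_splits)
      moreover have "closedin X (?C \<union> X closure_of V)"
        using C by (intro closedin_Un) (auto simp: clopenin_def)
      ultimately show ?thesis by (rule closure_of_minimal)
    qed
    have "W \<inter> ?C = {}"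
    proof -
      have "u \<le> e"
      proof (rule order_trans[OF u(2)])
        show "\<mu> (topspace X) \<in> {\<mu> V |V. openin X V \<and> \<Delta> \<subseteq> V}"
          using sets.sets_into_space[OF \<Delta>] by (auto simp: space_Borel)
      qed (simp add: \<mu>_topspace)
      then show ?thesis
        unfolding W_def using h_\<mu>[OF \<Delta>] u(1) unit_mem
        by (auto simp: le_iff h_unit indicator_def)
    qed
    \<comment> \<open>This clopen set lies in the closure of every open neighbourhood of
      \<open>\<Delta> - ?C\<close>, so nullness of that difference empties it.\<close>
    have "X closure_of W - ?C = {}"
      using N C W closure unfolding null_set_in_def
      by (metis (no_types, lifting) Diff_subset_conv clopenin_closure_of clopenin_diff)
    then have "W = {}" using \<open>W \<inter> ?C = {}\<close> closure_of_subset[OF openin_subset[OF W]] by blast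
    then show "u \<le> \<mu> \<Delta>" using u(1) \<mu>_mem[OF \<Delta>] by (auto simp: W_def le_iff not_less)
  qed
qed

section \<open>Integrals of continuous functions against the measure\<close>

sublocale mu: sublattice_measure F "Borel X" \<mu>
  by unfold_locales (rule subspace Sup_mem lattice_measure_\<mu>; assumption)+

lemma continuous_map_borel_measurable:
  assumes "continuous_map X euclideanreal f"
  shows "f \<in> borel_measurable (Borel X)"
proof (rule borel_measurableI)
  fix S :: "real set" assume "open S"
  then have "openin X {x \<in> topspace X. f x \<in> S}"
    using assms by (intro openin_continuous_map_preimage[of X euclideanreal]) auto
  moreover have "f -` S \<inter> space (Borel X) = {x \<in> topspace X. f x \<in> S}"
    by (auto simp: space_Borel)
  ultimately show "f -` S \<inter> space (Borel X) \<in> sets (Borel X)"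
    by (simp add: openin_sets_Borel)
qed

lemma continuous_map_bounded:
  assumes "continuous_map X euclideanreal f"
  shows "\<exists>c. \<forall>x\<in>topspace X. f x \<le> c"
proof -
  have "compactin euclideanreal (f ` topspace X)"
    using compact_X assms unfolding compact_space_def by (rule image_compactin)
  then have "bounded (f ` topspace X)" by (simp add: compact_imp_bounded)
  then obtain c where "\<forall>y\<in>f ` topspace X. \<bar>y\<bar> \<le> c" by (auto simp: bounded_real)
  then show ?thesis by (intro exI[of _ c]) auto
qed

lemma h_diff: "S \<in> F \<Longrightarrow> T \<in> F \<Longrightarrow> x \<in> topspace X \<Longrightarrow> h (S - T) x = h S x - h T x"
  using h_add[of S "(- 1) *\<^sub>R T" x] h_scale[of T x "- 1"] subspace_neg[OF subspace, of T] by simp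

text \<open>Off the finitely many null differences between level sets and their representatives, a
  point lies in exactly one representative, that of its own level set.\<close>

lemma h_simple_order_integral:
  assumes s: "simple_function (Borel X) s"
  obtains N where "null_set_in X N"
    "\<And>x. x \<in> topspace X \<Longrightarrow> x \<notin> N \<Longrightarrow> h (simple_order_integral (Borel X) \<mu> s) x = s x"
proof -
  let ?A = "\<lambda>r. s -` {r} \<inter> topspace X"
  have fin: "finite (s ` topspace X)" and A: "\<And>r. r \<in> s ` topspace X \<Longrightarrow> ?A r \<in> sets (Borel X)"
    using s by (auto simp: simple_function_def space_Borel)
  define N where "N = (\<Union>r\<in>s ` topspace X. sym_diff (?A r) (rep (?A r)))"
  have "null_set_in X N"
    unfolding N_def using fin by (rule null_set_in_finite_UN) (rule null_rep[OF A])
  moreover have "h (simple_order_integral (Borel X) \<mu> s) x = s x" if x: "x \<in> topspace X" "x \<notin> N" for x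
  proof -
    have "h (simple_order_integral (Borel X) \<mu> s) x = (\<Sum>r\<in>s ` topspace X. h (r *\<^sub>R \<mu> (?A r)) x)"
      unfolding simple_order_integral_def space_Borel
      using fin x(1) A by (intro h_sum subspace_scale[OF subspace] \<mu>_mem)
    also have "\<dots> = (\<Sum>r\<in>s ` topspace X. if r = s x then r else 0)"
    proof (rule sum.cong[OF refl])
      fix r assume r: "r \<in> s ` topspace X"
      have "x \<in> rep (?A r) \<longleftrightarrow> x \<in> ?A r" using x(2) r unfolding N_def by blast
      then show "h (r *\<^sub>R \<mu> (?A r)) x = (if r = s x then r else 0)"
        using x(1) by (auto simp: h_scale[OF \<mu>_mem[OF A[OF r]]] h_\<mu>[OF A[OF r]] indicator_def)
    qed
    also have "\<dots> = s x" using fin x(1) by (simp add: sum.delta')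
    finally show ?thesis .
  qed
  ultimately show ?thesis by (rule that)
qed

text \<open>The continuous representatives of the integrals of simple functions agree with those
  functions off a null set, and a nonempty open set is never null.\<close>

lemma order_integral_nonneg_\<mu>:
  assumes f: "continuous_map X euclideanreal f" "\<And>x. 0 \<le> f x"
  shows "order_integral_nonneg F (Borel X) \<mu> f = J f"
proof -
  let ?I = "simple_order_integral (Borel X) \<mu>"
  have meas: "f \<in> borel_measurable (Borel X)" using f(1) by (rule continuous_map_borel_measurable)
  obtain c where c: "\<forall>x\<in>topspace X. f x \<le> c"
    using continuous_map_bounded[OF f(1)] by blast
  obtain s where s: "simple_approximation (Borel X) s f"
    using mu.simple_approximation_ex[OF meas f(2)] by blast
  have sf: "simple_function (Borel X) (s n)" for n using s by (simp add: simple_approximation_def)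
  have inc: "incseq (\<lambda>n. s n x)" and lim: "(\<lambda>n. s n x) \<longlonglongrightarrow> f x" if "x \<in> topspace X" for x
    using s that by (simp_all add: simple_approximation_def space_Borel)
  have "\<exists>N. null_set_in X N \<and> (\<forall>x\<in>topspace X. x \<notin> N \<longrightarrow> h (?I (s n)) x = s n x)" for n
    using h_simple_order_integral[OF sf[of n]] by metis
  then obtain N where N: "\<And>n. null_set_in X (N n)"
    "\<And>n x. x \<in> topspace X \<Longrightarrow> x \<notin> N n \<Longrightarrow> h (?I (s n)) x = s n x"
    by metis
  have null: "null_set_in X (\<Union>n. N n)" using N(1) by (rule null_set_in_UN)
  have le: "S \<le> T" if "S \<in> F" "T \<in> F" and *: "\<And>x. x \<in> topspace X \<Longrightarrow> x \<notin> (\<Union>n. N n) \<Longrightarrow> h S x \<le> h T x" for S T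
  proof -
    have "null_set_in X {x \<in> topspace X. h T x < h S x}"
      by (rule null_set_in_mono[OF null]) (use * in force)
    then have "{x \<in> topspace X. h T x < h S x} = {}"
      using openin_less[OF that(2,1)] by (intro openin_null_empty)
    then show ?thesis using that(1,2) by (auto simp: le_iff not_less)
  qed
  have Jf: "J f \<in> F" "\<And>x. x \<in> topspace X \<Longrightarrow> h (J f) x = f x"
    using f(1) by (auto intro: J_mem h_J)
  have I_mem: "?I (s n) \<in> F" for n using sf by (rule mu.simple_order_integral_mem)
  have "isLub F (range (\<lambda>n. ?I (s n))) (J f)"
  proof (rule isLubI)
    show "J f \<in> F" by (rule Jf)
    fix a assume "a \<in> range (\<lambda>n. ?I (s n))"
    then obtain n where a: "a = ?I (s n)" by blast
    show "a \<le> J f"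
      unfolding a
    proof (rule le[OF I_mem Jf(1)])
      fix x assume x: "x \<in> topspace X" "x \<notin> (\<Union>n. N n)"
      then show "h (?I (s n)) x \<le> h (J f) x"
        using incseq_le[OF inc[OF x(1)] lim[OF x(1)], of n] N(2)[of x n] Jf(2) by simp
    qed
  next
    fix u assume u: "u \<in> F" "\<And>a. a \<in> range (\<lambda>n. ?I (s n)) \<Longrightarrow> a \<le> u"
    show "J f \<le> u"
    proof (rule le[OF Jf(1) u(1)])
      fix x assume x: "x \<in> topspace X" "x \<notin> (\<Union>n. N n)"
      have "s n x \<le> h u x" for n
      proof -
        have "?I (s n) \<le> u" using u(2) by blast
        then have "h (?I (s n)) x \<le> h u x" using le_iff[OF I_mem u(1)] x(1) by blast
        then show ?thesis using N(2)[of x n] x by simp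
      qed
      then have "f x \<le> h u x" using lim[OF x(1)] by (intro LIMSEQ_le_const2) auto
      then show "h (J f) x \<le> h u x" using Jf(2) x(1) by simp
    qed
  qed
  moreover have "isLub F (range (\<lambda>n. ?I (s n))) (order_integral_nonneg F (Borel X) \<mu> f)"
    using meas f(2) c s by (intro mu.isLub_order_integral_nonneg) (auto simp: space_Borel)
  ultimately show ?thesis using isLub_eq by blast
qed

lemma order_integral_real_\<mu>:
  assumes f: "continuous_map X euclideanreal f"
  shows "order_integral_real F (Borel X) \<mu> f = J f"
proof -
  have pos: "continuous_map X euclideanreal (\<lambda>x. max (f x) 0)"
    and neg: "continuous_map X euclideanreal (\<lambda>x. max (- f x) 0)"
    using f by (auto intro!: continuous_map_real_max continuous_map_minus)
  have "J (\<lambda>x. max (f x) 0) - J (\<lambda>x. max (- f x) 0) = J f"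
    by (rule h_eqI)
       (use f pos neg in \<open>auto simp: J_mem h_diff h_J max_def intro!: subspace_diff[OF subspace]\<close>)
  then show ?thesis
    by (simp add: order_integral_real_def order_integral_nonneg_\<mu> pos neg)
qed

section \<open>Uniqueness of the representing measure\<close>

text \<open>For closed \<open>K\<close>, monotone convergence gives \<open>\<nu> K \<le> T\<close>
  for every \<open>T\<close> dominating \<open>K\<close>, so \<open>\<nu> K \<le> \<mu> K\<close>;
  inner regularity of \<open>\<nu>\<close> carries this over to open sets. Conversely, every
  \<open>T\<close> subordinate to an open \<open>V\<close> is at most \<open>\<nu> V\<close>, which
  gives \<open>\<mu> V \<le> \<nu> V\<close>.\<close>

lemma \<mu>_unique:
  assumes \<nu>: "regular_Borel_measure F X \<nu>"
    and int: "\<And>T. T \<in> F \<Longrightarrow> order_integral_real F (Borel X) \<nu> (h T) = T"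
    and \<Delta>: "\<Delta> \<in> sets (Borel X)"
  shows "\<nu> \<Delta> = \<mu> \<Delta>"
proof -
  let ?I = "simple_order_integral (Borel X) \<nu>"
  interpret nu: sublattice_measure F "Borel X" \<nu>
    by unfold_locales (use \<nu> Sup_mem subspace in \<open>auto simp: regular_Borel_measure_def\<close>)
  have rep: "\<exists>s. simple_approximation (Borel X) s (\<lambda>x. max (h T x) 0) \<and> isLub F (range (\<lambda>n. ?I (s n))) T"
    if T: "T \<in> F" "\<And>x. x \<in> topspace X \<Longrightarrow> 0 \<le> h T x" for T
  proof -
    have cont: "continuous_map X euclideanreal (\<lambda>x. max (h T x) 0)"
      using h_cont[OF T(1)] by (intro continuous_map_real_max) auto
    obtain c where c: "\<forall>x\<in>topspace X. max (h T x) 0 \<le> c"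
      using continuous_map_bounded[OF cont] by blast
    have meas: "(\<lambda>x. max (h T x) 0) \<in> borel_measurable (Borel X)"
      using cont by (rule continuous_map_borel_measurable)
    obtain s where s: "simple_approximation (Borel X) s (\<lambda>x. max (h T x) 0)"
      using nu.simple_approximation_ex[OF meas] by auto
    \<comment> \<open>\<open>h T\<close> is known to be nonnegative on \<open>topspace X\<close>
      only, so its positive part stays as the integrand. The negative part contributes 0, and the
      positive part then integrates to \<open>T\<close>.\<close>
    have "order_integral_nonneg F (Borel X) \<nu> (\<lambda>x. max (- h T x) 0) = 0"
      using T(2) by (intro nu.order_integral_nonneg_zero) (auto simp: space_Borel)
    then have "order_integral_nonneg F (Borel X) \<nu> (\<lambda>x. max (h T x) 0) = T"
      using int[OF T(1)] by (simp add: order_integral_real_def)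
    moreover have "isLub F (range (\<lambda>n. ?I (s n))) (order_integral_nonneg F (Borel X) \<nu> (\<lambda>x. max (h T x) 0))"
      using meas c s by (intro nu.isLub_order_integral_nonneg) (auto simp: space_Borel)
    ultimately show ?thesis using s by auto
  qed
  have closed: "\<nu> K \<le> \<mu> K" if K: "closedin X K" for K
  proof (rule isGlb_greatest[OF isGlb_\<mu>_closed[OF K]])
    show "\<nu> K \<in> F" using K by (intro nu.measure_mem closedin_sets_Borel)
    fix T assume "T \<in> dominating K"
    then have T: "T \<in> F" "\<And>x. x \<in> topspace X \<Longrightarrow> 0 \<le> h T x" "\<And>x. x \<in> K \<Longrightarrow> h T x = 1"
      by (auto simp: dominating_def)
    obtain s where s: "simple_approximation (Borel X) s (\<lambda>x. max (h T x) 0)"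
      and lub: "isLub F (range (\<lambda>n. ?I (s n))) T" using rep[OF T(1,2)] by blast
    have "?I (indicator K) \<le> T"
    proof (rule nu.simple_order_integral_monotone_convergence[where f = "\<lambda>x. max (h T x) 0" and s = s])
      show "simple_function (Borel X) (indicator K)"
        using closedin_sets_Borel[OF K] by (rule simple_function_indicator)
      show "indicator K x \<le> max (h T x) 0" for x
        using T(3)[of x] by (auto simp: indicator_def)
      show "?I (s n) \<le> T" for n using isLubD2[OF lub] by blast
    qed (use s T(1) in \<open>auto simp: simple_approximation_def\<close>)
    then show "\<nu> K \<le> T"
      by (simp add: nu.simple_order_integral_indicator closedin_sets_Borel[OF K])
  qed
  have "\<nu> V = \<mu> V" if V: "openin X V" for V
  proof (rule order.antisym)
    have inner: "isLub F {\<nu> K |K. compactin X K \<and> K \<subseteq> V} (\<nu> V)"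
      using \<nu> V by (simp add: regular_Borel_measure_def)
    show "\<nu> V \<le> \<mu> V"
    proof (rule isLub_least[OF inner])
      show "\<mu> V \<in> F" using V by (intro \<mu>_mem openin_sets_Borel)
      fix a assume "a \<in> {\<nu> K |K. compactin X K \<and> K \<subseteq> V}"
      then obtain K where K: "a = \<nu> K" "closedin X K" "K \<subseteq> V"
        by (auto simp: compactin_iff_closedin)
      show "a \<le> \<mu> V"
        unfolding K(1) using closed[OF K(2)] \<mu>_mono[OF closedin_sets_Borel[OF K(2)] openin_sets_Borel[OF V] K(3)]
        by (rule order_trans)
    qed
    show "\<mu> V \<le> \<nu> V"
    proof (rule isLub_least[OF isLub_\<mu>_open[OF V]])
      show "\<nu> V \<in> F" using V by (intro nu.measure_mem openin_sets_Borel)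
      fix T assume T: "T \<in> subordinate V"
      have TF: "T \<in> F" "\<And>x. x \<in> topspace X \<Longrightarrow> 0 \<le> h T x \<and> h T x \<le> 1" "support T \<subseteq> V"
        using T by (auto simp: subordinate_def)
      obtain s where s: "simple_approximation (Borel X) s (\<lambda>x. max (h T x) 0)"
        and lub: "isLub F (range (\<lambda>n. ?I (s n))) T" using rep[of T] TF by blast
      have "?I (s n) \<le> ?I (indicator V)" for n
      proof (rule nu.simple_order_integral_mono)
        show "simple_function (Borel X) (s n)" using s by (simp add: simple_approximation_def)
        show "simple_function (Borel X) (indicator V)"
          using openin_sets_Borel[OF V] by (rule simple_function_indicator)
        fix x assume "x \<in> space (Borel X)"
        then have x: "x \<in> topspace X" by (simp add: space_Borel)
        have "s n x \<le> max (h T x) 0"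
          using s x by (intro incseq_le[where X = "\<lambda>n. s n x"]) (auto simp: simple_approximation_def space_Borel)
        moreover have "h T x = 0" if "x \<notin> V"
          using that TF(3) x closure_of_subset[of "{x \<in> topspace X. h T x \<noteq> 0}" X] by (auto simp: support_def)
        ultimately show "s n x \<le> indicator V x"
          using TF(2)[OF x] by (cases "x \<in> V") auto
      qed
      then have "?I (s n) \<le> \<nu> V" for n
        by (simp add: nu.simple_order_integral_indicator openin_sets_Borel[OF V])
      then show "T \<le> \<nu> V"
        using V by (intro isLub_least[OF lub] nu.measure_mem openin_sets_Borel) auto
    qed
  qed
  then have eq: "{\<nu> V |V. openin X V \<and> \<Delta> \<subseteq> V} = {\<mu> V |V. openin X V \<and> \<Delta> \<subseteq> V}"
    by force
  have "isGlb F {\<nu> V |V. openin X V \<and> \<Delta> \<subseteq> V} (\<nu> \<Delta>)" "isGlb F {\<mu> V |V. openin X V \<and> \<Delta> \<subseteq> V} (\<mu> \<Delta>)"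
    using \<nu> regular_\<mu> \<Delta> by (auto simp: regular_Borel_measure_def)
  then show ?thesis unfolding eq by (rule isGlb_eq)
qed

end

section \<open>Application to the centre\<close>

lemma star_isomorphism_representation:
  fixes X :: "'x topology"
    and hat :: "'a::dedekind_complete_vector_lattice regop complexification \<Rightarrow> 'x \<Rightarrow> complex"
  assumes "compact_space X" and "Hausdorff_space X" and star: "star_isomorphism X hat"
  shows "function_representation X centre id_regop (\<lambda>T x. Re (hat (Cplx T 0) x))"
proof
  fix S T :: "'a regop" and c x
  show "continuous_map X euclideanreal (\<lambda>x. Re (hat (Cplx T 0) x))" if T: "T \<in> centre"
    using continuous_map_compose[OF star_continuous[OF star Cplx_complex_centre[OF T]], of euclideanreal Re]
    by (simp add: o_def continuous_intros)
  show add: "Re (hat (Cplx (S + T) 0) x) = Re (hat (Cplx S 0) x) + Re (hat (Cplx T 0) x)"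
    if "S \<in> centre" "T \<in> centre" "x \<in> topspace X" for S T x
    using star_add[OF star Cplx_complex_centre[OF that(1)] Cplx_complex_centre[OF that(2)] that(3)] by (simp add: Cplx_add)
  show scale: "Re (hat (Cplx (c *\<^sub>R T) 0) x) = c * Re (hat (Cplx T 0) x)" if "T \<in> centre" "x \<in> topspace X" for c T x
    using star_cscale[OF star Cplx_complex_centre[OF that(1)] that(2), of "of_real c"] by (simp add: cscale_of_real_Cplx)
  show "Re (hat (Cplx (S * T) 0) x) = Re (hat (Cplx S 0) x) * Re (hat (Cplx T 0) x)"
    if ST: "S \<in> centre" "T \<in> centre" and x: "x \<in> topspace X"
    using star_mult[OF star Cplx_complex_centre[OF ST(1)] Cplx_complex_centre[OF ST(2)] x]
      arg_cong[OF star_real[OF star ST(1) x], of Im]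
    by (simp add: Cplx_mult)
  show "S \<le> T \<longleftrightarrow> (\<forall>x\<in>topspace X. Re (hat (Cplx S 0) x) \<le> Re (hat (Cplx T 0) x))"
    if ST: "S \<in> centre" "T \<in> centre"
  proof -
    \<comment> \<open>Written as a sum with a scalar multiple, the difference of \<open>T\<close>
      and \<open>S\<close> can be evaluated by \<open>add\<close> and \<open>scale\<close> once the
      positivity criterion is applied.\<close>
    have neg: "(- 1) *\<^sub>R S \<in> centre" using ST(1) by (rule subspace_scale[OF subspace_centre])
    have "S \<le> T \<longleftrightarrow> 0 \<le> T + (- 1) *\<^sub>R S" by simp
    also have "\<dots> \<longleftrightarrow> (\<forall>x\<in>topspace X. 0 \<le> Re (hat (Cplx (T + (- 1) *\<^sub>R S) 0) x))"
      using ST(2) neg by (intro star_nonneg_iff[OF star] subspace_add[OF subspace_centre])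
    also have "\<dots> \<longleftrightarrow> (\<forall>x\<in>topspace X. Re (hat (Cplx S 0) x) \<le> Re (hat (Cplx T 0) x))"
      using add[OF ST(2) neg] scale[OF ST(1), of _ "- 1"] by (intro ball_cong) auto
    finally show ?thesis .
  qed
  show "\<exists>T\<in>centre. \<forall>x\<in>topspace X. Re (hat (Cplx T 0) x) = f x"
    if f: "continuous_map X euclideanreal f" for f
  proof -
    obtain T where "T \<in> centre" "\<And>x. x \<in> topspace X \<Longrightarrow> hat (Cplx T 0) x = complex_of_real (f x)"
      using star_real_surj[OF star f] by metis
    then show ?thesis by (intro bexI[of _ T]) auto
  qed
  show "Re (hat (Cplx id_regop 0) x) = 1" if "x \<in> topspace X"
    using star_id[OF star that] by simp
qed (use assms subspace_centre Sup_in_centre centre_mult id_regop_in_centre in blast)+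

text \<open>\<open>T\<close> splits as \<open>R + iS\<close> with \<open>R\<close> and
  \<open>S\<close> central, and their images are real, so real and imaginary parts separate. This
  reduces the complex integral to two real ones.\<close>

lemma star_Re_Im:
  fixes X :: "'x topology"
    and hat :: "'a::dedekind_complete_vector_lattice regop complexification \<Rightarrow> 'x \<Rightarrow> complex"
  assumes star: "star_isomorphism X hat" and T: "T \<in> complex_centre" and x: "x \<in> topspace X"
  shows "Re (hat T x) = Re (hat (Cplx (re_part T) 0) x)" "Im (hat T x) = Re (hat (Cplx (im_part T) 0) x)"
proof -
  let ?R = "Cplx (re_part T) 0" and ?S = "Cplx (im_part T) 0"
  have c: "re_part T \<in> centre" "im_part T \<in> centre" using T by (simp_all add: complex_centre_iff)
  have "cscale \<i> ?S \<in> complex_centre"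
    using c(2) subspace_0[OF subspace_centre] by (simp add: complex_centre_iff cscale_def)
  moreover have "T = ?R + cscale \<i> ?S"
    by (simp add: complexification_eq_iff plus_complexification_def cscale_def)
  ultimately have "hat T x = hat ?R x + \<i> * hat ?S x"
    using star_add[OF star Cplx_complex_centre[OF c(1)] _ x, of "cscale \<i> ?S"]
      star_cscale[OF star Cplx_complex_centre[OF c(2)] x, of \<i>] by simp
  moreover have "Im (hat ?R x) = 0" "Im (hat ?S x) = 0"
    using star_real[OF star c(1) x] star_real[OF star c(2) x] by (metis Im_complex_of_real)+
  ultimately show "Re (hat T x) = Re (hat ?R x)" "Im (hat T x) = Re (hat ?S x)" by simp_all
qed

theorem theorem4p4:
  fixes X :: "'x topology"
    and hat :: "'a::dedekind_complete_banach_lattice regop complexification \<Rightarrow> 'x \<Rightarrow> complex"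
  assumes "normal_lattice (centre :: 'a regop set)"
    and "compact_space X" and "Hausdorff_space X"
    and "star_isomorphism X hat"
  shows "\<exists>\<mu> :: 'x set \<Rightarrow> 'a regop.
    regular_Borel_measure centre X \<mu> \<and>
    (\<forall>T\<in>centre. Cplx T 0 = order_integral centre (Borel X) \<mu> (hat (Cplx T 0))) \<and>
    (\<forall>\<nu>. regular_Borel_measure centre X \<nu> \<and>
         (\<forall>T\<in>centre. Cplx T 0 = order_integral centre (Borel X) \<nu> (hat (Cplx T 0))) \<longrightarrow>
         (\<forall>\<Delta>\<in>sets (Borel X). \<nu> \<Delta> = \<mu> \<Delta>)) \<and>
    spectral (Borel X) \<mu> \<and>
    (\<forall>\<Delta>\<in>sets (Borel X). order_projection (\<mu> \<Delta>)) \<and>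
    \<mu> (topspace X) = id_regop \<and>
    (\<forall>T\<in>complex_centre. T = order_integral centre (Borel X) \<mu> (hat T)) \<and>
    (\<forall>V. openin X V \<and> V \<noteq> {} \<longrightarrow>
       isLub centre
         {T \<in> centre. (\<forall>x\<in>topspace X. hat (Cplx T 0) x \<in> complex_of_real ` {0..1}) \<and>
                      supp X (hat (Cplx T 0)) \<subseteq> V}
         (\<mu> V)) \<and>
    (\<forall>K. compactin X K \<and> K \<noteq> {} \<longrightarrow>
       isGlb centre
         {T \<in> centre. (\<forall>x\<in>topspace X. hat (Cplx T 0) x \<in> complex_of_real ` {0..1}) \<and>
                      (\<forall>x\<in>K. hat (Cplx T 0) x = 1)}
         (\<mu> K)) \<and>
    (\<forall>V. openin X V \<and> V \<noteq> {} \<longrightarrow> 0 < \<mu> V)"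
proof -
  note star = assms(4)
  let ?h = "\<lambda>T x. Re (hat (Cplx T 0) x)"
  interpret rep: function_representation X centre id_regop ?h
    using assms(2-4) by (rule star_isomorphism_representation)
  interpret rep: normal_function_representation X centre id_regop ?h
    by unfold_locales (rule assms(1))
  have real: "hat (Cplx T 0) x = complex_of_real (?h T x)" if "T \<in> centre" "x \<in> topspace X" for T x
    using star that by (rule star_real)
  \<comment> \<open>Real values are automatic for elements of the centre, so the membership only
    constrains the real part.\<close>
  have unit: "hat (Cplx T 0) x \<in> complex_of_real ` {0..1} \<longleftrightarrow> 0 \<le> ?h T x \<and> ?h T x \<le> 1"
    if "T \<in> centre" "x \<in> topspace X" for T x
    using real[OF that] by (force simp: image_iff)
  have subordinate: "{T \<in> centre. (\<forall>x\<in>topspace X. hat (Cplx T 0) x \<in> complex_of_real ` {0..1}) \<and>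
      supp X (hat (Cplx T 0)) \<subseteq> V} = rep.subordinate V" for V
  proof -
    have "supp X (hat (Cplx T 0)) = rep.support T" if "T \<in> centre" for T
    proof -
      have "{x \<in> topspace X. hat (Cplx T 0) x \<noteq> 0} = {x \<in> topspace X. ?h T x \<noteq> 0}"
        using real[OF that] by (metis (no_types, lifting) of_real_eq_0_iff)
      then show ?thesis by (simp add: supp_def rep.support_def)
    qed
    then show ?thesis unfolding rep.subordinate_def using unit by blast
  qed
  have dominating: "{T \<in> centre. (\<forall>x\<in>topspace X. hat (Cplx T 0) x \<in> complex_of_real ` {0..1}) \<and>
      (\<forall>x\<in>K. hat (Cplx T 0) x = 1)} = rep.dominating K" if "K \<subseteq> topspace X" for K
  proof -
    have "hat (Cplx T 0) x = 1 \<longleftrightarrow> ?h T x = 1" if "T \<in> centre" "x \<in> topspace X" for T x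
      using real[OF that] by (metis of_real_eq_1_iff)
    with that show ?thesis unfolding rep.dominating_def using unit by blast
  qed
  have integral: "T = order_integral centre (Borel X) rep.\<mu> (hat T)" if T: "T \<in> complex_centre" for T
  proof -
    have c: "re_part T \<in> centre" "im_part T \<in> centre" using T by (simp_all add: complex_centre_iff)
    have cont: "continuous_map X euclideanreal (\<lambda>x. Re (hat T x))" "continuous_map X euclideanreal (\<lambda>x. Im (hat T x))"
      using continuous_map_compose[OF star_continuous[OF star T], of euclideanreal Re]
        continuous_map_compose[OF star_continuous[OF star T], of euclideanreal Im]
      by (simp_all add: o_def continuous_intros)
    \<comment> \<open>By \<open>star_Re_Im\<close> both sides are represented by the same continuous
      function.\<close>
    have "rep.J (\<lambda>x. Re (hat T x)) = re_part T" "rep.J (\<lambda>x. Im (hat T x)) = im_part T"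
      using cont c by (auto intro!: rep.h_eqI simp: rep.J_mem rep.h_J star_Re_Im[OF star T])
    then show ?thesis
      using cont by (simp add: order_integral_def rep.order_integral_real_\<mu>)
  qed
  have unique: "\<nu> \<Delta> = rep.\<mu> \<Delta>"
    if \<nu>: "regular_Borel_measure centre X \<nu>"
      and int: "\<And>T. T \<in> centre \<Longrightarrow> Cplx T 0 = order_integral centre (Borel X) \<nu> (hat (Cplx T 0))"
      and \<Delta>: "\<Delta> \<in> sets (Borel X)" for \<nu> \<Delta>
  proof (rule rep.\<mu>_unique[OF \<nu> _ \<Delta>])
    fix T :: "'a regop" assume "T \<in> centre"
    from int[OF this] show "order_integral_real centre (Borel X) \<nu> (?h T) = T"
      by (simp add: order_integral_def)
  qed
  show ?thesis
  proof (intro exI[of _ rep.\<mu>] conjI allI ballI impI)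
    show "regular_Borel_measure centre X rep.\<mu>" by (rule rep.regular_\<mu>)
    show "rep.\<mu> (topspace X) = id_regop" by (rule rep.\<mu>_topspace)
    show "spectral (Borel X) rep.\<mu>" by (simp add: spectral_def rep.\<mu>_Int)
    show "T = order_integral centre (Borel X) rep.\<mu> (hat T)" if "T \<in> complex_centre" for T
      using that by (rule integral)
    then show "Cplx T 0 = order_integral centre (Borel X) rep.\<mu> (hat (Cplx T 0))" if "T \<in> centre" for T
      using that Cplx_complex_centre by blast
    show "order_projection (rep.\<mu> \<Delta>)" if "\<Delta> \<in> sets (Borel X)" for \<Delta>
      using rep.\<mu>_Int[OF that that] rep.\<mu>_nonneg[OF that] rep.\<mu>_le_unit[OF that]
      by (simp add: order_projection_def)
  next
    fix \<nu> \<Delta>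
    assume "regular_Borel_measure centre X \<nu> \<and>
      (\<forall>T\<in>centre. Cplx T 0 = order_integral centre (Borel X) \<nu> (hat (Cplx T 0)))"
      and "\<Delta> \<in> sets (Borel X)"
    then show "\<nu> \<Delta> = rep.\<mu> \<Delta>" by (intro unique) blast+
  next
    fix V assume V: "openin X V \<and> V \<noteq> {}"
    then show "0 < rep.\<mu> V" by (intro rep.\<mu>_open_pos) auto
    show "isLub centre {T \<in> centre. (\<forall>x\<in>topspace X. hat (Cplx T 0) x \<in> complex_of_real ` {0..1}) \<and>
        supp X (hat (Cplx T 0)) \<subseteq> V} (rep.\<mu> V)"
      unfolding subordinate using V by (intro rep.isLub_\<mu>_open) blast
  next
    fix K assume K: "compactin X K \<and> K \<noteq> {}"
    then have "closedin X K" by (simp add: rep.compactin_iff_closedin)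
    then show "isGlb centre {T \<in> centre. (\<forall>x\<in>topspace X. hat (Cplx T 0) x \<in> complex_of_real ` {0..1}) \<and>
        (\<forall>x\<in>K. hat (Cplx T 0) x = 1)} (rep.\<mu> K)"
      unfolding dominating[OF closedin_subset[OF \<open>closedin X K\<close>]] by (rule rep.isGlb_\<mu>_closed)
  qed
qed

end
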